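(* Let $n\ge 1$ and $d\ge 1$ be integers, let $0<p_1,\dots,p_n\le\infty$ and $0<p<\infty$ with $\frac1{p_1}+\dots+\frac1{p_n}=\frac1p$, and let $s_1,\dots,s_n>0$. Suppose that $$\min(s_1,\dots,s_n)\le \frac d2 \qquad\text{or}\qquad \sum_{k\in J}\Big(\frac{s_k}{d}-\frac1{p_k}\Big)\le -\frac12 \ \text{ for some } J\subset\{1,\dots,n\}.$$ Then the estimate $$\|T_\sigma\|_{H^{p_1}\times\cdots\times H^{p_n}\to L^p}\lesssim \mathcal{L}^{2,(n)}_{(s_1,\dots,s_n)}[\sigma]$$ does not hold; that is, there is no constant $C<\infty$ such that $\|T_\sigma(f_1,\dots,f_n)\|_{L^p(\mathbb{R}^d)}\le C\,\mathcal{L}^{2,(n)}_{(s_1,\dots,s_n)}[\sigma]\,\prod_{j=1}^n\|f_j\|_{H^{p_j}(\mathbb{R}^d)}$ for all bounded functions $\sigma$ on $(\mathbb{R}^d)^n$ with $\mathcal{L}^{2,(n)}_{(s_1,\dots,s_n)}[\sigma]<\infty$ and all Schwartz functions $f_1,\dots,f_n$.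
   Context: For a bounded function $\sigma$ on $(\mathbb{R}^d)^n$, the $n$-linear multiplier operator is $$T_\sigma(f_1,\dots,f_n)(x)=\int_{(\mathbb{R}^d)^n}\sigma(\xi_1,\dots,\xi_n)\Big(\prod_{j=1}^n\widehat{f_j}(\xi_j)\Big)e^{2\pi i\langle x,\xi_1+\dots+\xi_n\rangle}\,d\xi_1\cdots d\xi_n$$ for Schwartz functions $f_1,\dots,f_n$ on $\mathbb{R}^d$, where $\widehat f(\xi)=\int_{\mathbb{R}^d}f(x)e^{-2\pi i\langle x,\xi\rangle}dx$. $H^{q}(\mathbb{R}^d)$ denotes the Hardy space (with $H^q=L^q$ for $1<q\le\infty$). Let $\phi^{(n)}$ be a Schwartz function on $(\mathbb{R}^d)^n$ with $\widehat{\phi^{(n)}}$ supported in $\{\vec\xi\in(\mathbb{R}^d)^n: 2^{-1}\le|\vec\xi|\le 2\}$ and $\sum_{k\in\mathbb{Z}}\widehat{\phi^{(n)}}(\vec\xi/2^k)=1$ for $\vec\xi\ne0$. The product-type Sobolev norm is $$\|f\|_{L^2_{(s_1,\dots,s_n)}((\mathbb{R}^d)^n)}=\Big(\int_{(\mathbb{R}^d)^n}\Big(\prod_{j=1}^n(1+4\pi^2|x_j|^2)^{s_j}\Big)|\widehat f(x_1,\dots,x_n)|^2\,dx_1\cdots dx_n\Big)^{1/2},$$ and $$\mathcal{L}^{2,(n)}_{(s_1,\dots,s_n)}[\sigma]=\sup_{j\in\mathbb{Z}}\big\|\sigma(2^j\cdot_1,\dots,2^j\cdot_n)\,\widehat{\phi^{(n)}}\big\|_{L^2_{(s_1,\dots,s_n)}((\mathbb{R}^d)^n)}.$$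 *)

theory Defs
  imports "HOL-Analysis.Analysis" "HOL-Probability.Essential_Supremum"
begin

definition enn_powr :: "real \<Rightarrow> ennreal \<Rightarrow> ennreal" where
  "enn_powr r a = (if a = top then top else ennreal (enn2real a powr r))"

definition recip :: "ereal \<Rightarrow> real" where
  "recip q = (if q = \<infinity> then 0 else 1 / real_of_ereal q)"

definition fourier :: "('a::euclidean_space \<Rightarrow> complex) \<Rightarrow> 'a \<Rightarrow> complex" where
  "fourier f \<xi> = (\<integral> x. f x * cis (- 2 * pi * (x \<bullet> \<xi>)) \<partial>lborel)"

fun iter_deriv :: "'a::real_normed_vector list \<Rightarrow> ('a \<Rightarrow> complex) \<Rightarrow> 'a \<Rightarrow> complex" where
  "iter_deriv [] f = f"
| "iter_deriv (v # vs) f = (\<lambda>x. frechet_derivative (iter_deriv vs f) (at x) v)"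

definition schwartz :: "('a::euclidean_space \<Rightarrow> complex) \<Rightarrow> bool" where
  "schwartz f \<longleftrightarrow>
     (\<forall>vs. set vs \<subseteq> Basis \<longrightarrow> (\<forall>x. iter_deriv vs f differentiable at x)) \<and>
     (\<forall>vs (N::nat). set vs \<subseteq> Basis \<longrightarrow>
        bounded (range (\<lambda>x. (1 + norm x) ^ N * norm (iter_deriv vs f x))))"

definition lq_norm :: "real \<Rightarrow> ('a::euclidean_space \<Rightarrow> ennreal) \<Rightarrow> ennreal" where
  "lq_norm q g = enn_powr (1 / q) (\<integral>\<^sup>+ x. enn_powr q (g x) \<partial>lborel)"

definition Lp_norm :: "ereal \<Rightarrow> ('a::euclidean_space \<Rightarrow> complex) \<Rightarrow> ennreal" where
  "Lp_norm q f = (if q = \<infinity> then esssup lborel (\<lambda>x. ennreal (norm (f x)))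
                  else lq_norm (real_of_ereal q) (\<lambda>x. ennreal (norm (f x))))"

text \<open>Gaussian e^{-pi |x|^2}, the fixed test function of the maximal characterisation.\<close>
definition gauss :: "'a::euclidean_space \<Rightarrow> real" where
  "gauss x = exp (- pi * (norm x)\<^sup>2)"

definition max_fun :: "('a::euclidean_space \<Rightarrow> complex) \<Rightarrow> 'a \<Rightarrow> ennreal" where
  "max_fun f x = (SUP t\<in>{0<..}. ennreal (norm (\<integral> y.
      complex_of_real (t powr (- real DIM('a)) * gauss ((1 / t) *\<^sub>R (x - y))) * f y \<partial>lborel)))"

text \<open>Hardy space H^q quasi-norm, 0 < q <= infinity: H^q = L^q for q > 1,
  and for q <= 1 the L^q quasi-norm of the smooth maximal function.\<close>
definition hardy_norm :: "ereal \<Rightarrow> ('a::euclidean_space \<Rightarrow> complex) \<Rightarrow> ennreal" where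
  "hardy_norm q f = (if q > 1 then Lp_norm q f else lq_norm (real_of_ereal q) (max_fun f))"

text \<open>n-linear multiplier operator; an element xi of real^'d^'n is (xi_1,...,xi_n).\<close>
definition multiplier_op ::
  "(real^'d^'n \<Rightarrow> complex) \<Rightarrow> ('n \<Rightarrow> real^'d \<Rightarrow> complex) \<Rightarrow> real^'d \<Rightarrow> complex" where
  "multiplier_op \<sigma> f x = (\<integral> \<xi>. \<sigma> \<xi> * (\<Prod>j\<in>UNIV. fourier (f j) (\<xi> $ j))
        * cis (2 * pi * (x \<bullet> (\<Sum>j\<in>UNIV. \<xi> $ j))) \<partial>lborel)"

definition sobolev_norm :: "('n \<Rightarrow> real) \<Rightarrow> (real^'d^'n \<Rightarrow> complex) \<Rightarrow> ennreal" where
  "sobolev_norm s g = enn_powr (1/2) (\<integral>\<^sup>+ x.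
      ennreal ((\<Prod>j\<in>UNIV. (1 + 4 * pi\<^sup>2 * (norm (x $ j))\<^sup>2) powr s j) * (norm (fourier g x))\<^sup>2) \<partial>lborel)"

definition admissible_phi :: "(real^'d^'n \<Rightarrow> complex) \<Rightarrow> bool" where
  "admissible_phi \<phi> \<longleftrightarrow> schwartz \<phi> \<and>
     (\<forall>\<xi>. fourier \<phi> \<xi> \<noteq> 0 \<longrightarrow> 1/2 \<le> norm \<xi> \<and> norm \<xi> \<le> 2) \<and>
     (\<forall>\<xi>. \<xi> \<noteq> 0 \<longrightarrow> ((\<lambda>k::int. fourier \<phi> ((2 powr (- real_of_int k)) *\<^sub>R \<xi>)) has_sum 1) UNIV)"

definition sobolev_L2 ::
  "(real^'d^'n \<Rightarrow> complex) \<Rightarrow> ('n \<Rightarrow> real) \<Rightarrow> (real^'d^'n \<Rightarrow> complex) \<Rightarrow> ennreal" where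
  "sobolev_L2 \<phi> s \<sigma> = (SUP j::int. sobolev_norm s
      (\<lambda>\<xi>. \<sigma> ((2 powr real_of_int j) *\<^sub>R \<xi>) * fourier \<phi> \<xi>))"

end

theory Submission
  imports Defs "HOL-Probability.Characteristic_Functions" "HOL-Probability.Sinc_Integral"
    "HOL-Computational_Algebra.Polynomial"
begin

text \<open>
  Write \<open>e(t) = cis (2 pi t)\<close> and \<open>\<phi>^\<close> for the Fourier transform of \<open>\<phi>\<close>.
  For a finite set \<open>Y\<close> of lattice points of \<open>\<real>\<^sup>d\<close> the symbol
  \<open>\<sigma>(\<xi>) = \<phi>^(\<xi>) \<Sum>y\<in>Y. c(y) e(y \<bullet> \<Sum>j\<in>J. \<xi>(j))\<close> has norm at most a constant times
  \<open>(\<Sum>y\<in>Y. |c(y)|\<^sup>2 (1 + |y|) ^ (2 \<Sum>j\<in>J. s(j)))\<close> to the power one half, and \<open>T\<^sub>\<sigma>(f)(x)\<close> is the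
  sum of the \<open>c(y) F(X)\<close>, where \<open>F\<close> is the convolution of \<open>\<phi>\<close> with the tensor product of the \<open>f(j)\<close>,
  and \<open>X(j) = x + y\<close> for \<open>j \<in> J\<close>, \<open>X(j) = x\<close> otherwise. Take \<open>Y\<close> to fill \<open>K\<close> dyadic shells and put
  \<open>\<Lambda> = \<Sum>y\<in>Y. (1 + |y|) ^ (-d)\<close>, which is at least of order \<open>K\<close>.

  If the sum of \<open>s(k)/d - 1/p(k)\<close> over \<open>J\<close> is at most \<open>-1/2\<close>, let \<open>f(j)\<close> be fixed for \<open>j \<in> J\<close>, let
  \<open>f(k)\<close> be the signed sum of the \<open>K\<close> dilates \<open>2 ^ (-m d/p(k)) \<psi>(x / 2 ^ m)\<close> for \<open>k \<notin> J\<close>, and let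
  \<open>|c(y)| = (1 + |y|) ^ (-d \<Sum>j\<in>J. 1/p(j))\<close> with arbitrary signs. Averaging over all signs isolates the
  resonant terms and gives \<open>\<Lambda> ^ (1/p)\<close> on the left, against \<open>\<Lambda> ^ (1/2) K ^ (\<Sum>k\<notin>J. 1/p(k))\<close> on the
  right; as \<open>\<Sum>j\<in>J. 1/p(j) > 1/2\<close>, this is absurd for large \<open>K\<close>.

  If \<open>s(i) \<le> d/2\<close> and \<open>p(i) \<le> 1\<close>, the previous case applies to \<open>J = {i}\<close>. If \<open>p(i) > 1\<close>, let
  \<open>c(y) = (1 + |y|) ^ (-d) e(-a \<bullet> y)\<close>, let \<open>f(i)\<close> be a wide Gaussian of frequency \<open>a\<close> and let the other
  \<open>f(j)\<close> be wide; then \<open>\<Lambda>\<close> would be bounded by a multiple of \<open>\<Lambda> ^ (1/2)\<close>.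
\<close>

section \<open>Lebesgue integrals on Euclidean spaces\<close>

text \<open>\<open>p\<close> and the \<open>p(j)\<close> may be below 1, so neither duality nor
  convexity of the norm is at hand, and near \<open>-y\<close> every other lattice point and every
  other dilate could cancel the resonant term. The signs remove this interference. A flip multiplies
  by a common sign all signs of the lattice sum except the one at \<open>y\<close>, and likewise,
  for each wide input, all signs except that of the resonant dilate. It permutes the sign patterns,
  and the resonant term is the mean of the flipped sums, hence at most the largest of them in
  modulus. The number of flips depends on \<open>J\<close> and on the number of variables but not on
  \<open>K\<close>, so nothing is lost as \<open>K\<close> grows. The exponents balance because
  \<open>1/p\<close> is the sum of the \<open>1/p(j)\<close>: the resonant term at \<open>y\<close>
  has size \<open>(1 + |y|) ^ (-d/p)\<close>, and the \<open>p\<close>-th powers add up to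
  \<open>\<Lambda>\<close>. The hypothesis on \<open>J\<close> is exactly what keeps the symbol norm
  below a multiple of \<open>\<Lambda> ^ (1/2)\<close>; positivity of the \<open>s(j)\<close> makes
  the inequality for the sum of the \<open>1/p(j)\<close> strict. At equality in the hypotheses the
  divergence is only logarithmic in the radius, which is why shells are counted.\<close>

lemma nn_integral_lborel_affine:
  fixes f :: "'a::euclidean_space \<Rightarrow> ennreal"
  assumes [measurable]: "f \<in> borel_measurable borel" and c: "c \<noteq> 0"
  shows "(\<integral>\<^sup>+x. f (t + c *\<^sub>R x) \<partial>lborel) = ennreal ((1 / \<bar>c\<bar>) ^ DIM('a)) * (\<integral>\<^sup>+x. f x \<partial>lborel)"
proof -
  have "(\<integral>\<^sup>+x. f x \<partial>lborel) = ennreal (\<bar>c\<bar> ^ DIM('a)) * (\<integral>\<^sup>+x. f (t + c *\<^sub>R x) \<partial>lborel)"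
    by (subst lborel_affine[OF c, of t])
       (simp add: nn_integral_density nn_integral_distr nn_integral_cmult)
  then have "ennreal ((1 / \<bar>c\<bar>) ^ DIM('a)) * (\<integral>\<^sup>+x. f x \<partial>lborel)
     = ennreal ((1 / \<bar>c\<bar>) ^ DIM('a)) * ennreal (\<bar>c\<bar> ^ DIM('a)) * (\<integral>\<^sup>+x. f (t + c *\<^sub>R x) \<partial>lborel)"
    by (simp add: mult.assoc)
  also have "ennreal ((1 / \<bar>c\<bar>) ^ DIM('a)) * ennreal (\<bar>c\<bar> ^ DIM('a)) = 1"
    using c by (simp add: ennreal_mult[symmetric] power_mult_distrib[symmetric])
  finally show ?thesis by simp
qed

lemma integrable_lborel_affine:
  fixes f :: "'a::euclidean_space \<Rightarrow> 'b::{banach, second_countable_topology}"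
  assumes f: "integrable lborel f" and c: "c \<noteq> 0"
  shows "integrable lborel (\<lambda>x. f (t + c *\<^sub>R x))"
  using f f[THEN borel_measurable_integrable] c unfolding integrable_iff_bounded
  by (subst nn_integral_lborel_affine[where f="\<lambda>x. ennreal (norm (f x))"]) (auto simp: ennreal_mult_less_top)

lemma integrable_lborel_affine_iff:
  fixes f :: "'a::euclidean_space \<Rightarrow> 'b::{banach, second_countable_topology}"
  assumes c: "c \<noteq> 0"
  shows "integrable lborel (\<lambda>x. f (t + c *\<^sub>R x)) \<longleftrightarrow> integrable lborel f"
  using integrable_lborel_affine[of f c t] c
    integrable_lborel_affine[of "\<lambda>x. f (t + c *\<^sub>R x)" "1/c" "- (1/c) *\<^sub>R t"]
  by (auto simp: algebra_simps)

lemma integral_lborel_affine: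
  fixes f :: "'a::euclidean_space \<Rightarrow> 'b::{banach, second_countable_topology}"
  assumes c: "c \<noteq> 0"
  shows "(\<integral>x. f (t + c *\<^sub>R x) \<partial>lborel) = ((1 / \<bar>c\<bar>) ^ DIM('a)) *\<^sub>R (\<integral>x. f x \<partial>lborel)"
proof cases
  assume f: "integrable lborel f"
  note [measurable] = borel_measurable_integrable[OF f]
  have "(\<integral>x. f x \<partial>lborel) = (\<bar>c\<bar> ^ DIM('a)) *\<^sub>R (\<integral>x. f (t + c *\<^sub>R x) \<partial>lborel)"
    using c f integrable_lborel_affine[OF f c]
    by (subst lborel_affine[OF c, of t]) (simp add: integral_density integral_distr)
  then show ?thesis using c by (simp add: power_mult_distrib[symmetric])
next
  \<comment> \<open>Without integrability both Bochner integrals have the default value 0.\<close>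
  assume "\<not> integrable lborel f" with c show ?thesis
    by (simp add: integrable_lborel_affine_iff not_integrable_integral_eq)
qed

lemma integral_lborel_shift:
  fixes f :: "'a::euclidean_space \<Rightarrow> 'b::{banach, second_countable_topology}"
  shows "(\<integral>x. f (x + t) \<partial>lborel) = (\<integral>x. f x \<partial>lborel)"
  using integral_lborel_affine[of 1 f t] by (simp add: add.commute)

lemma integrable_lborel_shift:
  fixes f :: "'a::euclidean_space \<Rightarrow> 'b::{banach, second_countable_topology}"
  shows "integrable lborel f \<Longrightarrow> integrable lborel (\<lambda>x. f (x + t))"
  using integrable_lborel_affine[of f 1 t] by (simp add: add.commute)

lemma integral_lborel_reflect:
  fixes f :: "'a::euclidean_space \<Rightarrow> 'b::{banach, second_countable_topology}"
  shows "(\<integral>x. f (t - x) \<partial>lborel) = (\<integral>x. f x \<partial>lborel)"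
  using integral_lborel_affine[of "-1" f t] by simp

text \<open>Lebesgue measure is the image of the product measure over \<open>Basis\<close> under the
  coordinate map, so the product formula for finite products of measures carries over.\<close>

lemma
  fixes f :: "'a::euclidean_space \<Rightarrow> real \<Rightarrow> 'b::{real_normed_field, banach, second_countable_topology}"
  assumes f: "\<And>b. b \<in> Basis \<Longrightarrow> integrable lborel (f b)"
  shows integrable_lborel_prod_Basis: "integrable lborel (\<lambda>x. \<Prod>b\<in>Basis. f b (x \<bullet> b))" (is ?I)
    and integral_lborel_prod_Basis:
      "(\<integral>x. (\<Prod>b\<in>Basis. f b (x \<bullet> b)) \<partial>lborel) = (\<Prod>b\<in>Basis. \<integral>x. f b x \<partial>lborel)" (is ?E)
proof -
  interpret product_sigma_finite "\<lambda>b::'a. lborel :: real measure"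
    by standard
  note m[measurable] = borel_measurable_integrable[OF f, simplified]
  have meas: "(\<lambda>x. \<Prod>b\<in>Basis. f b (x \<bullet> b)) \<in> borel_measurable borel"
    by (intro borel_measurable_prod measurable_compose[OF _ m]) auto
  have T[measurable]: "(\<lambda>g. \<Sum>b\<in>Basis. g b *\<^sub>R b) \<in> (\<Pi>\<^sub>M b\<in>(Basis::'a set). lborel) \<rightarrow>\<^sub>M (borel :: 'a measure)"
    by measurable
  have eq: "(\<Prod>b\<in>Basis. f b ((\<Sum>b'\<in>Basis. g b' *\<^sub>R b') \<bullet> b)) = (\<Prod>b\<in>Basis. f b (g b))" for g
    by (intro prod.cong refl) (simp add: inner_sum_left_Basis)
  show ?I
    by (subst lborel_eq, subst integrable_distr_eq[OF T meas], subst eq)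
       (rule product_integrable_prod, auto intro: f)
  show ?E
    by (subst lborel_eq, subst integral_distr[OF T meas], subst eq)
       (rule product_integral_prod, auto intro: f)
qed

section \<open>Lebesgue measure on blocks of variables\<close>

lemma borel_measurable_vec_nth [measurable]:
  "(\<lambda>x::('a::euclidean_space)^'n. x $ j) \<in> borel_measurable borel"
  by (intro borel_measurable_continuous_onI continuous_intros)

lemma measurable_vec_lambda_lborel:
  "(vec_lambda :: ('n \<Rightarrow> 'a::euclidean_space) \<Rightarrow> 'a^'n) \<in> (\<Pi>\<^sub>M j\<in>UNIV. lborel) \<rightarrow>\<^sub>M borel"
proof (subst borel_measurable_iff_halfspace_le, intro ballI allI)
  fix c :: real and b :: "'a^'n" assume "b \<in> Basis"
  have "(\<lambda>w. vec_lambda w \<bullet> b) \<in> borel_measurable (\<Pi>\<^sub>M j\<in>(UNIV::'n set). (lborel::'a measure))"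
    unfolding inner_vec_def by simp
  then show "{w \<in> space (\<Pi>\<^sub>M j\<in>(UNIV::'n set). (lborel::'a measure)). vec_lambda w \<bullet> b \<le> c} \<in> sets (\<Pi>\<^sub>M j\<in>UNIV. lborel)"
    by simp
qed

text \<open>Lebesgue measure is determined by its values on boxes, and the basis vectors of the
  block space are the \<open>axis j b\<close>, so a box is a product over \<open>j\<close> of boxes
  in the factors. This gives access to one variable \<open>z $ j\<close> at a time.\<close>

lemma lborel_vec_eq:
  "(lborel :: (('a::euclidean_space)^'n) measure) = distr (\<Pi>\<^sub>M j\<in>UNIV. lborel) borel vec_lambda"
proof (rule lborel_eqI)
  interpret product_sigma_finite "\<lambda>j::'n. lborel :: 'a measure"
    by standard
  note [measurable] = measurable_vec_lambda_lborel
  fix l u :: "'a^'n"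
  assume le: "\<And>b. b \<in> Basis \<Longrightarrow> l \<bullet> b \<le> u \<bullet> b"
  have le': "l $ j \<bullet> b \<le> u $ j \<bullet> b" if "b \<in> Basis" for j b
    using le[of "axis j b"] that by (auto simp: Basis_vec_def inner_axis)
  have bij: "bij_betw (\<lambda>(j, b). axis j b) (UNIV \<times> Basis) (Basis :: ('a^'n) set)"
    by (auto simp: bij_betw_def Basis_vec_def inj_on_def axis_eq_axis)
  have "vec_lambda -` box l u \<inter> space (\<Pi>\<^sub>M j\<in>UNIV. lborel) = (\<Pi>\<^sub>E j\<in>UNIV. box (l $ j) (u $ j))"
    by (auto simp: box_def Basis_vec_def inner_axis space_PiM PiE_def)
  then have "emeasure (distr (\<Pi>\<^sub>M j\<in>UNIV. lborel) borel vec_lambda) (box l u)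
     = emeasure (\<Pi>\<^sub>M j\<in>UNIV. lborel) (\<Pi>\<^sub>E j\<in>UNIV. box (l $ j) (u $ j))"
    by (simp add: emeasure_distr)
  also have "\<dots> = (\<Prod>j\<in>UNIV. emeasure lborel (box (l $ j) (u $ j)))"
    by (rule emeasure_PiM) auto
  also have "\<dots> = (\<Prod>j\<in>UNIV. ennreal (\<Prod>b\<in>Basis. (u $ j - l $ j) \<bullet> b))"
    using le' by (simp)
  also have "\<dots> = ennreal (\<Prod>j\<in>UNIV. \<Prod>b\<in>Basis. (u $ j - l $ j) \<bullet> b)"
    by (subst prod_ennreal) (auto intro!: prod_nonneg simp: inner_diff_left le')
  also have "(\<Prod>j\<in>UNIV. \<Prod>b\<in>Basis. (u $ j - l $ j) \<bullet> b) = (\<Prod>(j, b)\<in>UNIV \<times> Basis. (u $ j - l $ j) \<bullet> b)"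
    by (rule prod.cartesian_product)
  also have "\<dots> = (\<Prod>b\<in>Basis. (u - l) \<bullet> b)"
    by (subst prod.reindex_bij_betw[OF bij, symmetric]) (auto intro!: prod.cong simp: inner_axis)
  finally show "emeasure (distr (\<Pi>\<^sub>M j\<in>UNIV. lborel) borel vec_lambda) (box l u) = (\<Prod>b\<in>Basis. (u - l) \<bullet> b)" .
qed simp

lemma
  fixes f :: "'n::finite \<Rightarrow> 'a::euclidean_space \<Rightarrow> 'b::{real_normed_field, banach, second_countable_topology}"
  assumes f: "\<And>j. integrable lborel (f j)"
  shows integrable_lborel_prod_vec: "integrable lborel (\<lambda>x. \<Prod>j\<in>UNIV. f j (x $ j))" (is ?I)
    and integral_lborel_prod_vec:
      "(\<integral>x. (\<Prod>j\<in>UNIV. f j (x $ j)) \<partial>lborel) = (\<Prod>j\<in>UNIV. \<integral>x. f j x \<partial>lborel)" (is ?E)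
proof -
  interpret product_sigma_finite "\<lambda>j::'n. lborel :: 'a measure"
    by standard
  note m[measurable] = borel_measurable_integrable[OF f, simplified]
  have meas: "(\<lambda>x. \<Prod>j\<in>UNIV. f j (x $ j)) \<in> borel_measurable borel"
    by (intro borel_measurable_prod measurable_compose[OF _ m]) auto
  note T = measurable_vec_lambda_lborel
  show ?I
    by (subst lborel_vec_eq, subst integrable_distr_eq[OF T meas]) 
       (simp, rule product_integrable_prod, auto intro: f)
  show ?E
    by (subst lborel_vec_eq, subst integral_distr[OF T meas])
       (simp, rule product_integral_prod, auto intro: f)
qed

section \<open>Integrable polynomial weights\<close>

lemma integrable_inverse_one_plus_abs_sq: "integrable lborel (\<lambda>t::real. inverse (1 + \<bar>t\<bar>) ^ 2)"
proof (rule Bochner_Integration.integrable_bound)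
  show "integrable lborel (\<lambda>t::real. inverse (1 + t\<^sup>2))"
    using integrable_inverse_1_plus_square by (simp add: set_integrable_def)
qed (auto intro!: AE_I2 frac_le add_pos_nonneg simp: power2_eq_square field_simps)

text \<open>The threshold \<open>2 * DIM('a)\<close> gives each coordinate the exponent 2, so that a
  product of one-dimensional integrable functions dominates and polar coordinates are avoided. The
  same threshold reappears in every decay exponent chosen later.\<close>

lemma integrable_one_plus_norm_powr:
  assumes a: "a \<ge> 2 * real DIM('a)"
  shows "integrable lborel (\<lambda>x::'a::euclidean_space. (1 + norm x) powr (- a))"
proof (rule Bochner_Integration.integrable_bound)
  show "integrable lborel (\<lambda>x::'a. \<Prod>b\<in>Basis. inverse (1 + \<bar>x \<bullet> b\<bar>) ^ 2)"
    by (rule integrable_lborel_prod_Basis) (rule integrable_inverse_one_plus_abs_sq)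
  have "norm ((1 + norm x) powr - a) \<le> norm (\<Prod>b\<in>Basis. (inverse (1 + \<bar>x \<bullet> b\<bar>))\<^sup>2)" for x :: 'a
  proof -
    have "(1 + norm x) powr - a \<le> (1 + norm x) powr - (real (2 * DIM('a)))"
      using a by (intro powr_mono) auto
    also have "\<dots> = inverse ((1 + norm x) ^ (2 * DIM('a)))"
      by (subst powr_minus, subst powr_realpow) (auto intro: add_pos_nonneg)
    also have "\<dots> = (\<Prod>b\<in>(Basis::'a set). (inverse (1 + norm x))\<^sup>2)"
      by (simp add: power_mult power_inverse)
    also have "\<dots> \<le> (\<Prod>b\<in>Basis. (inverse (1 + \<bar>x \<bullet> b\<bar>))\<^sup>2)"
      by (intro prod_mono) (auto intro!: power_mono le_imp_inverse_le Basis_le_norm add_pos_nonneg)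
    finally show ?thesis by (simp add: prod_nonneg)
  qed
  then show "AE x in lborel. norm ((1 + norm (x::'a)) powr - a) \<le> norm (\<Prod>b\<in>Basis. (inverse (1 + \<bar>x \<bullet> b\<bar>))\<^sup>2)"
    by simp
qed simp


section \<open>Gaussians and Fourier inversion\<close>

text \<open>The integrable tensor product of \<open>f\<close> and \<open>g\<close> dominates. The
  kernels met below are unimodular exponentials, so this covers all exchanges of a Fourier integral
  with another integral.\<close>

lemma integrable_pair_bounded_kernel:
  fixes f :: "'a::euclidean_space \<Rightarrow> complex" and g :: "'b::euclidean_space \<Rightarrow> complex"
  assumes f: "integrable lborel f" and g: "integrable lborel g"
    and k[measurable]: "(\<lambda>(x, y). k x y) \<in> borel_measurable (lborel \<Otimes>\<^sub>M lborel)"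
    and k1: "\<And>x y. norm (k x y :: complex) \<le> 1"
  shows "integrable (lborel \<Otimes>\<^sub>M lborel) (\<lambda>(x, y). f x * g y * k x y)"
proof (rule Bochner_Integration.integrable_bound)
  note [measurable] = borel_measurable_integrable[OF f] borel_measurable_integrable[OF g]
  show "integrable (lborel \<Otimes>\<^sub>M lborel) (\<lambda>(x, y). f x * g y)"
  proof (rule lborel_pair.Fubini_integrable)
    show "integrable lborel (\<lambda>x. \<integral>y. norm (case (x, y) of (x, y) \<Rightarrow> f x * g y) \<partial>lborel)"
      using f by (simp add: norm_mult)
  qed (use g in auto)
  show "AE z in lborel \<Otimes>\<^sub>M lborel. norm (case z of (x, y) \<Rightarrow> f x * g y * k x y) \<le> norm (case z of (x, y) \<Rightarrow> f x * g y)"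
    using k1 by (auto intro!: AE_I2 mult_left_le simp: norm_mult)
  show "(\<lambda>(x, y). f x * g y * k x y) \<in> borel_measurable (lborel \<Otimes>\<^sub>M lborel)"
    using k unfolding split_beta' by measurable
qed

lemma Fubini_bounded_kernel:
  fixes f :: "'a::euclidean_space \<Rightarrow> complex" and g :: "'b::euclidean_space \<Rightarrow> complex"
  assumes f: "integrable lborel f" and g: "integrable lborel g"
    and k: "(\<lambda>(x, y). k x y) \<in> borel_measurable (lborel \<Otimes>\<^sub>M lborel)"
    and k1: "\<And>x y. norm (k x y :: complex) \<le> 1"
  shows "(\<integral>x. f x * (\<integral>y. g y * k x y \<partial>lborel) \<partial>lborel) = (\<integral>y. g y * (\<integral>x. f x * k x y \<partial>lborel) \<partial>lborel)"
proof -
  have "(\<integral>y. (\<integral>x. f x * g y * k x y \<partial>lborel) \<partial>lborel) = (\<integral>x. (\<integral>y. f x * g y * k x y \<partial>lborel) \<partial>lborel)"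
    by (rule lborel_pair.Fubini_integral[OF integrable_pair_bounded_kernel[OF assms]])
  moreover have "f x * (\<integral>y. g y * k x y \<partial>lborel) = (\<integral>y. f x * g y * k x y \<partial>lborel)" for x
    unfolding mult.assoc by (rule integral_mult_right_zero[symmetric])
  moreover have "g y * (\<integral>x. f x * k x y \<partial>lborel) = (\<integral>x. f x * g y * k x y \<partial>lborel)" for y
    unfolding mult.assoc by (subst integral_mult_right_zero[symmetric]) (simp add: mult.left_commute)
  ultimately show ?thesis by simp
qed

lemma integrable_mult_bounded:
  fixes f g :: "'a::euclidean_space \<Rightarrow> complex"
  assumes f: "integrable lborel f" and g[measurable]: "g \<in> borel_measurable borel" and b: "\<And>x. norm (g x) \<le> B"
  shows "integrable lborel (\<lambda>x. f x * g x)"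
proof (rule Bochner_Integration.integrable_bound)
  note [measurable] = borel_measurable_integrable[OF f]
  show "integrable lborel (\<lambda>x. f x * of_real B)" using f by simp
  show "AE x in lborel. norm (f x * g x) \<le> norm (f x * complex_of_real B)"
    using order_trans[OF b abs_ge_self] by (auto intro!: AE_I2 mult_left_mono simp: norm_mult)
  show "(\<lambda>x. f x * g x) \<in> borel_measurable lborel" by measurable
qed

lemma integrable_times_cis:
  fixes f :: "'a::euclidean_space \<Rightarrow> complex"
  assumes f: "integrable lborel f" and g: "continuous_on UNIV g"
  shows "integrable lborel (\<lambda>x. f x * cis (g x))"
  by (rule integrable_mult_bounded[OF f, of _ 1])
     (auto intro!: borel_measurable_continuous_onI continuous_intros g)

lemma borel_measurable_cis [measurable (raw)]:
  "f \<in> borel_measurable M \<Longrightarrow> (\<lambda>x. cis (f x)) \<in> borel_measurable M"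
  by (rule measurable_compose[of f M borel cis])
     (auto intro!: borel_measurable_continuous_onI continuous_intros)

section \<open>The Gaussian and its Fourier transform\<close>

lemma continuous_on_gauss [continuous_intros]:
  "continuous_on S f \<Longrightarrow> continuous_on S (\<lambda>x. gauss (f x))"
  unfolding gauss_def by (intro continuous_intros)

lemma gauss_pos [simp]: "0 < gauss x" by (simp add: gauss_def)

lemma gauss_nonneg [simp]: "0 \<le> gauss x" by (simp add: gauss_def)

lemma gauss_le_1 [simp]: "gauss x \<le> 1" by (simp add: gauss_def)

lemma gauss_zero [simp]: "gauss 0 = 1" by (simp add: gauss_def)

lemma borel_measurable_gauss [measurable (raw)]:
  "f \<in> borel_measurable M \<Longrightarrow> (\<lambda>x. gauss (f x :: 'a::euclidean_space)) \<in> borel_measurable M"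
  unfolding gauss_def by measurable

lemma gauss_uminus [simp]: "gauss (- x) = gauss x" by (simp add: gauss_def)

lemma gauss_prod: "gauss x = (\<Prod>b\<in>Basis. gauss (x \<bullet> b))" for x :: "'a::euclidean_space"
proof -
  have "(norm x)\<^sup>2 = (\<Sum>b\<in>Basis. (x \<bullet> b)\<^sup>2)"
    by (subst power2_norm_eq_inner, subst euclidean_inner) (simp add: power2_eq_square)
  then show ?thesis by (simp add: gauss_def exp_sum[symmetric] sum_distrib_left)
qed

lemma cis_sum: "finite A \<Longrightarrow> cis (\<Sum>a\<in>A. f a) = (\<Prod>a\<in>A. cis (f a))"
  by (induction A rule: finite_induct) (auto simp: cis_mult[symmetric])

text \<open>The substitution \<open>x = sqrt (2 * pi) * t\<close> turns the Gaussian into the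
  standard normal density, whose characteristic function is known.\<close>

lemma fourier_gauss_real:
  fixes s :: real
  shows "integrable lborel (gauss :: real \<Rightarrow> real)"
    and "(\<integral>t. complex_of_real (gauss t) * cis (- 2 * pi * (t * s)) \<partial>lborel) = complex_of_real (gauss s)"
proof -
  have dens: "std_normal_density (sqrt (2 * pi) * t) = gauss t / sqrt (2 * pi)" for t
    by (simp add: std_normal_density_def gauss_def power_mult_distrib)
  have int: "integrable lborel std_normal_density" by simp
  have "integrable lborel (\<lambda>t. std_normal_density (0 + sqrt (2 * pi) * t))"
    by (rule lborel_integrable_real_affine[OF int]) simp
  from integrable_mult_right[OF this, of "sqrt (2 * pi)"] show "integrable lborel (gauss :: real \<Rightarrow> real)"
    by (simp add: dens)
  define u where "u = - sqrt (2 * pi) * s"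
  have "complex_of_real (gauss s) = char std_normal_distribution u"
    by (simp add: char_std_normal_distribution u_def gauss_def power_mult_distrib)
  also have "\<dots> = (\<integral>x. std_normal_density x *\<^sub>R cis (u * x) \<partial>lborel)"
    unfolding char_def by (subst integral_density) (auto simp: cis_conv_exp)
  also have "\<dots> = sqrt (2 * pi) *\<^sub>R (\<integral>t. std_normal_density (0 + sqrt (2 * pi) * t) *\<^sub>R cis (u * (0 + sqrt (2 * pi) * t)) \<partial>lborel)"
    by (subst lborel_integral_real_affine[of "sqrt (2 * pi)" _ 0]) auto
  also have "\<dots> = (\<integral>t. complex_of_real (gauss t) * cis (- 2 * pi * (t * s)) \<partial>lborel)"
  proof -
    have "u * (sqrt (2 * pi) * t) = - 2 * pi * (t * s)" for t
    proof -
      have "u * (sqrt (2 * pi) * t) = - (sqrt (2 * pi) * sqrt (2 * pi)) * (s * t)"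
        by (simp add: u_def)
      then show ?thesis by (simp only: real_sqrt_mult_self) (simp)
    qed
    then show ?thesis
      unfolding integral_scaleR_right[symmetric] by (simp add: dens scaleR_conv_of_real)
  qed
  finally show "(\<integral>t. complex_of_real (gauss t) * cis (- 2 * pi * (t * s)) \<partial>lborel) = complex_of_real (gauss s)" ..
qed

lemma integrable_gauss: "integrable lborel (gauss :: 'a::euclidean_space \<Rightarrow> real)"
  by (subst ext[of gauss, OF gauss_prod]) (rule integrable_lborel_prod_Basis, rule fourier_gauss_real)

lemma integrable_complex_gauss: "integrable lborel (\<lambda>x::'a::euclidean_space. complex_of_real (gauss x))"
  by (rule integrable_of_real[OF integrable_gauss])

lemma fourier_gauss: "fourier (\<lambda>x. complex_of_real (gauss x)) \<xi> = complex_of_real (gauss (\<xi> :: 'a::euclidean_space))"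
proof -
  have eq: "complex_of_real (gauss x) * cis (- 2 * pi * (x \<bullet> \<xi>))
     = (\<Prod>b\<in>Basis. complex_of_real (gauss (x \<bullet> b)) * cis (- 2 * pi * ((x \<bullet> b) * (\<xi> \<bullet> b))))" for x
    by (subst euclidean_inner, subst gauss_prod)
       (simp add: sum_distrib_left prod.distrib cis_sum[symmetric])
  have "fourier (\<lambda>x. complex_of_real (gauss x)) \<xi>
     = (\<Prod>b\<in>Basis. \<integral>t. complex_of_real (gauss t) * cis (- 2 * pi * (t * (\<xi> \<bullet> b))) \<partial>lborel)"
    unfolding fourier_def eq
    by (rule integral_lborel_prod_Basis)
       (intro integrable_times_cis integrable_of_real fourier_gauss_real continuous_intros)
  also have "\<dots> = complex_of_real (gauss \<xi>)"
    by (simp only: fourier_gauss_real gauss_prod[of \<xi>] of_real_prod)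
  finally show ?thesis .
qed

lemma integral_gauss: "(\<integral>x. gauss (x :: 'a::euclidean_space) \<partial>lborel) = 1"
proof -
  have "(\<integral>x. complex_of_real (gauss (x :: 'a)) \<partial>lborel) = 1"
    using fourier_gauss[of "0::'a"] by (simp add: fourier_def)
  then have "complex_of_real (\<integral>x. gauss (x :: 'a) \<partial>lborel) = 1"
    by (subst (asm) integral_complex_of_real)
  then show ?thesis by simp
qed

lemma fourier_gauss_scaled:
  fixes w :: "'a::euclidean_space"
  assumes e: "\<epsilon> > 0"
  shows "integrable lborel (\<lambda>x::'a. complex_of_real (gauss (\<epsilon> *\<^sub>R x)))"
    and "(\<integral>x. complex_of_real (gauss (\<epsilon> *\<^sub>R x)) * cis (2 * pi * (x \<bullet> w)) \<partial>lborel)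
     = complex_of_real ((1 / \<epsilon>) ^ DIM('a) * gauss ((1 / \<epsilon>) *\<^sub>R w))"
proof -
  show "integrable lborel (\<lambda>x::'a. complex_of_real (gauss (\<epsilon> *\<^sub>R x)))"
    using integrable_lborel_affine[OF integrable_complex_gauss, of \<epsilon> 0] e by simp
  have "(\<integral>x. complex_of_real (gauss (\<epsilon> *\<^sub>R x)) * cis (2 * pi * (x \<bullet> w)) \<partial>lborel)
    = (\<integral>x. (\<lambda>y. complex_of_real (gauss y) * cis (- 2 * pi * (y \<bullet> ((- 1 / \<epsilon>) *\<^sub>R w)))) (0 + \<epsilon> *\<^sub>R x) \<partial>lborel)"
    using e by (intro Bochner_Integration.integral_cong) auto
  also have "\<dots> = (1 / \<bar>\<epsilon>\<bar>) ^ DIM('a) *\<^sub>R (\<integral>y. complex_of_real (gauss y) * cis (- 2 * pi * (y \<bullet> ((- 1 / \<epsilon>) *\<^sub>R w))) \<partial>lborel)"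
    using e by (intro integral_lborel_affine) simp
  also have "\<dots> = complex_of_real ((1 / \<epsilon>) ^ DIM('a) * gauss ((1 / \<epsilon>) *\<^sub>R w))"
    using fourier_gauss[of "(- 1 / \<epsilon>) *\<^sub>R w"] e
    by (simp add: fourier_def scaleR_conv_of_real gauss_def)
  finally show "(\<integral>x. complex_of_real (gauss (\<epsilon> *\<^sub>R x)) * cis (2 * pi * (x \<bullet> w)) \<partial>lborel)
     = complex_of_real ((1 / \<epsilon>) ^ DIM('a) * gauss ((1 / \<epsilon>) *\<^sub>R w))" .
qed

text \<open>Gaussian summation: the inversion integral is damped by
  \<open>gauss (\<epsilon> \<xi>)\<close>. As \<open>\<epsilon>\<close> tends to 0 it converges to
  the undamped integral, with the modulus of the transform as majorant, and also to
  \<open>f x\<close>.\<close>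

lemma fourier_inversion:
  fixes f :: "'a::euclidean_space \<Rightarrow> complex"
  assumes f: "integrable lborel f" and cont: "continuous_on UNIV f" and bd: "\<And>x. norm (f x) \<le> B"
    and fh: "integrable lborel (fourier f)"
  shows "(\<integral>\<xi>. fourier f \<xi> * cis (2 * pi * (x \<bullet> \<xi>)) \<partial>lborel) = f x"
proof (rule LIMSEQ_unique)
  note [measurable] = borel_measurable_integrable[OF f] borel_measurable_integrable[OF fh]
  define \<epsilon> where "\<epsilon> n = inverse (real (Suc n))" for n
  have e: "\<epsilon> n > 0" for n by (simp add: \<epsilon>_def)
  have lim: "\<epsilon> \<longlonglongrightarrow> 0" unfolding \<epsilon>_def by (rule LIMSEQ_inverse_real_of_nat)
  define A where "A n = (\<integral>\<xi>. fourier f \<xi> * cis (2 * pi * (x \<bullet> \<xi>)) * complex_of_real (gauss (\<epsilon> n *\<^sub>R \<xi>)) \<partial>lborel)" for n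
  show "A \<longlonglongrightarrow> (\<integral>\<xi>. fourier f \<xi> * cis (2 * pi * (x \<bullet> \<xi>)) \<partial>lborel)"
    unfolding A_def
  proof (rule integral_dominated_convergence[where w="\<lambda>\<xi>. norm (fourier f \<xi>)"])
    show "AE \<xi> in lborel. (\<lambda>n. fourier f \<xi> * cis (2 * pi * (x \<bullet> \<xi>)) * complex_of_real (gauss (\<epsilon> n *\<^sub>R \<xi>)))
        \<longlonglongrightarrow> fourier f \<xi> * cis (2 * pi * (x \<bullet> \<xi>))"
    proof (rule AE_I2)
      fix \<xi> :: 'a
      have "(\<lambda>n. gauss (\<epsilon> n *\<^sub>R \<xi>)) \<longlonglongrightarrow> gauss (0 *\<^sub>R \<xi>)"
        unfolding gauss_def by (intro tendsto_intros lim)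
      then have "(\<lambda>n. fourier f \<xi> * cis (2 * pi * (x \<bullet> \<xi>)) * complex_of_real (gauss (\<epsilon> n *\<^sub>R \<xi>)))
        \<longlonglongrightarrow> fourier f \<xi> * cis (2 * pi * (x \<bullet> \<xi>)) * complex_of_real (gauss (0 *\<^sub>R \<xi>))"
        by (intro tendsto_intros)
      then show "(\<lambda>n. fourier f \<xi> * cis (2 * pi * (x \<bullet> \<xi>)) * complex_of_real (gauss (\<epsilon> n *\<^sub>R \<xi>)))
        \<longlonglongrightarrow> fourier f \<xi> * cis (2 * pi * (x \<bullet> \<xi>))"
        by (simp add: gauss_def)
    qed
    show "AE \<xi> in lborel. norm (fourier f \<xi> * cis (2 * pi * (x \<bullet> \<xi>)) * complex_of_real (gauss (\<epsilon> n *\<^sub>R \<xi>))) \<le> norm (fourier f \<xi>)" for n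
      by (auto intro!: AE_I2 mult_left_le simp: norm_mult)
    show "integrable lborel (\<lambda>\<xi>. norm (fourier f \<xi>))" using fh by simp
  qed measurable
  \<comment> \<open>Exchanging the integrals moves the transform onto the Gaussian and leaves an
    average of \<open>f\<close> around \<open>x\<close> at scale \<open>\<epsilon> n\<close>, to
    which continuity of \<open>f\<close> applies.\<close>
  have A_eq: "A n = (\<integral>u. f (x - \<epsilon> n *\<^sub>R u) * complex_of_real (gauss u) \<partial>lborel)" for n
  proof -
    have "A n = (\<integral>\<xi>. (complex_of_real (gauss (\<epsilon> n *\<^sub>R \<xi>)) * cis (2 * pi * (x \<bullet> \<xi>))) *
        (\<integral>z. f z * cis ((- 2 * pi) * (\<xi> \<bullet> z)) \<partial>lborel) \<partial>lborel)"
      unfolding A_def fourier_def by (simp add: ac_simps inner_commute)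
    also have "\<dots> = (\<integral>z. f z * (\<integral>\<xi>. (complex_of_real (gauss (\<epsilon> n *\<^sub>R \<xi>)) * cis (2 * pi * (x \<bullet> \<xi>))) *
        cis ((- 2 * pi) * (\<xi> \<bullet> z)) \<partial>lborel) \<partial>lborel)"
      by (rule Fubini_bounded_kernel[OF integrable_times_cis[OF fourier_gauss_scaled(1)[OF e]] f])
         (auto intro!: continuous_intros)
    also have "\<dots> = (\<integral>z. f z * (\<integral>\<xi>. complex_of_real (gauss (\<epsilon> n *\<^sub>R \<xi>)) * cis (2 * pi * (\<xi> \<bullet> (x - z))) \<partial>lborel) \<partial>lborel)"
      by (simp add: mult.assoc cis_mult inner_diff_right right_diff_distrib inner_commute)
    also have "\<dots> = (\<integral>z. f z * complex_of_real ((1 / \<epsilon> n) ^ DIM('a) * gauss ((1 / \<epsilon> n) *\<^sub>R (x - z))) \<partial>lborel)"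
      by (simp only: fourier_gauss_scaled(2)[OF e])
    also have "\<dots> = (1 / \<bar>- \<epsilon> n\<bar>) ^ DIM('a) *\<^sub>R (\<integral>z. f z * complex_of_real (gauss ((1 / \<epsilon> n) *\<^sub>R (x - z))) \<partial>lborel)"
      using e[of n] by (subst integral_scaleR_right[symmetric], intro Bochner_Integration.integral_cong)
         (auto simp: scaleR_conv_of_real)
    also have "\<dots> = (\<integral>u. f (x + (- \<epsilon> n) *\<^sub>R u) * complex_of_real (gauss ((1 / \<epsilon> n) *\<^sub>R (x - (x + (- \<epsilon> n) *\<^sub>R u)))) \<partial>lborel)"
      using e[of n] by (subst integral_lborel_affine[of "- \<epsilon> n" _ x]) auto
    also have "\<dots> = (\<integral>u. f (x - \<epsilon> n *\<^sub>R u) * complex_of_real (gauss u) \<partial>lborel)"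
      using e[of n] by simp
    finally show ?thesis .
  qed
  have "(\<lambda>n. \<integral>u. f (x - \<epsilon> n *\<^sub>R u) * complex_of_real (gauss u) \<partial>lborel) \<longlonglongrightarrow> (\<integral>u. f x * complex_of_real (gauss (u::'a)) \<partial>lborel)"
  proof (rule integral_dominated_convergence[where w="\<lambda>u. B * gauss u"])
    show "integrable lborel (\<lambda>u::'a. B * gauss u)" by (rule integrable_mult_right[OF integrable_gauss])
    show "AE u in lborel. (\<lambda>n. f (x - \<epsilon> n *\<^sub>R u) * complex_of_real (gauss u)) \<longlonglongrightarrow> f x * complex_of_real (gauss u)"
    proof (rule AE_I2)
      fix u
      have "(\<lambda>n. x - \<epsilon> n *\<^sub>R u) \<longlonglongrightarrow> x - 0 *\<^sub>R u" by (intro tendsto_intros lim)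
      then have "(\<lambda>n. f (x - \<epsilon> n *\<^sub>R u)) \<longlonglongrightarrow> f x"
        using cont by (intro isCont_tendsto_compose[of x f]) (auto simp: continuous_on_eq_continuous_at)
      then show "(\<lambda>n. f (x - \<epsilon> n *\<^sub>R u) * complex_of_real (gauss u)) \<longlonglongrightarrow> f x * complex_of_real (gauss u)"
        by (intro tendsto_intros)
    qed
    show "AE u in lborel. norm (f (x - \<epsilon> n *\<^sub>R u) * complex_of_real (gauss u)) \<le> B * gauss u" for n
      using bd by (auto intro!: AE_I2 mult_right_mono simp: norm_mult)
  qed measurable
  moreover have "(\<integral>u. f x * complex_of_real (gauss (u::'a)) \<partial>lborel) = f x"
    by (simp add: integral_gauss)
  ultimately show "A \<longlonglongrightarrow> f x" by (simp only: A_eq[abs_def])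
qed

lemma continuous_on_fourier:
  fixes f :: "'a::euclidean_space \<Rightarrow> complex"
  assumes f: "integrable lborel f"
  shows "continuous_on UNIV (fourier f)"
proof -
  note [measurable] = borel_measurable_integrable[OF f]
  have "isCont (fourier f) \<xi>" for \<xi>
    unfolding continuous_at_sequentially comp_def
  proof (intro allI impI)
    fix X assume X: "X \<longlonglongrightarrow> \<xi>"
    show "(\<lambda>n. fourier f (X n)) \<longlonglongrightarrow> fourier f \<xi>"
      unfolding fourier_def
    proof (rule integral_dominated_convergence[where w="\<lambda>x. norm (f x)"])
      show "AE x in lborel. (\<lambda>n. f x * cis (- 2 * pi * (x \<bullet> X n))) \<longlonglongrightarrow> f x * cis (- 2 * pi * (x \<bullet> \<xi>))"
        unfolding cis_conv_exp by (intro AE_I2 tendsto_intros X)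
      show "integrable lborel (\<lambda>x. norm (f x))" using f by simp
    qed (auto simp: norm_mult)
  qed
  then show ?thesis by (simp add: continuous_at_imp_continuous_on)
qed

lemma norm_fourier_le: "norm (fourier f \<xi>) \<le> (\<integral>x. norm (f x) \<partial>lborel)"
  unfolding fourier_def by (rule order_trans[OF integral_norm_bound]) (simp add: norm_mult)

section \<open>Decay and integrability of Schwartz functions\<close>

lemma schwartz_continuous: "schwartz f \<Longrightarrow> continuous_on UNIV f"
  unfolding schwartz_def
  by (metis empty_set empty_subsetI iter_deriv.simps(1) differentiable_imp_continuous_within continuous_at_imp_continuous_on)

lemma schwartz_decay:
  assumes "schwartz f"
  shows "\<exists>C>0. \<forall>x. norm (f x) \<le> C * (1 + norm x) powr (- a)"
proof -
  define N where "N = nat \<lceil>a\<rceil>"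
  have N: "a \<le> real N" unfolding N_def by linarith
  from assms have "bounded (range (\<lambda>x. (1 + norm x) ^ N * norm (iter_deriv [] f x)))"
    unfolding schwartz_def by (metis empty_set empty_subsetI)
  then obtain C where C: "C > 0" "\<And>x. norm ((1 + norm x) ^ N * norm (f x)) \<le> C"
    by (auto simp: bounded_pos)
  have "norm (f x) \<le> C * (1 + norm x) powr (- a)" for x
  proof -
    have "(1 + norm x) powr a * norm (f x) \<le> (1 + norm x) powr (real N) * norm (f x)"
      using N by (intro mult_right_mono powr_mono) auto
    also have "\<dots> \<le> C" using C(2)[of x] by (simp add: powr_realpow add_pos_nonneg)
    finally show ?thesis
      by (simp add: powr_minus pos_le_divide_eq divide_inverse[symmetric] add_pos_nonneg mult.commute add_pos_nonneg[THEN less_imp_neq, symmetric])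
  qed
  with C(1) show ?thesis by auto
qed

lemma integrable_of_decay:
  fixes f :: "'a::euclidean_space \<Rightarrow> 'b::{banach, second_countable_topology}"
  assumes "f \<in> borel_measurable borel" "\<And>x. norm (f x) \<le> C * (1 + norm x) powr (- a)" "a \<ge> 2 * real DIM('a)"
  shows "integrable lborel f"
proof (rule Bochner_Integration.integrable_bound)
  show "integrable lborel (\<lambda>x::'a. C * (1 + norm x) powr (- a))"
    by (intro integrable_mult_right integrable_one_plus_norm_powr assms)
  show "AE x in lborel. norm (f x) \<le> norm (C * (1 + norm x) powr (- a))"
    using order_trans[OF assms(2) abs_ge_self] by (simp add: AE_I2)
qed (use assms in simp)

lemma schwartz_measurable: "schwartz f \<Longrightarrow> f \<in> borel_measurable borel"
  by (intro borel_measurable_continuous_onI schwartz_continuous)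

lemma schwartz_bounded: assumes "schwartz f" shows "\<exists>B. \<forall>x. norm (f x) \<le> B"
proof -
  obtain C where C: "C > 0" "\<And>x. norm (f x) \<le> C * (1 + norm x) powr (- 0)"
    using schwartz_decay[OF assms, of 0] by auto
  have "norm (f x) \<le> C" for x
    using C(2)[of x] by (simp add: add_nonneg_eq_0_iff)
  then show ?thesis by auto
qed

lemma schwartz_integrable: "schwartz f \<Longrightarrow> integrable lborel f"
  using schwartz_decay[of f "2 * real DIM('a)"]
  by (auto intro: integrable_of_decay schwartz_measurable)


section \<open>Trigonometric symbols\<close>

definition block_vec :: "'n set \<Rightarrow> real^'d \<Rightarrow> real^'d^'n" where
  "block_vec J y = (\<chi> j. if j \<in> J then y else 0)"

lemma block_vec_nth [simp]: "block_vec J y $ j = (if j \<in> J then y else 0)"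
  by (simp add: block_vec_def)

text \<open>The transform of \<open>\<phi>\<close> itself serves as the cut-off. Its support makes the rescaled symbol
  meet the annulus at five dyadic scales only, and no bump function has to be constructed.\<close>

definition trig_symbol ::
  "(real^'d^'n \<Rightarrow> complex) \<Rightarrow> 'n set \<Rightarrow> (real^'d) set \<Rightarrow> (real^'d \<Rightarrow> complex) \<Rightarrow> real^'d^'n \<Rightarrow> complex" where
  "trig_symbol \<phi> J Y c \<xi> = fourier \<phi> \<xi> * (\<Sum>y\<in>Y. c y * cis (2 * pi * (block_vec J y \<bullet> \<xi>)))"

definition tensor_conv :: "(real^'d^'n \<Rightarrow> complex) \<Rightarrow> ('n \<Rightarrow> real^'d \<Rightarrow> complex) \<Rightarrow> real^'d^'n \<Rightarrow> complex" where
  "tensor_conv \<phi> f X = (\<integral>z. \<phi> z * (\<Prod>j\<in>UNIV. f j (X $ j - z $ j)) \<partial>lborel)"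

lemma fourier_tensor:
  fixes f :: "'n::finite \<Rightarrow> 'a::euclidean_space \<Rightarrow> complex"
  assumes "\<And>j. integrable lborel (f j)"
  shows "fourier (\<lambda>z. \<Prod>j\<in>UNIV. f j (z $ j)) \<xi> = (\<Prod>j\<in>UNIV. fourier (f j) (\<xi> $ j))"
proof -
  have "(\<Prod>j\<in>UNIV. f j (z $ j)) * cis (- 2 * pi * (z \<bullet> \<xi>))
      = (\<Prod>j\<in>UNIV. f j (z $ j) * cis (- 2 * pi * (z $ j \<bullet> \<xi> $ j)))" for z
    by (simp add: inner_vec_def sum_distrib_left prod.distrib cis_sum[symmetric])
  then show ?thesis
    unfolding fourier_def
    by (simp only:) (intro integral_lborel_prod_vec integrable_times_cis assms continuous_intros)
qed

context
  fixes \<phi> :: "real^'d::finite^'n::finite \<Rightarrow> complex"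
  assumes phi: "admissible_phi \<phi>"
begin

lemma phi_schwartz: "schwartz \<phi>"
  and fourier_phi_support: "fourier \<phi> \<xi> \<noteq> 0 \<Longrightarrow> 1/2 \<le> norm \<xi> \<and> norm \<xi> \<le> 2"
  using phi by (auto simp: admissible_phi_def)

lemma phi_integrable: "integrable lborel \<phi>"
  using phi_schwartz by (rule schwartz_integrable)

lemma fourier_phi_continuous: "continuous_on UNIV (fourier \<phi>)"
  by (intro continuous_on_fourier phi_integrable)

lemma fourier_phi_measurable [measurable]: "fourier \<phi> \<in> borel_measurable borel"
  by (intro borel_measurable_continuous_onI fourier_phi_continuous)

text \<open>The transform is bounded and lives where \<open>norm \<xi> \<le> 2\<close>. There
  \<open>1 + norm \<xi>\<close> is at most 3, so the factor \<open>3 powr a\<close> buys decay of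
  any order.\<close>

lemma fourier_phi_integrable: "integrable lborel (fourier \<phi>)"
proof (rule integrable_of_decay)
  define B where "B = (\<integral>x. norm (\<phi> x) \<partial>lborel)"
  define a where "a = 2 * real DIM(real^'d^'n)"
  show "norm (fourier \<phi> \<xi>) \<le> B * 3 powr a * (1 + norm \<xi>) powr (- a)" for \<xi>
  proof (cases "fourier \<phi> \<xi> = 0")
    case False
    then have "1 + norm \<xi> \<le> 3" using fourier_phi_support by force
    then have "(1 + norm \<xi>) powr a \<le> 3 powr a" by (intro powr_mono2) (auto simp: a_def)
    moreover have "norm (fourier \<phi> \<xi>) \<le> B" unfolding B_def by (rule norm_fourier_le)
    moreover have "B \<ge> 0" unfolding B_def by (intro integral_nonneg_AE) simp
    ultimately have "norm (fourier \<phi> \<xi>) * (1 + norm \<xi>) powr a \<le> B * 3 powr a"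
      by (intro mult_mono) auto
    moreover have "0 < (1 + norm \<xi>) powr a" by (simp add: add_nonneg_eq_0_iff)
    ultimately show ?thesis
      by (simp add: powr_minus divide_inverse[symmetric] pos_le_divide_eq)
  qed (simp add: B_def)
qed simp_all

lemma phi_inversion: "(\<integral>\<xi>. fourier \<phi> \<xi> * cis (2 * pi * (x \<bullet> \<xi>)) \<partial>lborel) = \<phi> x"
proof -
  obtain B where "\<And>x. norm (\<phi> x) \<le> B" using schwartz_bounded[OF phi_schwartz] by auto
  then show ?thesis
    by (intro fourier_inversion phi_integrable schwartz_continuous[OF phi_schwartz] fourier_phi_integrable)
qed

text \<open>Once \<open>fourier F\<close> is written as an integral and the order exchanged, the
  inner integral is the inversion integral of \<open>\<phi>\<close> at \<open>X - z\<close>; a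
  reflection then gives the convolution.\<close>

lemma phi_inversion_Fubini:
  assumes F: "integrable lborel F"
  shows "(\<integral>\<xi>. fourier \<phi> \<xi> * fourier F \<xi> * cis (2 * pi * (X \<bullet> \<xi>)) \<partial>lborel) = (\<integral>z. \<phi> z * F (X - z) \<partial>lborel)"
proof -
  have "(\<integral>\<xi>. fourier \<phi> \<xi> * fourier F \<xi> * cis (2 * pi * (X \<bullet> \<xi>)) \<partial>lborel)
     = (\<integral>\<xi>. (fourier \<phi> \<xi> * cis (2 * pi * (X \<bullet> \<xi>))) * (\<integral>z. F z * cis ((- 2 * pi) * (\<xi> \<bullet> z)) \<partial>lborel) \<partial>lborel)"
    by (simp add: fourier_def[of F] inner_commute ac_simps)
  also have "\<dots> = (\<integral>z. F z * (\<integral>\<xi>. (fourier \<phi> \<xi> * cis (2 * pi * (X \<bullet> \<xi>))) * cis ((- 2 * pi) * (\<xi> \<bullet> z)) \<partial>lborel) \<partial>lborel)"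
    by (rule Fubini_bounded_kernel[OF integrable_times_cis[OF fourier_phi_integrable] F])
       (auto intro!: continuous_intros)
  also have "\<dots> = (\<integral>z. F z * (\<integral>\<xi>. fourier \<phi> \<xi> * cis (2 * pi * ((X - z) \<bullet> \<xi>)) \<partial>lborel) \<partial>lborel)"
    by (simp add: mult.assoc cis_mult inner_diff_left inner_commute algebra_simps)
  also have "\<dots> = (\<integral>z. F z * \<phi> (X - z) \<partial>lborel)" by (simp only: phi_inversion)
  also have "\<dots> = (\<integral>z. \<phi> z * F (X - z) \<partial>lborel)"
    using integral_lborel_reflect[of "\<lambda>z. F z * \<phi> (X - z)" X] by (simp add: mult.commute)
  finally show ?thesis .
qed

text \<open>Only \<open>\<phi>\<close> is recovered by Fourier inversion, so the \<open>f j\<close> need not have integrable transforms.\<close>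

lemma multiplier_op_trig_symbol:
  assumes f: "\<And>j. integrable lborel (f j)" and Y: "finite Y"
  shows "multiplier_op (trig_symbol \<phi> J Y c) f x
     = (\<Sum>y\<in>Y. c y * tensor_conv \<phi> f (\<chi> j. if j \<in> J then x + y else x))"
proof -
  define F where "F z = (\<Prod>j\<in>UNIV. f j (z $ j))" for z
  have F: "integrable lborel F"
    unfolding F_def by (intro integrable_lborel_prod_vec f)
  have FF: "fourier F \<xi> = (\<Prod>j\<in>UNIV. fourier (f j) (\<xi> $ j))" for \<xi>
    unfolding F_def[abs_def] by (rule fourier_tensor[OF f])
  have Fm: "fourier F \<in> borel_measurable borel"
    by (intro borel_measurable_continuous_onI continuous_on_fourier F)
  define X where "X y = (\<chi> j. if j \<in> J then x + y else x)" for y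
  have X: "X y \<bullet> \<xi> = x \<bullet> (\<Sum>j\<in>UNIV. \<xi> $ j) + block_vec J y \<bullet> \<xi>" for y \<xi>
  proof -
    have "X y = (\<chi> j. x) + block_vec J y" by (simp add: X_def vec_eq_iff)
    moreover have "(\<chi> j. x) \<bullet> \<xi> = x \<bullet> (\<Sum>j\<in>UNIV. \<xi> $ j)"
      by (subst inner_vec_def) (simp add: inner_sum_right)
    ultimately show ?thesis by (simp add: inner_add_left)
  qed
  have int: "integrable lborel (\<lambda>\<xi>. fourier \<phi> \<xi> * fourier F \<xi> * cis (2 * pi * (X y \<bullet> \<xi>)))" for y
    by (intro integrable_times_cis integrable_mult_bounded[OF fourier_phi_integrable Fm norm_fourier_le] continuous_intros)
  have "multiplier_op (trig_symbol \<phi> J Y c) f x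
     = (\<integral>\<xi>. (\<Sum>y\<in>Y. c y * (fourier \<phi> \<xi> * fourier F \<xi> * cis (2 * pi * (X y \<bullet> \<xi>)))) \<partial>lborel)"
    unfolding multiplier_op_def trig_symbol_def
    by (intro Bochner_Integration.integral_cong refl)
       (simp add: FF X distrib_left cis_mult[symmetric] sum_distrib_left sum_distrib_right ac_simps)
  also have "\<dots> = (\<Sum>y\<in>Y. c y * (\<integral>\<xi>. fourier \<phi> \<xi> * fourier F \<xi> * cis (2 * pi * (X y \<bullet> \<xi>)) \<partial>lborel))"
    by (subst Bochner_Integration.integral_sum) (auto intro: int)
  also have "\<dots> = (\<Sum>y\<in>Y. c y * tensor_conv \<phi> f (X y))"
    by (simp only: phi_inversion_Fubini[OF F]) (simp add: tensor_conv_def F_def)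
  finally show ?thesis unfolding X_def .
qed

lemma trig_symbol_measurable: "trig_symbol \<phi> J Y c \<in> borel_measurable borel"
  unfolding trig_symbol_def[abs_def] by measurable

lemma trig_symbol_bounded: "bounded (range (trig_symbol \<phi> J Y c))"
proof -
  have "norm (trig_symbol \<phi> J Y c \<xi>) \<le> (\<integral>x. norm (\<phi> x) \<partial>lborel) * (\<Sum>y\<in>Y. norm (c y))" for \<xi>
    unfolding trig_symbol_def norm_mult
    by (intro mult_mono norm_fourier_le order_trans[OF norm_sum]) (auto simp: norm_mult intro!: sum_nonneg)
  then show ?thesis by (auto simp: bounded_iff)
qed

text \<open>The cut-off built into the symbol, dilated by \<open>r\<close>, meets the cut-off of the
  Sobolev norm. Each exponential of the symbol merely translates this one function, so its decay
  controls the whole symbol.\<close>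

definition cross_kernel :: "real \<Rightarrow> real^'d^'n \<Rightarrow> complex" where
  "cross_kernel r = fourier (\<lambda>\<xi>. fourier \<phi> (r *\<^sub>R \<xi>) * fourier \<phi> \<xi>)"

text \<open>Undoing both transforms exhibits the kernel as a convolution of \<open>\<phi>\<close>
  with a dilate of itself, from which decay is read off without differentiating on the Fourier
  side.\<close>

lemma cross_kernel_eq:
  assumes l: "r > 0"
  shows "cross_kernel r x = (\<integral>z. \<phi> z * ((1 / r) ^ DIM(real^'d^'n) *\<^sub>R \<phi> ((- 1 / r) *\<^sub>R (x + z))) \<partial>lborel)"
proof -
  have int: "integrable lborel (\<lambda>\<xi>. fourier \<phi> (r *\<^sub>R \<xi>))"
    using integrable_lborel_affine[OF fourier_phi_integrable, of r 0] l by simp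
  have inner: "(\<integral>\<xi>. fourier \<phi> (r *\<^sub>R \<xi>) * cis (2 * pi * (w \<bullet> \<xi>)) \<partial>lborel) = (1 / r) ^ DIM(real^'d^'n) *\<^sub>R \<phi> ((1 / r) *\<^sub>R w)" for w
  proof -
    have "(\<integral>\<xi>. fourier \<phi> (r *\<^sub>R \<xi>) * cis (2 * pi * (w \<bullet> \<xi>)) \<partial>lborel)
      = (\<integral>\<xi>. (\<lambda>\<eta>. fourier \<phi> \<eta> * cis (2 * pi * (((1 / r) *\<^sub>R w) \<bullet> \<eta>))) (0 + r *\<^sub>R \<xi>) \<partial>lborel)"
      using l by simp
    also have "\<dots> = (1 / \<bar>r\<bar>) ^ DIM(real^'d^'n) *\<^sub>R (\<integral>\<eta>. fourier \<phi> \<eta> * cis (2 * pi * (((1 / r) *\<^sub>R w) \<bullet> \<eta>)) \<partial>lborel)"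
      using l by (intro integral_lborel_affine) simp
    finally show ?thesis using l by (simp only: phi_inversion) simp
  qed
  have "cross_kernel r x = (\<integral>\<xi>. (fourier \<phi> (r *\<^sub>R \<xi>) * cis (- 2 * pi * (x \<bullet> \<xi>))) * (\<integral>z. \<phi> z * cis ((- 2 * pi) * (\<xi> \<bullet> z)) \<partial>lborel) \<partial>lborel)"
    unfolding cross_kernel_def by (subst fourier_def, subst (2) fourier_def) (simp add: inner_commute ac_simps)
  also have "\<dots> = (\<integral>z. \<phi> z * (\<integral>\<xi>. (fourier \<phi> (r *\<^sub>R \<xi>) * cis (- 2 * pi * (x \<bullet> \<xi>))) * cis ((- 2 * pi) * (\<xi> \<bullet> z)) \<partial>lborel) \<partial>lborel)"
    by (rule Fubini_bounded_kernel[OF integrable_times_cis[OF int] phi_integrable])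
       (auto intro!: continuous_intros)
  also have "\<dots> = (\<integral>z. \<phi> z * (\<integral>\<xi>. fourier \<phi> (r *\<^sub>R \<xi>) * cis (2 * pi * ((- (x + z)) \<bullet> \<xi>)) \<partial>lborel) \<partial>lborel)"
    by (simp add: mult.assoc cis_mult inner_add_left inner_diff_left inner_commute algebra_simps)
  also have "\<dots> = (\<integral>z. \<phi> z * ((1 / r) ^ DIM(real^'d^'n) *\<^sub>R \<phi> ((- 1 / r) *\<^sub>R (x + z))) \<partial>lborel)"
  proof -
    have "(1 / r) *\<^sub>R (- (x + z)) = (- 1 / r) *\<^sub>R (x + z)" for z by (simp add: algebra_simps)
    then show ?thesis by (simp only: inner)
  qed
  finally show ?thesis .
qed

text \<open>Since \<open>1 + norm x\<close> is at most
  \<open>(1 + norm z) * (1 + norm (x + z))\<close>, the decay in \<open>x\<close> comes from the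
  second factor of the convolution, and the resulting growth in \<open>z\<close> is paid for by the
  first. The range of \<open>r\<close> costs only powers of 4.\<close>

lemma cross_kernel_decay:
  assumes a: "a \<ge> 0"
  shows "\<exists>C>0. \<forall>r x. 1/4 \<le> r \<longrightarrow> r \<le> 4 \<longrightarrow> norm (cross_kernel r x) \<le> C * (1 + norm x) powr (- a)"
proof -
  define D where "D = DIM(real^'d^'n)"
  \<comment> \<open>The part \<open>a\<close> absorbs the growth in \<open>z\<close>, the part
    \<open>2 * D\<close> makes the remaining integral converge.\<close>
  define b where "b = a + 2 * real D"
  obtain C1 where C1: "C1 > 0" "\<And>x. norm (\<phi> x) \<le> C1 * (1 + norm x) powr (- a)"
    using schwartz_decay[OF phi_schwartz] by blast
  obtain C2 where C2: "C2 > 0" "\<And>x. norm (\<phi> x) \<le> C2 * (1 + norm x) powr (- b)"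
    using schwartz_decay[OF phi_schwartz] by blast
  have int: "integrable lborel (\<lambda>z::real^'d^'n. (1 + norm z) powr (- (2 * real D)))"
    by (rule integrable_one_plus_norm_powr) (simp add: D_def)
  define I where "I = (\<integral>z. (1 + norm (z::real^'d^'n)) powr (- (2 * real D)) \<partial>lborel)"
  define C where "C = C2 * 4 ^ D * C1 * 4 powr a * (I + 1)"
  have I0: "I \<ge> 0" unfolding I_def by (intro integral_nonneg_AE) simp
  have "norm (cross_kernel r x) \<le> C * (1 + norm x) powr (- a)" if l: "1/4 \<le> r" "r \<le> 4" for r x
  proof -
    have l0: "r > 0" using l by linarith
    have bound: "norm (\<phi> z * ((1 / r) ^ D *\<^sub>R \<phi> ((- 1 / r) *\<^sub>R (x + z))))
       \<le> C2 * 4 ^ D * C1 * 4 powr a * (1 + norm x) powr (- a) * (1 + norm z) powr (- (2 * real D))" for z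
    proof -
      have p: "0 < 1 + norm u" for u :: "real^'d^'n" by (simp add: add_pos_nonneg)
      have "1 + norm x \<le> (1 + norm z) * (1 + norm (x + z))"
        using norm_triangle_ineq4[of "x + z" z] by (simp add: algebra_simps) (smt (verit) mult_nonneg_nonneg norm_ge_zero)
      also have "1 + norm (x + z) \<le> 4 * (1 + norm ((- 1 / r) *\<^sub>R (x + z)))"
      proof -
        have "1 * norm (x + z) \<le> (4 / r) * norm (x + z)"
          using l l0 by (intro mult_right_mono) (auto simp: field_simps)
        then show ?thesis using l0 by simp
      qed
      finally have "(1 + norm x) powr a \<le> ((1 + norm z) * (4 * (1 + norm ((- 1 / r) *\<^sub>R (x + z))))) powr a"
        using a p by (intro powr_mono2) (auto simp: mult_left_mono less_imp_le)
      also have "\<dots> = (1 + norm z) powr a * (4 powr a * (1 + norm ((- 1 / r) *\<^sub>R (x + z))) powr a)"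
        by (simp only: powr_mult)
      finally have *: "(1 + norm ((- 1 / r) *\<^sub>R (x + z))) powr (- a) \<le> (1 + norm z) powr a * 4 powr a * (1 + norm x) powr (- a)"
        using p by (simp add: powr_minus divide_simps p[THEN less_imp_neq, symmetric] mult.commute)
      have "norm (\<phi> z * ((1 / r) ^ D *\<^sub>R \<phi> ((- 1 / r) *\<^sub>R (x + z))))
         = norm (\<phi> z) * ((1 / r) ^ D * norm (\<phi> ((- 1 / r) *\<^sub>R (x + z))))"
        using l0 by (simp add: norm_mult power_abs)
      also have "\<dots> \<le> (C2 * (1 + norm z) powr (- b)) * (4 ^ D * (C1 * ((1 + norm z) powr a * 4 powr a * (1 + norm x) powr (- a))))"
        using l l0 C1 C2 *
        by (intro mult_mono power_mono order_trans[OF C1(2)] mult_left_mono C2(2)) (auto simp: field_simps intro!: add_pos_nonneg)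
      also have "\<dots> = C2 * 4 ^ D * C1 * 4 powr a * (1 + norm x) powr (- a) * ((1 + norm z) powr (- b) * (1 + norm z) powr a)"
        by (simp add: ac_simps)
      also have "(1 + norm z) powr (- b) * (1 + norm z) powr a = (1 + norm z) powr (- (2 * real D))"
        by (simp add: powr_add[symmetric] b_def)
      finally show ?thesis .
    qed
    have "norm (cross_kernel r x) \<le> (\<integral>z. C2 * 4 ^ D * C1 * 4 powr a * (1 + norm x) powr (- a) * (1 + norm z) powr (- (2 * real D)) \<partial>(lborel :: (real^'d^'n) measure))"
      unfolding cross_kernel_eq[OF l0] D_def[symmetric]
      by (rule order_trans[OF integral_norm_bound], rule integral_mono_AE')
         (use bound int C1(1) C2(1) in \<open>auto intro!: AE_I2 integrable_mult_right simp del: scaleR_minus_left\<close>)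
    also have "\<dots> = C2 * 4 ^ D * C1 * 4 powr a * I * (1 + norm x) powr (- a)"
      by (simp add: I_def)
    also have "\<dots> \<le> C * (1 + norm x) powr (- a)"
      unfolding C_def using C1 C2 by (intro mult_right_mono mult_left_mono) auto
    finally show ?thesis .
  qed
  moreover have "C > 0" using C1 C2 I0 by (simp add: C_def)
  ultimately show ?thesis by blast
qed

end


section \<open>Sobolev norms of trigonometric symbols\<close>

definition int_lattice :: "(real^'d) set" where
  "int_lattice = {y. \<forall>i. y $ i \<in> \<int>}"

text \<open>Taken open so that it is a \<open>box\<close>. Cubes at different lattice points are
  disjoint and have volume one; the faces that they miss never enter.\<close>

definition unit_cube :: "real^'d \<Rightarrow> (real^'d) set" where
  "unit_cube y = box y (y + One)"

lemma One_nth: "(One :: real^'d::finite) $ i = 1"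
  using inner_sum_left_Basis[of "axis i 1 :: real^'d" "\<lambda>_. 1"] by (simp add: cart_eq_inner_axis)

lemma mem_unit_cube:
  fixes y z :: "real^'d::finite"
  shows "z \<in> unit_cube y \<longleftrightarrow> (\<forall>i. y $ i < z $ i \<and> z $ i < y $ i + 1)"
  by (simp only: unit_cube_def mem_box_cart vector_add_component One_nth)

lemma emeasure_unit_cube [simp]: "emeasure lborel (unit_cube y) = 1"
  by (simp add: unit_cube_def emeasure_lborel_box inner_add_left)

lemma unit_cube_borel [measurable, simp]: "unit_cube y \<in> sets borel"
  by (simp add: unit_cube_def)

lemma unit_cube_disjoint:
  assumes "y \<in> int_lattice" "y' \<in> int_lattice" "z \<in> unit_cube y" "z \<in> unit_cube y'"
  shows "y = y'"
proof (subst vec_eq_iff, rule allI)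
  fix i
  obtain m n :: int where "y $ i = of_int m" "y' $ i = of_int n"
    using assms(1,2) unfolding int_lattice_def by (metis (mono_tags) Ints_cases mem_Collect_eq)
  moreover have "y $ i < z $ i" "z $ i < y $ i + 1" "y' $ i < z $ i" "z $ i < y' $ i + 1"
    using assms(3,4) by (auto simp: mem_unit_cube)
  ultimately have "(of_int m :: real) < of_int n + 1" "(of_int n :: real) < of_int m + 1" by linarith+
  then have "m = n" using of_int_less_iff[of m "n + 1", where ?'a=real] of_int_less_iff[of n "m + 1", where ?'a=real] by simp
  then show "y $ i = y' $ i" using \<open>y $ i = of_int m\<close> \<open>y' $ i = of_int n\<close> by linarith
qed

lemma norm_diff_unit_cube:
  fixes y :: "real^'d::finite"
  assumes "z \<in> unit_cube y" shows "norm (z - y) \<le> real CARD('d)"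
proof -
  have "norm (z - y) \<le> (\<Sum>i\<in>UNIV. \<bar>(z - y) $ i\<bar>)" by (rule norm_le_l1_cart)
  also have "\<dots> \<le> (\<Sum>i\<in>(UNIV::'d set). 1)"
    using assms by (intro sum_mono) (auto simp: mem_unit_cube abs_if intro: less_imp_le; smt (verit))
  finally show ?thesis by simp
qed

lemma sum_unit_cube_indicator_le:
  assumes "finite Y" "Y \<subseteq> int_lattice"
  shows "(\<Sum>y\<in>Y. indicator (unit_cube y) z) \<le> (1::real)"
proof (cases "\<exists>y\<in>Y. z \<in> unit_cube y")
  case True
  then obtain y where y: "y \<in> Y" "z \<in> unit_cube y" by blast
  have "(\<Sum>y\<in>Y. indicator (unit_cube y) z) = (\<Sum>y'\<in>{y}. indicator (unit_cube y') z :: real)"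
    using assms y by (intro sum.mono_neutral_right)
      (auto simp: indicator_def dest: unit_cube_disjoint[of y _ z] subsetD)
  then show ?thesis using y(2) by simp
next
  case False
  then have "(\<Sum>y\<in>Y. indicator (unit_cube y) z) = (0::real)"
    by (intro sum.neutral) (auto simp: indicator_def)
  then show ?thesis by simp
qed

lemma one_plus_norm_mult: "1 + norm (x + y) \<le> (1 + norm x) * (1 + norm (y :: 'a::real_normed_vector))"
  using norm_triangle_ineq[of x y] by (simp add: algebra_simps) (smt (verit) mult_nonneg_nonneg norm_ge_zero)

text \<open>Comparison with an integral: on the unit cube at \<open>y\<close> the weight changes by
  a bounded factor only, and the cubes are disjoint. Scales \<open>r\<close> between 1/4 and 4 are
  the only ones at which symbol and cut-off overlap.\<close>

lemma lattice_sum_bound: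
  assumes a: "a \<ge> 2 * real CARD('d)"
  shows "\<exists>C>0. \<forall>r Y (x::real^'d::finite). 1/4 \<le> r \<longrightarrow> r \<le> 4 \<longrightarrow> finite Y \<longrightarrow> Y \<subseteq> int_lattice
     \<longrightarrow> (\<Sum>y\<in>Y. (1 + norm (x - r *\<^sub>R y)) powr (- a)) \<le> C"
proof -
  define w where "w z = (1 + norm z) powr (- a)" for z :: "real^'d"
  \<comment> \<open>Points of one cube differ by at most \<open>CARD('d)\<close> in norm, and
    \<open>r\<close> is at most 4.\<close>
  define K where "K = (1 + 4 * real CARD('d)) powr a"
  define I where "I = (\<integral>z. w z \<partial>lborel)"
  have int: "integrable lborel w"
    unfolding w_def using a by (intro integrable_one_plus_norm_powr) simp
  have I0: "I \<ge> 0" unfolding I_def w_def by (intro integral_nonneg_AE) simp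
  have K0: "K > 0" by (simp add: K_def add_nonneg_eq_0_iff)
  have "(\<Sum>y\<in>Y. w (x - r *\<^sub>R y)) \<le> K * (4 ^ CARD('d) * I) + 1"
    if r: "1/4 \<le> r" "r \<le> 4" and Y: "finite Y" "Y \<subseteq> int_lattice" for r Y and x :: "real^'d"
  proof -
    have intr: "integrable lborel (\<lambda>z. w (x - r *\<^sub>R z))"
      using integrable_lborel_affine[OF int, of "- r" x] r by simp
    have cube: "w (x - r *\<^sub>R y) \<le> K * w (x - r *\<^sub>R z)" if z: "z \<in> unit_cube y" for y z
    proof -
      have "1 + norm (x - r *\<^sub>R z) \<le> (1 + norm (x - r *\<^sub>R y)) * (1 + norm (r *\<^sub>R (y - z)))"
        using one_plus_norm_mult[of "x - r *\<^sub>R y" "r *\<^sub>R (y - z)"] by (simp add: algebra_simps)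
      also have "\<dots> \<le> (1 + norm (x - r *\<^sub>R y)) * (1 + 4 * real CARD('d))"
        using r norm_diff_unit_cube[OF z]
        by (intro mult_left_mono add_left_mono) (auto simp: norm_minus_commute intro!: mult_mono)
      finally have "(1 + norm (x - r *\<^sub>R z)) powr a \<le> ((1 + norm (x - r *\<^sub>R y)) * (1 + 4 * real CARD('d))) powr a"
        using a by (intro powr_mono2) auto
      also have "\<dots> = (1 + norm (x - r *\<^sub>R y)) powr a * K"
        by (simp only: powr_mult K_def)
      finally show ?thesis
        unfolding w_def by (simp add: powr_minus divide_simps add_nonneg_eq_0_iff mult.commute)
    qed
    have cint: "(\<integral>z. indicator (unit_cube y) z * w (x - r *\<^sub>R y) \<partial>lborel) = w (x - r *\<^sub>R y)" for y
      by (simp add: measure_def)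
    have iint: "integrable lborel (\<lambda>z. indicator (unit_cube y) z * w (x - r *\<^sub>R y))" for y
      by (intro integrable_mult_left integrable_real_indicator) auto
    have "(\<Sum>y\<in>Y. w (x - r *\<^sub>R y)) = (\<integral>z. (\<Sum>y\<in>Y. indicator (unit_cube y) z * w (x - r *\<^sub>R y)) \<partial>lborel)"
      by (subst Bochner_Integration.integral_sum) (simp_all only: cint iint)
    also have "\<dots> \<le> (\<integral>z. K * w (x - r *\<^sub>R z) \<partial>lborel)"
    proof (rule integral_mono)
      fix z
      have "(\<Sum>y\<in>Y. indicator (unit_cube y) z * w (x - r *\<^sub>R y)) \<le> (\<Sum>y\<in>Y. indicator (unit_cube y) z * (K * w (x - r *\<^sub>R z)))"
        using cube by (intro sum_mono) (auto simp: indicator_def)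
      also have "\<dots> = (\<Sum>y\<in>Y. indicator (unit_cube y) z) * (K * w (x - r *\<^sub>R z))"
        by (simp add: sum_distrib_right)
      also have "\<dots> \<le> 1 * (K * w (x - r *\<^sub>R z))"
        using K0 by (intro mult_right_mono sum_unit_cube_indicator_le Y) (auto simp: w_def)
      finally show "(\<Sum>y\<in>Y. indicator (unit_cube y) z * w (x - r *\<^sub>R y)) \<le> K * w (x - r *\<^sub>R z)" by simp
    qed (use intr iint in auto)
    also have "\<dots> = K * ((1 / r) ^ CARD('d) * I)"
      using integral_lborel_affine[of "- r" w x] r by (simp add: I_def)
    also have "\<dots> \<le> K * (4 ^ CARD('d) * I)"
      using K0 I0 r by (intro mult_left_mono mult_right_mono power_mono) (auto simp: field_simps)
    finally show ?thesis by simp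
  qed
  moreover have "K * (4 ^ CARD('d) * I) + 1 > 0" using K0 I0 by (simp add: add_nonneg_pos)
  ultimately show ?thesis unfolding w_def by blast
qed

section \<open>Weighted square norms\<close>

lemma enn_powr_le:
  assumes "a \<le> ennreal V" "0 \<le> V" "0 \<le> r"
  shows "enn_powr r a \<le> ennreal (V powr r)"
proof -
  have "a \<noteq> top" using assms(1) by (auto simp: top_unique)
  then have "a = ennreal (enn2real a)" by (simp add: less_top[symmetric])
  then have "enn2real a \<le> V" using assms by (metis ennreal_le_iff)
  then show ?thesis using assms \<open>a \<noteq> top\<close> by (simp add: enn_powr_def ennreal_leI powr_mono2)
qed

lemma nn_integral_le_integral:
  assumes "integrable M g" "\<And>x. f x \<le> ennreal (g x)" "\<And>x. 0 \<le> g x"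
  shows "(\<integral>\<^sup>+x. f x \<partial>M) \<le> ennreal (\<integral>x. g x \<partial>M)"
  using assms by (subst nn_integral_eq_integral[symmetric]) (auto intro!: nn_integral_mono)

text \<open>In each block \<open>1 + norm (x $ j)\<close> splits, by the triangle inequality, into a
  factor for the distance from the centre \<open>r *\<^sub>R block_vec J v\<close> and a factor for
  the centre itself. The latter is trivial for \<open>j\<close> outside \<open>J\<close>, so only
  the \<open>s j\<close> with \<open>j\<close> in \<open>J\<close> weigh on
  \<open>v\<close>.\<close>

lemma sobolev_weight_le:
  fixes s :: "'n::finite \<Rightarrow> real" and x y :: "real^'d::finite^'n" and v :: "real^'d"
  assumes s: "\<And>j. 0 < s j" and r: "0 < r" "r \<le> 4"
  shows "(\<Prod>j\<in>UNIV. (1 + 4 * pi\<^sup>2 * (norm (x $ j))\<^sup>2) powr s j)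
    \<le> (\<Prod>j\<in>UNIV. 1000 powr s j) * (1 + norm (x - r *\<^sub>R block_vec J v)) powr (2 * (\<Sum>j\<in>UNIV. s j))
       * (1 + norm v) powr (2 * (\<Sum>j\<in>J. s j))"
proof -
  define N where "N = 1 + norm (x - r *\<^sub>R block_vec J v)"
  define M where "M j = (if j \<in> J then 1 + norm v else 1)" for j
  have N1: "N \<ge> 1" and M1: "M j \<ge> 1" for j by (auto simp: N_def M_def)
  have "(\<Prod>j\<in>UNIV. (1 + 4 * pi\<^sup>2 * (norm (x $ j))\<^sup>2) powr s j) \<le> (\<Prod>j\<in>UNIV. (1000 * N\<^sup>2 * (M j)\<^sup>2) powr s j)"
  proof (intro prod_mono conjI powr_mono2)
    fix j
    define w where "w = block_vec J v $ j"
    have "1 + norm (x $ j) \<le> (1 + norm (x $ j - r *\<^sub>R w)) * (1 + norm (r *\<^sub>R w))"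
      using one_plus_norm_mult[of "x $ j - r *\<^sub>R w" "r *\<^sub>R w"] by simp
    also have "\<dots> \<le> N * (4 * M j)"
    proof (intro mult_mono)
      show "1 + norm (x $ j - r *\<^sub>R w) \<le> N"
        using Finite_Cartesian_Product.norm_nth_le[of "x - r *\<^sub>R block_vec J v" j] by (simp add: N_def w_def)
      have "norm (r *\<^sub>R w) \<le> 4 * norm w" using r by (simp add: mult_right_mono)
      then show "1 + norm (r *\<^sub>R w) \<le> 4 * M j" by (auto simp: w_def M_def)
    qed (use N1 in auto)
    finally have *: "1 + norm (x $ j) \<le> N * (4 * M j)" .
    have "1 + 4 * pi\<^sup>2 * (norm (x $ j))\<^sup>2 \<le> 62 * (1 + norm (x $ j))\<^sup>2"
    proof -
      \<comment> \<open>Four times 3.9 squared is 60.84, whence the bounds 61 and then 62.\<close>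
      have "pi * pi \<le> 3.9 * 3.9" using pi_approx by (intro mult_mono) auto
      then have *: "4 * pi\<^sup>2 \<le> 61" by (simp add: power2_eq_square)
      have "1 + 4 * pi\<^sup>2 * (norm (x $ j))\<^sup>2 \<le> 62 * 1 + 62 * (norm (x $ j))\<^sup>2"
        using * by (intro add_mono mult_right_mono) auto
      also have "\<dots> \<le> 62 * (1 + norm (x $ j))\<^sup>2" by (simp add: power2_sum)
      finally show ?thesis .
    qed
    also have "\<dots> \<le> 62 * (N * (4 * M j))\<^sup>2"
      using * by (intro mult_left_mono power_mono) auto
    \<comment> \<open>The constant 1000 rounds up \<open>62 * 4 ^ 2 = 992\<close>.\<close>
    also have "\<dots> \<le> 1000 * N\<^sup>2 * (M j)\<^sup>2" by (simp add: power_mult_distrib)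
    finally show "1 + 4 * pi\<^sup>2 * (norm (x $ j))\<^sup>2 \<le> 1000 * N\<^sup>2 * (M j)\<^sup>2" .
  qed (use s in \<open>auto simp: less_imp_le intro!: add_nonneg_nonneg\<close>)
  also have "\<dots> = (\<Prod>j\<in>UNIV. 1000 powr s j * (N powr (2 * s j) * (M j) powr (2 * s j)))"
    using N1 M1 by (intro prod.cong refl)
      (simp add: powr_mult mult.assoc powr_powr[symmetric] powr_numeral order_trans[OF zero_le_one])
  also have "\<dots> = (\<Prod>j\<in>UNIV. 1000 powr s j) * N powr (2 * (\<Sum>j\<in>UNIV. s j)) * (\<Prod>j\<in>UNIV. M j powr (2 * s j))"
    using N1 by (simp add: prod.distrib powr_sum sum_distrib_left)
  also have "(\<Prod>j\<in>UNIV. M j powr (2 * s j)) = (\<Prod>j\<in>J. (1 + norm v) powr (2 * s j))"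
    unfolding M_def by (rule prod.mono_neutral_cong_right) auto
  also have "\<dots> = (1 + norm v) powr (2 * (\<Sum>j\<in>J. s j))"
    by (simp add: powr_sum sum_distrib_left add_nonneg_eq_0_iff)
  finally show ?thesis by (simp add: N_def)
qed

text \<open>Schur's test: the majorant \<open>u\<close> is split as \<open>sqrt u * sqrt u\<close>.
  In the application its plain sum is a lattice sum bounded independently of \<open>Y\<close>, so
  only the sum of squares of the coefficients survives.\<close>

lemma sum_weighted_Cauchy_Schwarz:
  fixes c :: "'a \<Rightarrow> complex" and u :: "'a \<Rightarrow> real"
  assumes u: "\<And>y. y \<in> Y \<Longrightarrow> norm (k y :: complex) \<le> u y"
  shows "(norm (\<Sum>y\<in>Y. c y * k y))\<^sup>2 \<le> (\<Sum>y\<in>Y. (norm (c y))\<^sup>2 * u y) * (\<Sum>y\<in>Y. u y)"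
proof -
  have u0: "y \<in> Y \<Longrightarrow> 0 \<le> u y" for y using u[of y] norm_ge_zero order_trans by blast
  have "norm (\<Sum>y\<in>Y. c y * k y) \<le> (\<Sum>y\<in>Y. norm (c y) * u y)"
    using u by (intro order_trans[OF norm_sum] sum_mono) (simp add: norm_mult mult_left_mono)
  also have "\<dots> = (\<Sum>y\<in>Y. (norm (c y) * sqrt (u y)) * sqrt (u y))"
    using u0 by (intro sum.cong refl) (simp add: mult.assoc)
  finally have "(norm (\<Sum>y\<in>Y. c y * k y))\<^sup>2 \<le> (\<Sum>y\<in>Y. (norm (c y) * sqrt (u y)) * sqrt (u y))\<^sup>2"
    by (intro power_mono) auto
  also have "\<dots> \<le> (\<Sum>y\<in>Y. (norm (c y) * sqrt (u y))\<^sup>2) * (\<Sum>y\<in>Y. (sqrt (u y))\<^sup>2)"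
    by (rule Cauchy_Schwarz_ineq_sum)
  also have "\<dots> = (\<Sum>y\<in>Y. (norm (c y))\<^sup>2 * u y) * (\<Sum>y\<in>Y. u y)"
    using u0 by (simp add: power_mult_distrib)
  finally show ?thesis .
qed


lemma sobolev_norm_zero: "sobolev_norm s (\<lambda>_. 0) = 0"
  by (simp add: sobolev_norm_def fourier_def enn_powr_def)

text \<open>A frequency \<open>block_vec J y\<close> in the symbol becomes, after dilation by
  \<open>r\<close> and transformation, a translation by
  \<open>r *\<^sub>R block_vec J y\<close>.\<close>

lemma fourier_trig_symbol_dilate:
  fixes \<phi> :: "real^'d::finite^'n::finite \<Rightarrow> complex"
  assumes phi: "admissible_phi \<phi>" and Y: "finite Y"
  shows "fourier (\<lambda>\<xi>. trig_symbol \<phi> J Y c (r *\<^sub>R \<xi>) * fourier \<phi> \<xi>) x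
     = (\<Sum>y\<in>Y. c y * cross_kernel \<phi> r (x - r *\<^sub>R block_vec J y))"
proof -
  note [measurable] = fourier_phi_measurable[OF phi]
  define G where "G \<xi> = fourier \<phi> (r *\<^sub>R \<xi>) * fourier \<phi> \<xi>" for \<xi>
  have G: "integrable lborel G"
    unfolding G_def mult.commute[of "fourier \<phi> (r *\<^sub>R _)"]
    by (rule integrable_mult_bounded[OF fourier_phi_integrable[OF phi] _ norm_fourier_le]) measurable
  have "fourier (\<lambda>\<xi>. trig_symbol \<phi> J Y c (r *\<^sub>R \<xi>) * fourier \<phi> \<xi>) x
     = (\<integral>\<xi>. (\<Sum>y\<in>Y. c y * (G \<xi> * cis (- 2 * pi * (\<xi> \<bullet> (x - r *\<^sub>R block_vec J y))))) \<partial>lborel)"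
    unfolding fourier_def[of _ x] trig_symbol_def
  proof (intro Bochner_Integration.integral_cong refl)
    fix \<xi> :: "real^'d^'n"
    have "cis (- 2 * pi * (\<xi> \<bullet> (x - r *\<^sub>R block_vec J y))) = cis (2 * pi * (block_vec J y \<bullet> (r *\<^sub>R \<xi>))) * cis (- 2 * pi * (\<xi> \<bullet> x))" for y
      by (simp add: cis_mult inner_diff_right right_diff_distrib inner_commute)
    then show "fourier \<phi> (r *\<^sub>R \<xi>) * (\<Sum>y\<in>Y. c y * cis (2 * pi * (block_vec J y \<bullet> r *\<^sub>R \<xi>))) * fourier \<phi> \<xi> * cis (- 2 * pi * (\<xi> \<bullet> x)) =
         (\<Sum>y\<in>Y. c y * (G \<xi> * cis (- 2 * pi * (\<xi> \<bullet> (x - r *\<^sub>R block_vec J y)))))"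
      by (simp only: G_def sum_distrib_left sum_distrib_right) (simp add: ac_simps)
  qed
  also have "\<dots> = (\<Sum>y\<in>Y. c y * (\<integral>\<xi>. G \<xi> * cis (- 2 * pi * (\<xi> \<bullet> (x - r *\<^sub>R block_vec J y))) \<partial>lborel))"
    by (subst Bochner_Integration.integral_sum) (auto intro!: integrable_mult_right integrable_times_cis[OF G] continuous_intros)
  finally show ?thesis
    by (simp add: cross_kernel_def[OF phi] fourier_def[of "\<lambda>\<xi>. fourier \<phi> (r *\<^sub>R \<xi>) * fourier \<phi> \<xi>"] G_def)
qed

text \<open>Almost orthogonality: the translates of the cross kernel are concentrated near separated
  points, so the weighted norm behaves like the weighted square sum of the coefficients. An estimate
  by the triangle inequality would give their plain sum and lose the gap between
  \<open>\<Lambda>\<close> and \<open>sqrt \<Lambda>\<close>.\<close>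

lemma sobolev_L2_trig_symbol_bound:
  fixes \<phi> :: "real^'d::finite^'n::finite \<Rightarrow> complex"
  assumes phi: "admissible_phi \<phi>" and s: "\<And>j. 0 < s j" and J: "J \<noteq> {}"
  shows "\<exists>C>0. \<forall>Y c. finite Y \<longrightarrow> Y \<subseteq> int_lattice \<longrightarrow>
     sobolev_L2 \<phi> s (trig_symbol \<phi> J Y c)
       \<le> ennreal (C * sqrt (\<Sum>y\<in>Y. (norm (c y))\<^sup>2 * (1 + norm y) powr (2 * (\<Sum>j\<in>J. s j))))"
proof -
  define S where "S = (\<Sum>j\<in>UNIV. s j)"
  define D where "D = DIM(real^'d^'n)"
  \<comment> \<open>The part \<open>2 * S\<close> pays for the Sobolev weight, the part
    \<open>2 * D\<close> leaves an integrable function of \<open>x\<close>.\<close>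
  define a where "a = 2 * S + 2 * real D"
  have S0: "S \<ge> 0" unfolding S_def using s by (intro sum_nonneg) (auto simp: less_imp_le)
  \<comment> \<open>A single coordinate in \<open>J\<close> already sees all of \<open>Y\<close> and
    separates the translates.\<close>
  obtain i where i: "i \<in> J" using J by blast
  have dD: "CARD('d) \<le> D" by (simp add: D_def)
  obtain C1 where C1: "C1 > 0"
    "\<And>r x. 1/4 \<le> r \<Longrightarrow> r \<le> 4 \<Longrightarrow> norm (cross_kernel \<phi> r x) \<le> C1 * (1 + norm x) powr (- a)"
    using cross_kernel_decay[OF phi, of a] S0 by (auto simp: a_def)
  obtain C2 where C2: "C2 > 0"
    "\<And>r Y (x::real^'d). 1/4 \<le> r \<Longrightarrow> r \<le> 4 \<Longrightarrow> finite Y \<Longrightarrow> Y \<subseteq> int_lattice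
     \<Longrightarrow> (\<Sum>y\<in>Y. (1 + norm (x - r *\<^sub>R y)) powr (- a)) \<le> C2"
    using lattice_sum_bound[where ?'d='d, of a] S0 dD by (auto simp: a_def)
  define w where "w z = (1 + norm z) powr (- (2 * real D))" for z :: "real^'d^'n"
  have w_int: "integrable lborel w"
    unfolding w_def by (rule integrable_one_plus_norm_powr) (simp add: D_def)
  define I where "I = (\<integral>z. w z \<partial>lborel)"
  have I0: "I \<ge> 0" unfolding I_def w_def by (intro integral_nonneg_AE) simp
  define P where "P = (\<Prod>j\<in>UNIV. 1000 powr s j)"
  have P0: "P > 0" unfolding P_def by (intro prod_pos) auto
  define K where "K = C1 * C2 * P * C1 * (I + 1)"
  have K0: "K > 0" using C1 C2 P0 I0 by (simp add: K_def)
  have main: "sobolev_norm s (\<lambda>\<xi>. trig_symbol \<phi> J Y c (r *\<^sub>R \<xi>) * fourier \<phi> \<xi>)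
       \<le> ennreal (sqrt K * sqrt (\<Sum>y\<in>Y. (norm (c y))\<^sup>2 * (1 + norm y) powr (2 * (\<Sum>j\<in>J. s j))))"
    if Y: "finite Y" "Y \<subseteq> int_lattice" and r: "1/4 \<le> r" "r \<le> 4" for Y c r
  proof -
    define A where "A = (\<Sum>y\<in>Y. (norm (c y))\<^sup>2 * (1 + norm y) powr (2 * (\<Sum>j\<in>J. s j)))"
    have A0: "A \<ge> 0" unfolding A_def by (intro sum_nonneg) auto
    define W where "W x = (\<Prod>j\<in>UNIV. (1 + 4 * pi\<^sup>2 * (norm (x $ j))\<^sup>2) powr s j)" for x :: "real^'d^'n"
    define u where "u x y = C1 * (1 + norm (x - r *\<^sub>R block_vec J y)) powr (- a)" for x :: "real^'d^'n" and y
    have u0: "0 \<le> u x y" for x y using C1 by (simp add: u_def)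
    define F where "F = fourier (\<lambda>\<xi>. trig_symbol \<phi> J Y c (r *\<^sub>R \<xi>) * fourier \<phi> \<xi>)"
    define g where "g x = (\<Sum>y\<in>Y. C1 * C2 * P * C1 * ((norm (c y))\<^sup>2 * (1 + norm y) powr (2 * (\<Sum>j\<in>J. s j)) * w (x - r *\<^sub>R block_vec J y)))" for x :: "real^'d^'n"
    have pt: "W x * (norm (F x))\<^sup>2 \<le> g x" for x
    proof -
      have usum: "(\<Sum>y\<in>Y. u x y) \<le> C1 * C2"
      proof -
        have "u x y \<le> C1 * (1 + norm (x $ i - r *\<^sub>R y)) powr (- a)" for y
          unfolding u_def using C1 S0 i Finite_Cartesian_Product.norm_nth_le[of "x - r *\<^sub>R block_vec J y" i]
          by (intro mult_left_mono powr_mono2') (auto simp: a_def add_pos_nonneg)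
        then have "(\<Sum>y\<in>Y. u x y) \<le> C1 * (\<Sum>y\<in>Y. (1 + norm (x $ i - r *\<^sub>R y)) powr (- a))"
          by (simp add: sum_distrib_left sum_mono)
        also have "\<dots> \<le> C1 * C2" using C1 C2(2)[OF r Y] by (intro mult_left_mono) auto
        finally show ?thesis .
      qed
      have "(norm (F x))\<^sup>2 \<le> (\<Sum>y\<in>Y. (norm (c y))\<^sup>2 * u x y) * (\<Sum>y\<in>Y. u x y)"
        unfolding F_def fourier_trig_symbol_dilate[OF phi Y(1)]
        by (rule sum_weighted_Cauchy_Schwarz) (use C1(2)[OF r] in \<open>simp add: u_def\<close>)
      also have "\<dots> \<le> (\<Sum>y\<in>Y. (norm (c y))\<^sup>2 * u x y) * (C1 * C2)"
        by (intro mult_left_mono usum sum_nonneg mult_nonneg_nonneg u0) auto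
      finally have "W x * (norm (F x))\<^sup>2 \<le> W x * ((\<Sum>y\<in>Y. (norm (c y))\<^sup>2 * u x y) * (C1 * C2))"
        by (rule mult_left_mono) (simp add: W_def prod_nonneg)
      also have "\<dots> = (\<Sum>y\<in>Y. C1 * C2 * ((norm (c y))\<^sup>2 * (W x * u x y)))"
        by (simp add: sum_distrib_left sum_distrib_right ac_simps)
      also have "\<dots> \<le> g x"
        unfolding g_def
      proof (rule sum_mono)
        fix y assume "y \<in> Y"
        define N where "N = 1 + norm (x - r *\<^sub>R block_vec J y)"
        have N: "N > 0" by (simp add: N_def add_pos_nonneg)
        have "W x * u x y \<le> P * N powr (2 * S) * (1 + norm y) powr (2 * (\<Sum>j\<in>J. s j)) * u x y"
          using sobolev_weight_le[of s r x J y] s r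
          by (intro mult_right_mono u0) (auto simp: W_def P_def N_def S_def)
        also have "\<dots> = P * C1 * ((1 + norm y) powr (2 * (\<Sum>j\<in>J. s j)) * (N powr (2 * S) * N powr (- a)))"
          by (simp add: u_def N_def)
        also have "N powr (2 * S) * N powr (- a) = w (x - r *\<^sub>R block_vec J y)"
          by (simp add: powr_add[symmetric] a_def w_def N_def)
        finally have *: "W x * u x y \<le> P * C1 * ((1 + norm y) powr (2 * (\<Sum>j\<in>J. s j)) * w (x - r *\<^sub>R block_vec J y))" .
        have "C1 * C2 * ((norm (c y))\<^sup>2 * (W x * u x y)) \<le> C1 * C2 * ((norm (c y))\<^sup>2 * (P * C1 * ((1 + norm y) powr (2 * (\<Sum>j\<in>J. s j)) * w (x - r *\<^sub>R block_vec J y))))"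
          using C1 C2 * by (intro mult_left_mono) auto
        then show "C1 * C2 * ((norm (c y))\<^sup>2 * (W x * u x y)) \<le> C1 * C2 * P * C1 * ((norm (c y))\<^sup>2 * (1 + norm y) powr (2 * (\<Sum>j\<in>J. s j)) * w (x - r *\<^sub>R block_vec J y))"
          by (simp add: ac_simps)
      qed
      finally show ?thesis .
    qed
    have w_shift: "integrable lborel (\<lambda>x. w (x - v))" "(\<integral>x. w (x - v) \<partial>lborel) = I" for v
      using integrable_lborel_shift[OF w_int, of "- v"] integral_lborel_shift[of w "- v"] by (simp_all add: I_def)
    have g_int: "integrable lborel g"
      unfolding g_def[abs_def] by (intro Bochner_Integration.integrable_sum integrable_mult_right w_shift)
    have "(\<integral>x. g x \<partial>lborel) = (\<Sum>y\<in>Y. C1 * C2 * P * C1 * ((norm (c y))\<^sup>2 * (1 + norm y) powr (2 * (\<Sum>j\<in>J. s j)) * I))"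
      unfolding g_def by (subst Bochner_Integration.integral_sum) (simp_all add: w_shift)
    also have "\<dots> = C1 * C2 * P * C1 * I * A"
      by (simp add: A_def sum_distrib_left sum_distrib_right ac_simps)
    also have "\<dots> \<le> K * A"
      using C1 C2 P0 A0 by (intro mult_right_mono) (auto simp: K_def)
    finally have g_le: "(\<integral>x. g x \<partial>lborel) \<le> K * A" .
    have "(\<integral>\<^sup>+x. ennreal (W x * (norm (F x))\<^sup>2) \<partial>lborel) \<le> ennreal (\<integral>x. g x \<partial>lborel)"
    proof (rule nn_integral_le_integral[OF g_int])
      show "0 \<le> g x" for x
        by (rule order_trans[OF _ pt]) (auto simp: W_def intro!: mult_nonneg_nonneg prod_nonneg)
    qed (use pt in \<open>simp add: ennreal_leI\<close>)
    also have "\<dots> \<le> ennreal (K * A)" using g_le by (rule ennreal_leI)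
    finally have "sobolev_norm s (\<lambda>\<xi>. trig_symbol \<phi> J Y c (r *\<^sub>R \<xi>) * fourier \<phi> \<xi>) \<le> ennreal ((K * A) powr (1/2))"
      unfolding sobolev_norm_def W_def F_def
      by (rule enn_powr_le) (use K0 A0 in auto)
    then show ?thesis using K0 A0 by (simp add: powr_half_sqrt real_sqrt_mult A_def)
  qed
  have "sobolev_L2 \<phi> s (trig_symbol \<phi> J Y c)
       \<le> ennreal (sqrt K * sqrt (\<Sum>y\<in>Y. (norm (c y))\<^sup>2 * (1 + norm y) powr (2 * (\<Sum>j\<in>J. s j))))"
    if Y: "finite Y" "Y \<subseteq> int_lattice" for Y c
    unfolding sobolev_L2_def
  proof (rule SUP_least)
    fix j :: int
    define r where "r = 2 powr real_of_int j"
    have r0: "r > 0" by (simp add: r_def)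
    show "sobolev_norm s (\<lambda>\<xi>. trig_symbol \<phi> J Y c (2 powr real_of_int j *\<^sub>R \<xi>) * fourier \<phi> \<xi>)
         \<le> ennreal (sqrt K * sqrt (\<Sum>y\<in>Y. (norm (c y))\<^sup>2 * (1 + norm y) powr (2 * (\<Sum>j\<in>J. s j))))"
    proof (cases "1/4 \<le> r \<and> r \<le> 4")
      case True
      then show ?thesis using main[OF Y] unfolding r_def by blast
    next
      case False
      have "fourier \<phi> (r *\<^sub>R \<xi>) * fourier \<phi> \<xi> = 0" for \<xi>
      proof (rule ccontr)
        assume "fourier \<phi> (r *\<^sub>R \<xi>) * fourier \<phi> \<xi> \<noteq> 0"
        then have *: "1/2 \<le> r * norm \<xi>" "r * norm \<xi> \<le> 2" "1/2 \<le> norm \<xi>" "norm \<xi> \<le> 2"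
          using fourier_phi_support[OF phi, of \<xi>] fourier_phi_support[OF phi, of "r *\<^sub>R \<xi>"] r0 by auto
        have "r * (1/2) \<le> r * norm \<xi>" "r * norm \<xi> \<le> r * 2" using * r0 by (auto intro!: mult_left_mono)
        with * False show False by linarith
      qed
      then have "(\<lambda>\<xi>. trig_symbol \<phi> J Y c (r *\<^sub>R \<xi>) * fourier \<phi> \<xi>) = (\<lambda>_. 0)"
        unfolding trig_symbol_def by (auto simp: fun_eq_iff)
      then show ?thesis unfolding r_def[symmetric] by (simp add: sobolev_norm_zero)
    qed
  qed
  then show ?thesis using K0 by (intro exI[of _ "sqrt K"]) auto
qed


section \<open>Differences of Gaussians\<close>

definition sym_diff :: "'a::real_vector \<Rightarrow> ('a \<Rightarrow> 'b::real_vector) \<Rightarrow> 'a \<Rightarrow> 'b" where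
  "sym_diff v f x = f (x + v) - f (x - v)"

text \<open>\<open>U\<close> lists successive derivatives. By the mean value theorem one central
  difference, over an interval of length 2, is traded for a derivative and a factor 2, and the
  window in which the bound is required widens by 1.\<close>

lemma sym_diff_funpow_bound:
  fixes U :: "nat \<Rightarrow> real \<Rightarrow> real"
  assumes "\<And>k h. (U k has_real_derivative U (Suc k) h) (at h)"
    and "\<And>\<theta>. \<bar>\<theta>\<bar> \<le> real M \<Longrightarrow> \<bar>U M (h + \<theta>)\<bar> \<le> B"
  shows "\<bar>(sym_diff 1 ^^ M) (U 0) h\<bar> \<le> 2 ^ M * B"
  using assms
proof (induction M arbitrary: U B)
  case 0
  from 0(2)[of 0] show ?case by simp
next
  case (Suc M)
  define V where "V k = sym_diff 1 (U k)" for k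
  have "(V k has_real_derivative V (Suc k) x) (at x)" for k x
    using DERIV_diff[OF DERIV_shift[THEN iffD1, OF Suc.prems(1)[of k "x + 1"]] DERIV_shift[THEN iffD1, OF Suc.prems(1)[of k "x + - 1"]]]
    unfolding V_def sym_diff_def[abs_def] by simp
  moreover have "\<bar>V M (h + \<theta>)\<bar> \<le> 2 * B" if t: "\<bar>\<theta>\<bar> \<le> real M" for \<theta>
  proof -
    obtain z where z: "h + \<theta> - 1 < z" "z < h + \<theta> + 1"
      "U M (h + \<theta> + 1) - U M (h + \<theta> - 1) = (h + \<theta> + 1 - (h + \<theta> - 1)) * U (Suc M) z"
      using MVT2[of "h + \<theta> - 1" "h + \<theta> + 1" "U M" "U (Suc M)"] Suc.prems(1) by auto
    have "\<bar>U (Suc M) (h + (z - h))\<bar> \<le> B"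
      using z t by (intro Suc.prems(2)) auto
    then show ?thesis using z(3) by (simp add: V_def sym_diff_def abs_mult)
  qed
  ultimately have "\<bar>(sym_diff 1 ^^ M) (V 0) h\<bar> \<le> 2 ^ M * (2 * B)"
    by (rule Suc.IH)
  then show ?case by (simp add: V_def funpow_Suc_right del: funpow.simps)
qed

lemma sym_diff_funpow_line:
  "(sym_diff v ^^ M) f (x + h *\<^sub>R v) = (sym_diff (1::real) ^^ M) (\<lambda>h. f (x + h *\<^sub>R v)) h"
proof (induction M arbitrary: h)
  case (Suc M)
  have eq: "x + h *\<^sub>R v + v = x + (h + 1) *\<^sub>R v" "x + h *\<^sub>R v - v = x + (h - 1) *\<^sub>R v"
    by (simp_all add: algebra_simps)
  show ?case
    by (simp only: funpow.simps comp_apply sym_diff_def[of _ "(sym_diff _ ^^ M) _"] eq Suc.IH)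
qed simp

lemma poly_growth:
  fixes p :: "real poly"
  shows "\<exists>K n. \<forall>s. \<bar>poly p s\<bar> \<le> K * (1 + \<bar>s\<bar>) ^ n"
proof (induction p)
  case 0
  show ?case by (intro exI[of _ 0]) simp
next
  case (pCons a p)
  then obtain K n where Kn: "\<And>s. \<bar>poly p s\<bar> \<le> K * (1 + \<bar>s\<bar>) ^ n" by blast
  have "\<bar>poly (pCons a p) s\<bar> \<le> (\<bar>a\<bar> + K) * (1 + \<bar>s\<bar>) ^ Suc n" for s
  proof -
    have "\<bar>poly (pCons a p) s\<bar> \<le> \<bar>a\<bar> * 1 + \<bar>s\<bar> * \<bar>poly p s\<bar>"
      using abs_triangle_ineq[of a "s * poly p s"] by (simp add: abs_mult)
    also have "\<dots> \<le> \<bar>a\<bar> * (1 + \<bar>s\<bar>) ^ Suc n + (1 + \<bar>s\<bar>) * (K * (1 + \<bar>s\<bar>) ^ n)"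
      by (intro add_mono mult_left_mono mult_mono Kn one_le_power) auto
    finally show ?thesis by (simp add: algebra_simps)
  qed
  then show ?case by blast
qed

text \<open>Combines \<open>(1 + r / N) ^ N \<le> exp r\<close> with
  \<open>r - pi * r ^ 2 \<le> 1\<close>.\<close>

lemma power_exp_bound:
  assumes r: "r \<ge> (0::real)"
  shows "(1 + r) ^ N * exp (- pi * r\<^sup>2) \<le> real N ^ N * exp 1 + 1"
proof (cases "N = 0")
  case False
  have "(1 + r) ^ N \<le> (real N * (1 + r / real N)) ^ N"
    using False r by (intro power_mono) (auto simp: distrib_left)
  also have "\<dots> = real N ^ N * (1 + r / real N) ^ N" by (simp add: power_mult_distrib)
  also have "\<dots> \<le> real N ^ N * exp r"
    using False r by (intro mult_left_mono exp_ge_one_plus_x_over_n_power_n) auto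
  finally have "(1 + r) ^ N * exp (- pi * r\<^sup>2) \<le> real N ^ N * exp r * exp (- pi * r\<^sup>2)"
    by (rule mult_right_mono) simp
  also have "\<dots> = real N ^ N * exp (r - pi * r\<^sup>2)" by (simp add: exp_diff exp_minus field_simps)
  also have "\<dots> \<le> real N ^ N * exp 1"
  proof (intro mult_left_mono)
    have "r \<le> 1 + r\<^sup>2" using zero_le_power2[of "r - 1"] r by (simp add: power2_diff)
    also have "\<dots> \<le> 1 + pi * r\<^sup>2" using pi_gt3 mult_right_mono[of 1 pi "r\<^sup>2"] by simp
    finally show "exp (r - pi * r\<^sup>2) \<le> exp 1" by simp
  qed simp
  finally show ?thesis by simp
qed (simp add: order_trans[of _ 1])

text \<open>The Gaussian of integral one at scale \<open>\<rho>\<close>. Averaging the unit Gaussian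
  at scale \<open>t\<close> produces \<open>\<rho> = sqrt (1 + t ^ 2)\<close>, so maximal functions
  involve only \<open>\<rho> \<ge> 1\<close>.\<close>

definition scaled_gauss :: "real \<Rightarrow> 'a::euclidean_space \<Rightarrow> real" where
  "scaled_gauss \<rho> x = (1 / \<rho>) ^ DIM('a) * gauss ((1 / \<rho>) *\<^sub>R x)"

text \<open>The polynomials of the Rodrigues formula for the derivatives of the Gaussian in direction \<open>v\<close>.\<close>

primrec hermite_dir :: "'a::euclidean_space \<Rightarrow> nat \<Rightarrow> real poly" where
  "hermite_dir v 0 = 1"
| "hermite_dir v (Suc k) = smult ((norm v)\<^sup>2) (pderiv (hermite_dir v k)) - [:0, 2 * pi:] * hermite_dir v k"

lemma scaled_gauss_line_derivative:
  fixes v x :: "'a::euclidean_space"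
  assumes \<rho>: "\<rho> > 0"
  defines "U \<equiv> \<lambda>k h. (1 / \<rho>) ^ k * poly (hermite_dir v k) ((v \<bullet> (x + h *\<^sub>R v)) / \<rho>) * scaled_gauss \<rho> (x + h *\<^sub>R v)"
  shows "(U k has_real_derivative U (Suc k) h) (at h)"
proof -
  define c where "c = (1 / \<rho>) ^ DIM('a)"
  have n2: "(norm ((1 / \<rho>) *\<^sub>R (x + h *\<^sub>R v)))\<^sup>2 = ((norm x)\<^sup>2 + 2 * h * (v \<bullet> x) + h\<^sup>2 * (norm v)\<^sup>2) / \<rho>\<^sup>2" for h
  proof -
    have "(norm (x + h *\<^sub>R v))\<^sup>2 = (norm x)\<^sup>2 + 2 * h * (v \<bullet> x) + h\<^sup>2 * (norm v)\<^sup>2"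
      unfolding power2_norm_eq_inner
      by (simp add: inner_add_left inner_add_right inner_commute power2_eq_square algebra_simps)
    then show ?thesis using \<rho> by (simp add: power_divide power_mult_distrib del: scaleR_add_right)
  qed
  have g: "scaled_gauss \<rho> (x + h *\<^sub>R v) = c * exp (- pi * (((norm x)\<^sup>2 + 2 * h * (v \<bullet> x) + h\<^sup>2 * (norm v)\<^sup>2) / \<rho>\<^sup>2))" for h
    by (simp only: scaled_gauss_def c_def gauss_def n2)
  have inn: "v \<bullet> (x + h *\<^sub>R v) = v \<bullet> x + h * (norm v)\<^sup>2" for h
    by (simp add: inner_add_right power2_norm_eq_inner)
  have "((\<lambda>h. (1 / \<rho>) ^ k * poly (hermite_dir v k) ((v \<bullet> x + h * (norm v)\<^sup>2) / \<rho>) *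
      (c * exp (- pi * (((norm x)\<^sup>2 + 2 * h * (v \<bullet> x) + h\<^sup>2 * (norm v)\<^sup>2) / \<rho>\<^sup>2))))
    has_real_derivative
      (1 / \<rho>) ^ k * (poly (pderiv (hermite_dir v k)) ((v \<bullet> x + h * (norm v)\<^sup>2) / \<rho>) * ((norm v)\<^sup>2 / \<rho>)) *
      (c * exp (- pi * (((norm x)\<^sup>2 + 2 * h * (v \<bullet> x) + h\<^sup>2 * (norm v)\<^sup>2) / \<rho>\<^sup>2)))
      + (1 / \<rho>) ^ k * poly (hermite_dir v k) ((v \<bullet> x + h * (norm v)\<^sup>2) / \<rho>) *
      (c * (exp (- pi * (((norm x)\<^sup>2 + 2 * h * (v \<bullet> x) + h\<^sup>2 * (norm v)\<^sup>2) / \<rho>\<^sup>2)) *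
        (- pi * ((2 * (v \<bullet> x) + 2 * h * (norm v)\<^sup>2) / \<rho>\<^sup>2))))) (at h)"
    using \<rho> by (auto intro!: derivative_eq_intros DERIV_chain2[OF poly_DERIV] simp: field_simps)
  then show ?thesis
    unfolding U_def g inn
    by (rule DERIV_cong) (use \<rho> in \<open>simp add: field_simps power2_eq_square\<close>)
qed

text \<open>The \<open>M\<close> derivatives contribute \<open>\<rho> ^ (-M)\<close> besides the
  normalising factor \<open>\<rho> ^ (-DIM('a))\<close>. Together with Gaussian decay in
  \<open>norm y / \<rho>\<close> they yield a bound free of \<open>\<rho>\<close>, which is what a
  supremum over all scales requires.\<close>

lemma sym_diff_scaled_gauss_bound:
  fixes v :: "'a::euclidean_space"
  shows "\<exists>C>0. \<forall>\<rho>\<ge>1. \<forall>x. \<bar>(sym_diff v ^^ M) (scaled_gauss \<rho>) x\<bar> \<le> C * inverse ((1 + norm x) ^ (DIM('a) + M))"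
proof -
  define N where "N = DIM('a) + M"
  obtain K n where Kn: "\<And>s. \<bar>poly (hermite_dir v M) s\<bar> \<le> K * (1 + \<bar>s\<bar>) ^ n"
    using poly_growth by blast
  have K0: "K \<ge> 0" using Kn[of 0] by (auto intro: order_trans[OF abs_ge_zero])
  define E where "E = real (N + n) ^ (N + n) * exp 1 + 1"
  have E0: "E > 0" by (simp add: E_def add_nonneg_pos)
  define L where "L = K * (1 + norm v) ^ n * E"
  \<comment> \<open>The power of 2 comes from the mean value steps, the power of
    \<open>1 + M * norm v\<close> from moving the intermediate point
    \<open>x + \<theta> *\<^sub>R v\<close> back to \<open>x\<close>.\<close>
  define C where "C = 2 ^ M * ((L + 1) * (1 + real M * norm v) ^ N)"
  have L0: "L \<ge> 0" using K0 E0 by (simp add: L_def)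
  have "\<bar>(sym_diff v ^^ M) (scaled_gauss \<rho>) x\<bar> \<le> C * inverse ((1 + norm x) ^ N)" if \<rho>: "\<rho> \<ge> 1" for \<rho> x
  proof -
    define U where "U = (\<lambda>k h. (1 / \<rho>) ^ k * poly (hermite_dir v k) ((v \<bullet> (x + h *\<^sub>R v)) / \<rho>) * scaled_gauss \<rho> (x + h *\<^sub>R v))"
    have deriv: "(U k has_real_derivative U (Suc k) h) (at h)" for k h
      unfolding U_def using \<rho> by (intro scaled_gauss_line_derivative) simp
    have "\<bar>U M (0 + \<theta>)\<bar> \<le> (L + 1) * (1 + real M * norm v) ^ N * inverse ((1 + norm x) ^ N)" if t: "\<bar>\<theta>\<bar> \<le> real M" for \<theta>
    proof -
      define y where "y = x + \<theta> *\<^sub>R v"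
      define r where "r = norm y / \<rho>"
      have r0: "r \<ge> 0" using \<rho> by (simp add: r_def)
      have s: "\<bar>(v \<bullet> y) / \<rho>\<bar> \<le> norm v * r"
        using \<rho> Cauchy_Schwarz_ineq2[of v y] by (simp add: r_def divide_right_mono)
      have "\<bar>poly (hermite_dir v M) ((v \<bullet> y) / \<rho>)\<bar> \<le> K * (1 + \<bar>(v \<bullet> y) / \<rho>\<bar>) ^ n" by (rule Kn)
      also have "\<dots> \<le> K * ((1 + norm v) * (1 + r)) ^ n"
      proof (intro mult_left_mono power_mono K0)
        have "1 + \<bar>(v \<bullet> y) / \<rho>\<bar> \<le> 1 + norm v * r" using s by simp
        also have "\<dots> \<le> (1 + norm v) * (1 + r)" using r0 by (simp add: algebra_simps)
        finally show "1 + \<bar>(v \<bullet> y) / \<rho>\<bar> \<le> (1 + norm v) * (1 + r)" .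
      qed simp
      finally have p: "\<bar>poly (hermite_dir v M) ((v \<bullet> y) / \<rho>)\<bar> \<le> K * (1 + norm v) ^ n * (1 + r) ^ n"
        by (simp add: power_mult_distrib mult.assoc)
      have g: "gauss ((1 / \<rho>) *\<^sub>R y) = exp (- pi * r\<^sup>2)"
        using \<rho> by (simp add: gauss_def r_def power_divide power_mult_distrib)
      have "(1 + r) ^ (N + n) * exp (- pi * r\<^sup>2) \<le> E" unfolding E_def by (rule power_exp_bound[OF r0])
      then have e: "(1 + r) ^ n * exp (- pi * r\<^sup>2) \<le> E * inverse ((1 + r) ^ N)"
        using r0 by (simp add: power_add field_simps)
      have "\<bar>U M (0 + \<theta>)\<bar> = (1 / \<rho>) ^ N * (\<bar>poly (hermite_dir v M) ((v \<bullet> y) / \<rho>)\<bar> * exp (- pi * r\<^sup>2))"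
        using \<rho> by (simp add: U_def y_def[symmetric] scaled_gauss_def g abs_mult N_def power_add)
      also have "\<dots> \<le> (1 / \<rho>) ^ N * (K * (1 + norm v) ^ n * (1 + r) ^ n * exp (- pi * r\<^sup>2))"
        using \<rho> p by (intro mult_left_mono mult_right_mono) auto
      also have "\<dots> \<le> (1 / \<rho>) ^ N * (L * inverse ((1 + r) ^ N))"
        using \<rho> K0 mult_left_mono[OF e, of "K * (1 + norm v) ^ n"] by (intro mult_left_mono) (auto simp: L_def ac_simps)
      \<comment> \<open>The scale is absorbed here: \<open>\<rho> * (1 + r)\<close> equals
        \<open>\<rho> + norm y\<close>, which is at least \<open>1 + norm y\<close>.\<close>
      also have "\<dots> = L * inverse ((\<rho> + norm y) ^ N)"
        using \<rho> by (simp add: r_def field_simps power_divide power_mult_distrib[symmetric])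
      also have "\<dots> \<le> (L + 1) * inverse ((1 + norm y) ^ N)"
        using \<rho> L0 by (intro mult_mono le_imp_inverse_le power_mono) (auto intro!: zero_less_power add_pos_nonneg)
      also have "inverse ((1 + norm y) ^ N) \<le> (1 + real M * norm v) ^ N * inverse ((1 + norm x) ^ N)"
      proof -
        have "1 + norm x \<le> (1 + norm y) * (1 + norm (\<theta> *\<^sub>R v))"
          using one_plus_norm_mult[of y "- \<theta> *\<^sub>R v"] by (simp add: y_def)
        also have "\<dots> \<le> (1 + norm y) * (1 + real M * norm v)"
          using t by (intro mult_left_mono add_left_mono) (auto intro: mult_right_mono)
        finally have "(1 + norm x) ^ N \<le> (1 + norm y) ^ N * (1 + real M * norm v) ^ N"
          by (simp add: power_mult_distrib[symmetric] power_mono)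
        moreover have "0 < (1 + norm y) ^ N" "0 < (1 + norm x) ^ N" by (auto intro!: zero_less_power add_pos_nonneg)
        ultimately show ?thesis by (simp add: field_simps)
      qed
      finally show ?thesis using L0 by (simp add: mult.assoc mult_left_mono)
    qed
    from sym_diff_funpow_bound[of U, OF deriv this]
    have "\<bar>(sym_diff 1 ^^ M) (U 0) 0\<bar> \<le> 2 ^ M * ((L + 1) * (1 + real M * norm v) ^ N * inverse ((1 + norm x) ^ N))" .
    moreover have "U 0 = (\<lambda>h. scaled_gauss \<rho> (x + h *\<^sub>R v))" by (simp add: U_def)
    ultimately show ?thesis
      using sym_diff_funpow_line[where v=v and x=x and h=0 and f="scaled_gauss \<rho>" and M=M] by (simp add: C_def mult.assoc)
  qed
  moreover have "C > 0" unfolding C_def using add_nonneg_pos[OF L0 zero_less_one]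
    by (intro mult_pos_pos zero_less_power) (auto intro: add_pos_nonneg)
  ultimately show ?thesis unfolding N_def by blast
qed


text \<open>The \<open>M\<close>-th difference kills moments of order below \<open>M\<close>, which puts the function into \<open>H\<^sup>q\<close> for
  small \<open>q\<close>. For odd \<open>M\<close> it vanishes at the origin, which makes its dyadic dilates summable.\<close>

definition diff_gauss :: "'a::euclidean_space \<Rightarrow> nat \<Rightarrow> 'a \<Rightarrow> real" where
  "diff_gauss v M = (sym_diff v ^^ M) gauss"

lemma diff_gauss_0 [simp]: "diff_gauss v 0 = gauss"
  by (simp add: diff_gauss_def)

lemma diff_gauss_Suc: "diff_gauss v (Suc M) x = diff_gauss v M (x + v) - diff_gauss v M (x - v)"
  by (simp add: diff_gauss_def sym_diff_def)

lemma continuous_diff_gauss: "continuous_on UNIV (diff_gauss v M)"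
proof (induction M)
  case 0 show ?case by (simp add: continuous_on_gauss)
next
  case (Suc M)
  have "continuous_on UNIV (\<lambda>x. diff_gauss v M (x + w))" for w
    by (rule continuous_on_compose2[OF Suc]) (auto intro!: continuous_intros)
  from this[of v] this[of "- v"] show ?case
    by (simp add: diff_gauss_Suc[abs_def] continuous_on_diff)
qed

lemma diff_gauss_measurable [measurable]: "diff_gauss v M \<in> borel_measurable borel"
  by (intro borel_measurable_continuous_onI continuous_diff_gauss)

lemma diff_gauss_decay:
  "\<exists>C>0. \<forall>x::'a::euclidean_space. \<bar>diff_gauss v M x\<bar> \<le> C * (1 + norm x) powr (- (real (DIM('a) + M)))"
proof -
  have "scaled_gauss 1 = (gauss :: 'a \<Rightarrow> real)" by (simp add: fun_eq_iff scaled_gauss_def)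
  then show ?thesis
    using sym_diff_scaled_gauss_bound[of M v]
    by (metis diff_gauss_def order_refl powr_minus powr_realpow add_pos_nonneg zero_less_one norm_ge_zero)
qed

lemma integrable_diff_gauss: "integrable lborel (diff_gauss v M)"
proof (induction M)
  case 0 show ?case by (simp add: integrable_gauss)
next
  case (Suc M)
  show ?case
    using integrable_lborel_shift[OF Suc, of v] integrable_lborel_shift[OF Suc, of "- v"]
    by (simp add: diff_gauss_Suc[abs_def])
qed

lemma diff_gauss_uminus: "diff_gauss v M (- x) = (- 1) ^ M * diff_gauss v M x"
proof (induction M arbitrary: x)
  case (Suc M)
  have "- x + v = - (x - v)" "- x - v = - (x + v)" by simp_all
  then show ?case by (simp only: diff_gauss_Suc Suc.IH) (simp add: algebra_simps)
qed simp

lemma diff_gauss_at_zero: "odd M \<Longrightarrow> diff_gauss v M 0 = 0"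
  using diff_gauss_uminus[of v M 0] by simp

text \<open>Reduces to the radial profile, whose derivative is bounded by \<open>2 * pi\<close>
  because \<open>\<bar>t\<bar> \<le> 1 + t ^ 2 \<le> exp (pi * t ^ 2)\<close>.\<close>

lemma gauss_Lipschitz: "\<bar>gauss x - gauss y\<bar> \<le> 2 * pi * norm (x - y)"
proof -
  have "\<bar>exp (- pi * a\<^sup>2) - exp (- pi * b\<^sup>2)\<bar> \<le> 2 * pi * \<bar>a - b\<bar>" for a b :: real
  proof -
    have "norm (exp (- pi * a\<^sup>2) - exp (- pi * b\<^sup>2)) \<le> (2 * pi) * norm (a - b)"
    proof (rule field_differentiable_bound[of UNIV])
      show "((\<lambda>t. exp (- pi * t\<^sup>2)) has_field_derivative (exp (- pi * t\<^sup>2) * (- pi * (2 * t)))) (at t within UNIV)" for t :: real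
        by (auto intro!: derivative_eq_intros)
      show "norm (exp (- pi * t\<^sup>2) * (- pi * (2 * t))) \<le> 2 * pi" for t :: real
      proof -
        have "\<bar>t\<bar> \<le> 1 + t\<^sup>2" using zero_le_power2[of "\<bar>t\<bar> - 1"] by (simp add: power2_diff)
        also have "\<dots> \<le> 1 + pi * t\<^sup>2" using pi_gt3 mult_right_mono[of 1 pi "t\<^sup>2"] by simp
        also have "\<dots> \<le> exp (pi * t\<^sup>2)" by (rule exp_ge_add_one_self)
        finally have "exp (- pi * t\<^sup>2) * \<bar>t\<bar> \<le> 1" by (simp add: exp_minus field_simps)
        then show ?thesis by (simp add: abs_mult)
      qed
    qed auto
    then show ?thesis by simp
  qed
  from this[of "norm x" "norm y"] show ?thesis
    unfolding gauss_def
    by (rule order_trans) (simp add: norm_triangle_ineq3)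
qed

lemma diff_gauss_Lipschitz: "\<bar>diff_gauss v M x - diff_gauss v M y\<bar> \<le> 2 ^ M * (2 * pi) * norm (x - y)"
proof (induction M arbitrary: x y)
  case 0 show ?case using gauss_Lipschitz[of x y] by simp
next
  case (Suc M)
  show ?case using Suc[of "x + v" "y + v"] Suc[of "x - v" "y - v"]
    by (simp add: diff_gauss_Suc)
qed

section \<open>Fourier transforms and Gaussian averages of the differences\<close>

lemma fourier_shift:
  fixes f :: "'a::euclidean_space \<Rightarrow> complex"
  shows "fourier (\<lambda>x. f (x + v)) \<xi> = cis (2 * pi * (v \<bullet> \<xi>)) * fourier f \<xi>"
proof -
  have "fourier (\<lambda>x. f (x + v)) \<xi> = (\<integral>x. (\<lambda>y. cis (2 * pi * (v \<bullet> \<xi>)) * (f y * cis (- 2 * pi * (y \<bullet> \<xi>)))) (x + v) \<partial>lborel)"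
    unfolding fourier_def
  proof (intro Bochner_Integration.integral_cong refl)
    fix x
    have "cis (- 2 * pi * (x \<bullet> \<xi>)) = cis (2 * pi * (v \<bullet> \<xi>)) * cis (- 2 * pi * ((x + v) \<bullet> \<xi>))"
      by (simp add: cis_mult inner_add_left algebra_simps)
    then show "f (x + v) * cis (- 2 * pi * (x \<bullet> \<xi>)) = cis (2 * pi * (v \<bullet> \<xi>)) * (f (x + v) * cis (- 2 * pi * ((x + v) \<bullet> \<xi>)))"
      by (simp add: ac_simps)
  qed
  also have "\<dots> = (\<integral>y. cis (2 * pi * (v \<bullet> \<xi>)) * (f y * cis (- 2 * pi * (y \<bullet> \<xi>))) \<partial>lborel)"
    by (rule integral_lborel_shift)
  finally show ?thesis by (simp add: fourier_def)
qed

lemma fourier_diff: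
  fixes f g :: "'a::euclidean_space \<Rightarrow> complex"
  assumes "integrable lborel f" "integrable lborel g"
  shows "fourier (\<lambda>x. f x - g x) \<xi> = fourier f \<xi> - fourier g \<xi>"
  unfolding fourier_def left_diff_distrib
  by (rule Bochner_Integration.integral_diff) (intro integrable_times_cis assms continuous_intros)+

text \<open>Each difference multiplies the transform by the difference of two conjugate
  exponentials. The sine equals 1 where \<open>v \<bullet> \<xi> = 1/4\<close>, the normalisation
  under which nonvanishing is obtained later.\<close>

lemma fourier_diff_gauss:
  "fourier (\<lambda>x. complex_of_real (diff_gauss v M x)) \<xi> = (2 * \<i> * sin (2 * pi * (v \<bullet> \<xi>))) ^ M * gauss \<xi>"
proof (induction M)
  case 0 show ?case by (simp add: fourier_gauss)
next
  case (Suc M)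
  have int: "integrable lborel (\<lambda>x. complex_of_real (diff_gauss v M (x + w)))" for w
    by (intro integrable_of_real integrable_lborel_shift integrable_diff_gauss)
  have "fourier (\<lambda>x. complex_of_real (diff_gauss v (Suc M) x)) \<xi>
     = fourier (\<lambda>x. complex_of_real (diff_gauss v M (x + v)) - complex_of_real (diff_gauss v M (x + - v))) \<xi>"
    by (simp add: diff_gauss_Suc)
  also have "\<dots> = fourier (\<lambda>x. complex_of_real (diff_gauss v M (x + v))) \<xi> - fourier (\<lambda>x. complex_of_real (diff_gauss v M (x + - v))) \<xi>"
    by (rule fourier_diff[OF int int])
  also have "\<dots> = (cis (2 * pi * (v \<bullet> \<xi>)) - cis (2 * pi * (- v \<bullet> \<xi>))) * fourier (\<lambda>x. complex_of_real (diff_gauss v M x)) \<xi>"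
    by (simp only: fourier_shift[where f="\<lambda>x. complex_of_real (diff_gauss v M x)"] left_diff_distrib)
  also have "cis (2 * pi * (v \<bullet> \<xi>)) - cis (2 * pi * (- v \<bullet> \<xi>)) = 2 * \<i> * sin (2 * pi * (v \<bullet> \<xi>))"
    by (simp add: complex_eq_iff)
  finally show ?case by (simp add: Suc.IH)
qed

text \<open>Completing the square in \<open>y\<close>: squared scales add under convolution.\<close>

lemma gauss_convolution:
  fixes x :: "'a::euclidean_space"
  assumes t: "t > 0"
  shows "(\<integral>y. t powr (- real DIM('a)) * gauss ((1 / t) *\<^sub>R (x - y)) * gauss y \<partial>lborel) = scaled_gauss (sqrt (1 + t\<^sup>2)) x"
proof -
  define \<rho> where "\<rho> = sqrt (1 + t\<^sup>2)"
  have \<rho>: "\<rho> > 0" "\<rho>\<^sup>2 = 1 + t\<^sup>2" using t by (auto simp: \<rho>_def add_pos_pos)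
  have "(norm ((1 / t) *\<^sub>R (x - y)))\<^sup>2 + (norm y)\<^sup>2
     = (norm ((1 / \<rho>) *\<^sub>R x))\<^sup>2 + (norm (- (1 / (\<rho> * t)) *\<^sub>R x + (\<rho> / t) *\<^sub>R y))\<^sup>2" for y
  proof -
    have 1: "(norm ((1 / t) *\<^sub>R (x - y)))\<^sup>2 = (1 / t\<^sup>2) * ((norm x)\<^sup>2 - 2 * (x \<bullet> y) + (norm y)\<^sup>2)"
      unfolding power2_norm_eq_inner
      by (simp add: inner_diff_left inner_diff_right inner_commute power2_eq_square add_divide_distrib diff_divide_distrib)
    have 2: "(norm (- (1 / (\<rho> * t)) *\<^sub>R x + (\<rho> / t) *\<^sub>R y))\<^sup>2
       = (1 / (\<rho>\<^sup>2 * t\<^sup>2)) * (norm x)\<^sup>2 - 2 * (1 / t\<^sup>2) * (x \<bullet> y) + (\<rho>\<^sup>2 / t\<^sup>2) * (norm y)\<^sup>2"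
    proof -
      have "(norm (a *\<^sub>R x + b *\<^sub>R y))\<^sup>2 = a\<^sup>2 * (norm x)\<^sup>2 + 2 * (a * b) * (x \<bullet> y) + b\<^sup>2 * (norm y)\<^sup>2" for a b
        unfolding power2_norm_eq_inner
        by (simp add: inner_add_left inner_add_right inner_commute power2_eq_square algebra_simps)
      moreover have "(- (1 / (\<rho> * t))) * (\<rho> / t) = - (1 / t\<^sup>2)" "(- (1 / (\<rho> * t)))\<^sup>2 = 1 / (\<rho>\<^sup>2 * t\<^sup>2)"
        using \<rho>(1) t by (simp_all add: power2_eq_square)
      ultimately show ?thesis by (simp only: power_divide)
    qed
    have 3: "(norm ((1 / \<rho>) *\<^sub>R x))\<^sup>2 = (1 / \<rho>\<^sup>2) * (norm x)\<^sup>2"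
      using \<rho> by (simp add: power_divide)
    have "(1 / \<rho>\<^sup>2) + (1 / (\<rho>\<^sup>2 * t\<^sup>2)) = 1 / t\<^sup>2" "\<rho>\<^sup>2 / t\<^sup>2 = 1 + 1 / t\<^sup>2"
      using t \<rho>(1) unfolding \<rho>(2)[symmetric] by (simp_all add: field_simps) (use \<rho>(2) in \<open>simp_all add: field_simps\<close>)
    then have "(1 / \<rho>\<^sup>2) * (norm x)\<^sup>2 + (1 / (\<rho>\<^sup>2 * t\<^sup>2)) * (norm x)\<^sup>2 = (1 / t\<^sup>2) * (norm x)\<^sup>2"
      "(\<rho>\<^sup>2 / t\<^sup>2) * (norm y)\<^sup>2 = (norm y)\<^sup>2 + (1 / t\<^sup>2) * (norm y)\<^sup>2"
      by (metis distrib_right, metis distrib_right mult_1)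
    then show ?thesis unfolding 1 2 3 by (simp add: algebra_simps)
  qed
  then have eq: "gauss ((1 / t) *\<^sub>R (x - y)) * gauss y
     = gauss ((1 / \<rho>) *\<^sub>R x) * gauss (- (1 / (\<rho> * t)) *\<^sub>R x + (\<rho> / t) *\<^sub>R y)" for y
    unfolding gauss_def by (simp only: exp_add[symmetric] distrib_left[symmetric])
  have "(\<integral>y. t powr (- real DIM('a)) * gauss ((1 / t) *\<^sub>R (x - y)) * gauss y \<partial>lborel)
     = t powr (- real DIM('a)) * gauss ((1 / \<rho>) *\<^sub>R x) * (\<integral>y. gauss (- (1 / (\<rho> * t)) *\<^sub>R x + (\<rho> / t) *\<^sub>R y) \<partial>lborel)"
    by (simp only: mult.assoc eq integral_mult_right_zero)
  also have "(\<integral>y. gauss (- (1 / (\<rho> * t)) *\<^sub>R x + (\<rho> / t) *\<^sub>R y) \<partial>lborel) = (t / \<rho>) ^ DIM('a)"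
    using \<rho>(1) t integral_lborel_affine[of "\<rho> / t" gauss "- (1 / (\<rho> * t)) *\<^sub>R x"] by (simp add: integral_gauss)
  also have "t powr (- real DIM('a)) * gauss ((1 / \<rho>) *\<^sub>R x) * (t / \<rho>) ^ DIM('a) = scaled_gauss \<rho> x"
    using t \<rho>(1) by (simp add: powr_minus powr_realpow scaled_gauss_def power_divide field_simps)
  finally show ?thesis by (simp add: \<rho>_def)
qed

text \<open>Differences commute with convolution, so the average of a difference is a difference of
  scaled Gaussians, for which the uniform decay is available.\<close>

lemma diff_gauss_convolution:
  fixes x :: "'a::euclidean_space"
  assumes t: "t > 0"
  shows "(\<integral>y. t powr (- real DIM('a)) * gauss ((1 / t) *\<^sub>R (x - y)) * diff_gauss v M y \<partial>lborel)
     = (sym_diff v ^^ M) (scaled_gauss (sqrt (1 + t\<^sup>2))) x"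
proof (induction M arbitrary: x)
  case 0 show ?case using gauss_convolution[OF t] by simp
next
  case (Suc M)
  define k where "k x y = t powr (- real DIM('a)) * gauss ((1 / t) *\<^sub>R (x - y))" for x y :: 'a
  have int: "integrable lborel (\<lambda>y. k x y * diff_gauss v M y)" for x
  proof (rule Bochner_Integration.integrable_bound)
    show "integrable lborel (\<lambda>y. t powr (- real DIM('a)) * diff_gauss v M y)"
      by (intro integrable_mult_right integrable_diff_gauss)
    show "AE y in lborel. norm (k x y * diff_gauss v M y) \<le> norm (t powr (- real DIM('a)) * diff_gauss v M y)"
      by (auto intro!: AE_I2 mult_right_mono mult_left_le simp: k_def abs_mult)
    show "(\<lambda>y. k x y * diff_gauss v M y) \<in> borel_measurable lborel" unfolding k_def by measurable
  qed
  have shift: "integrable lborel (\<lambda>y. k x y * diff_gauss v M (y + w))"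
    "(\<integral>y. k x y * diff_gauss v M (y + w) \<partial>lborel) = (\<integral>y. k (x + w) y * diff_gauss v M y \<partial>lborel)" for x w
  proof -
    have "k (x + w) (y + w) = k x y" for y by (simp add: k_def)
    then show "integrable lborel (\<lambda>y. k x y * diff_gauss v M (y + w))"
      "(\<integral>y. k x y * diff_gauss v M (y + w) \<partial>lborel) = (\<integral>y. k (x + w) y * diff_gauss v M y \<partial>lborel)"
      using integrable_lborel_shift[OF int, of "x + w" w] integral_lborel_shift[of "\<lambda>y. k (x + w) y * diff_gauss v M y" w]
      by simp_all
  qed
  have "(\<integral>y. k x y * diff_gauss v (Suc M) y \<partial>lborel)
     = (\<integral>y. k x y * diff_gauss v M (y + v) - k x y * diff_gauss v M (y + - v) \<partial>lborel)"
    by (simp add: diff_gauss_Suc right_diff_distrib)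
  also have "\<dots> = (\<integral>y. k (x + v) y * diff_gauss v M y \<partial>lborel) - (\<integral>y. k (x + - v) y * diff_gauss v M y \<partial>lborel)"
    by (subst Bochner_Integration.integral_diff) (simp_all only: shift)
  also have "\<dots> = (sym_diff v ^^ Suc M) (scaled_gauss (sqrt (1 + t\<^sup>2))) x"
    by (simp only: funpow.simps comp_apply sym_diff_def[of v "(sym_diff v ^^ M) _"] Suc.IH[folded k_def] diff_conv_add_uminus)
  finally show ?case by (simp add: k_def)
qed


section \<open>Hardy norms\<close>

text \<open>Passing through an integrable majorant \<open>h\<close> keeps measurability of the
  maximal function out of the argument.\<close>

lemma lq_norm_le:
  fixes g :: "'a::euclidean_space \<Rightarrow> ennreal"
  assumes q: "q > 0" and g: "\<And>x. g x \<le> ennreal (b x)" and b: "\<And>x. 0 \<le> b x"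
    and h: "integrable lborel h" "\<And>x. b x powr q \<le> h x" and V: "(\<integral>x. h x \<partial>lborel) \<le> V"
  shows "lq_norm q g \<le> ennreal (V powr (1 / q))"
  unfolding lq_norm_def
proof (rule enn_powr_le)
  have h0: "0 \<le> h x" for x using h(2)[of x] powr_ge_zero order_trans by blast
  have "(\<integral>\<^sup>+x. enn_powr q (g x) \<partial>lborel) \<le> ennreal (\<integral>x. h x \<partial>lborel)"
  proof (rule nn_integral_le_integral[OF h(1) _ h0])
    fix x
    have "enn_powr q (g x) \<le> ennreal (b x powr q)" using q b g by (intro enn_powr_le) auto
    also have "\<dots> \<le> ennreal (h x)" using h(2) by (rule ennreal_leI)
    finally show "enn_powr q (g x) \<le> ennreal (h x)" .
  qed
  also have "\<dots> \<le> ennreal V" using V by (rule ennreal_leI)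
  finally show "(\<integral>\<^sup>+x. enn_powr q (g x) \<partial>lborel) \<le> ennreal V" .
  show "0 \<le> V" by (rule order_trans[OF Bochner_Integration.integral_nonneg V]) (rule h0)
qed (use q in simp)

text \<open>Every Gaussian average of the function is an \<open>M\<close>-th difference of a
  Gaussian at some scale at least 1, and the decay of these is uniform in the scale. The constant
  does not depend on the shift \<open>h\<close>.\<close>

lemma max_fun_diff_gauss:
  "\<exists>C>0. \<forall>h x::'a::euclidean_space. max_fun (\<lambda>y. complex_of_real (diff_gauss v M (y + h))) x
     \<le> ennreal (C * (1 + norm (x + h)) powr (- real (DIM('a) + M)))"
proof -
  obtain C where C: "C > 0" "\<And>\<rho> x. \<rho> \<ge> 1 \<Longrightarrow> \<bar>(sym_diff v ^^ M) (scaled_gauss \<rho>) (x::'a)\<bar> \<le> C * inverse ((1 + norm x) ^ (DIM('a) + M))"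
    using sym_diff_scaled_gauss_bound[of M v] by auto
  have "max_fun (\<lambda>y. complex_of_real (diff_gauss v M (y + h))) x
     \<le> ennreal (C * (1 + norm (x + h)) powr (- real (DIM('a) + M)))" for h x :: 'a
    unfolding max_fun_def
  proof (rule SUP_least)
    fix t :: real assume "t \<in> {0<..}"
    then have t: "t > 0" by simp
    have "(\<integral>y. complex_of_real (t powr (- real DIM('a)) * gauss ((1 / t) *\<^sub>R (x - y))) * complex_of_real (diff_gauss v M (y + h)) \<partial>lborel)
      = complex_of_real (\<integral>y. t powr (- real DIM('a)) * gauss ((1 / t) *\<^sub>R (x - y)) * diff_gauss v M (y + h) \<partial>lborel)"
      by (subst of_real_mult[symmetric], subst integral_complex_of_real) simp
    also have "(\<integral>y. t powr (- real DIM('a)) * gauss ((1 / t) *\<^sub>R (x - y)) * diff_gauss v M (y + h) \<partial>lborel)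
      = (\<integral>y. t powr (- real DIM('a)) * gauss ((1 / t) *\<^sub>R (x + h - y)) * diff_gauss v M y \<partial>lborel)"
      using integral_lborel_shift[of "\<lambda>y. t powr (- real DIM('a)) * gauss ((1 / t) *\<^sub>R (x + h - y)) * diff_gauss v M y" h]
      by simp
    also have "\<dots> = (sym_diff v ^^ M) (scaled_gauss (sqrt (1 + t\<^sup>2))) (x + h)"
      by (rule diff_gauss_convolution[OF t])
    finally have "norm (\<integral>y. complex_of_real (t powr (- real DIM('a)) * gauss ((1 / t) *\<^sub>R (x - y))) * complex_of_real (diff_gauss v M (y + h)) \<partial>lborel)
      = \<bar>(sym_diff v ^^ M) (scaled_gauss (sqrt (1 + t\<^sup>2))) (x + h)\<bar>" by simp
    also have "\<dots> \<le> C * inverse ((1 + norm (x + h)) ^ (DIM('a) + M))"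
      by (rule C(2)) simp
    also have "\<dots> = C * (1 + norm (x + h)) powr (- real (DIM('a) + M))"
      by (subst powr_minus, subst powr_realpow) (auto intro: add_pos_nonneg)
    finally show "ennreal (norm (\<integral>y. complex_of_real (t powr (- real DIM('a)) * gauss ((1 / t) *\<^sub>R (x - y))) * complex_of_real (diff_gauss v M (y + h)) \<partial>lborel))
      \<le> ennreal (C * (1 + norm (x + h)) powr (- real (DIM('a) + M)))" by (rule ennreal_leI)
  qed
  with C(1) show ?thesis by blast
qed

text \<open>The average of the dilate at scale \<open>t\<close> is the average of \<open>g\<close>
  at scale \<open>t * r\<close>.\<close>

lemma max_fun_dilate:
  fixes g :: "'a::euclidean_space \<Rightarrow> complex"
  assumes r: "r > 0"
  shows "max_fun (\<lambda>y. g (r *\<^sub>R y)) x \<le> max_fun g (r *\<^sub>R x)"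
  unfolding max_fun_def
proof (rule SUP_least)
  fix t :: real assume "t \<in> {0<..}"
  then have t: "t > 0" by simp
  have "(\<integral>y. complex_of_real (t powr (- real DIM('a)) * gauss ((1 / t) *\<^sub>R (x - y))) * g (r *\<^sub>R y) \<partial>lborel)
     = (\<integral>y. (\<lambda>u. complex_of_real (t powr (- real DIM('a)) * gauss ((1 / (t * r)) *\<^sub>R (r *\<^sub>R x - u))) * g u) (0 + r *\<^sub>R y) \<partial>lborel)"
    using r by (simp add: scaleR_diff_right)
  also have "\<dots> = (1 / \<bar>r\<bar>) ^ DIM('a) *\<^sub>R (\<integral>u. complex_of_real (t powr (- real DIM('a)) * gauss ((1 / (t * r)) *\<^sub>R (r *\<^sub>R x - u))) * g u \<partial>lborel)"
    using r by (intro integral_lborel_affine) simp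
  also have "\<dots> = (\<integral>u. (1 / r) ^ DIM('a) *\<^sub>R (complex_of_real (t powr (- real DIM('a)) * gauss ((1 / (t * r)) *\<^sub>R (r *\<^sub>R x - u))) * g u) \<partial>lborel)"
    using r by simp
  also have "\<dots> = (\<integral>u. complex_of_real ((t * r) powr (- real DIM('a)) * gauss ((1 / (t * r)) *\<^sub>R (r *\<^sub>R x - u))) * g u \<partial>lborel)"
    using r t by (intro Bochner_Integration.integral_cong)
      (auto simp: scaleR_conv_of_real powr_mult powr_minus powr_realpow power_one_over inverse_eq_divide)
  finally show "ennreal (norm (\<integral>y. complex_of_real (t powr (- real DIM('a)) * gauss ((1 / t) *\<^sub>R (x - y))) * g (r *\<^sub>R y) \<partial>lborel))
     \<le> (SUP t\<in>{0<..}. ennreal (norm (\<integral>u. complex_of_real (t powr (- real DIM('a)) * gauss ((1 / t) *\<^sub>R (r *\<^sub>R x - u))) * g u \<partial>lborel)))"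
    using r t by (auto intro!: SUP_upper2[of "t * r"])
qed

lemma max_fun_sum_le:
  fixes g :: "'m \<Rightarrow> 'a::euclidean_space \<Rightarrow> complex"
  assumes fin: "finite S" and g: "\<And>m. m \<in> S \<Longrightarrow> integrable lborel (g m)"
    and b: "\<And>m. m \<in> S \<Longrightarrow> max_fun (g m) x \<le> ennreal (b m)" "\<And>m. m \<in> S \<Longrightarrow> 0 \<le> b m"
  shows "max_fun (\<lambda>y. \<Sum>m\<in>S. of_real (c m) * g m y) x \<le> ennreal (\<Sum>m\<in>S. \<bar>c m\<bar> * b m)"
  unfolding max_fun_def
proof (rule SUP_least, rule ennreal_leI)
  fix t :: real assume t: "t \<in> {0<..}"
  define k where "k y = complex_of_real (t powr (- real DIM('a)) * gauss ((1 / t) *\<^sub>R (x - y)))" for y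
  have k_le: "norm (\<integral>y. k y * g m y \<partial>lborel) \<le> b m" if "m \<in> S" for m
  proof -
    have "ennreal (norm (\<integral>y. k y * g m y \<partial>lborel)) \<le> max_fun (g m) x"
      unfolding max_fun_def k_def using t by (rule SUP_upper)
    also have "\<dots> \<le> ennreal (b m)" using b that by simp
    finally show ?thesis using b(2)[OF that] by simp
  qed
  have int: "integrable lborel (\<lambda>y. g m y * k y)" if "m \<in> S" for m
    by (rule integrable_mult_bounded[OF g[OF that], of _ "t powr (- real DIM('a))"])
       (auto simp: k_def norm_mult intro!: mult_left_le borel_measurable_continuous_onI continuous_intros)
  have "(\<integral>y. k y * (\<Sum>m\<in>S. of_real (c m) * g m y) \<partial>lborel) = (\<Sum>m\<in>S. of_real (c m) * (\<integral>y. k y * g m y \<partial>lborel))"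
  proof -
    have "(\<integral>y. k y * (\<Sum>m\<in>S. of_real (c m) * g m y) \<partial>lborel) = (\<integral>y. (\<Sum>m\<in>S. of_real (c m) * (g m y * k y)) \<partial>lborel)"
      by (simp add: sum_distrib_left ac_simps)
    also have "\<dots> = (\<Sum>m\<in>S. of_real (c m) * (\<integral>y. g m y * k y \<partial>lborel))"
      by (subst Bochner_Integration.integral_sum) (auto intro!: integrable_mult_right int)
    finally show ?thesis by (simp add: mult.commute)
  qed
  then have "norm (\<integral>y. k y * (\<Sum>m\<in>S. of_real (c m) * g m y) \<partial>lborel) \<le> (\<Sum>m\<in>S. \<bar>c m\<bar> * b m)"
    using k_le by (auto intro!: order_trans[OF norm_sum] sum_mono mult_left_mono simp: norm_mult)
  then show "norm (\<integral>y. complex_of_real (t powr (- real DIM('a)) * gauss ((1 / t) *\<^sub>R (x - y))) * (\<Sum>m\<in>S. of_real (c m) * g m y) \<partial>lborel) \<le> (\<Sum>m\<in>S. \<bar>c m\<bar> * b m)"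
    by (simp add: k_def)
qed

section \<open>Inequalities for powers and dyadic sums\<close>

text \<open>A fraction in the unit interval is at most its \<open>q\<close>-th power; applied to
  \<open>a / (a + b)\<close> and \<open>b / (a + b)\<close>.\<close>

lemma powr_sum_subadditive:
  fixes x :: "'m \<Rightarrow> real"
  assumes q: "0 < q" "q \<le> 1" and x: "\<And>m. m \<in> S \<Longrightarrow> 0 \<le> x m"
  shows "(\<Sum>m\<in>S. x m) powr q \<le> (\<Sum>m\<in>S. x m powr q)"
proof -
  have add: "(a + b) powr q \<le> a powr q + b powr q" if "0 \<le> a" "0 \<le> b" for a b :: real
  proof (cases "a + b = 0")
    case False
    then have ab: "a + b > 0" using that by linarith
    have frac: "z / (a + b) \<le> (z / (a + b)) powr q" if "0 \<le> z" "z \<le> a + b" for z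
    proof (cases "z = 0")
      case False
      then show ?thesis
        using that ab q powr_mono'[of q 1 "z / (a + b)"] by simp
    qed simp
    have "1 = a / (a + b) + b / (a + b)" using ab by (simp add: add_divide_distrib[symmetric])
    also have "\<dots> \<le> (a / (a + b)) powr q + (b / (a + b)) powr q"
      using that by (intro add_mono frac) auto
    also have "\<dots> = (a powr q + b powr q) / (a + b) powr q"
      using that ab by (simp add: powr_divide add_divide_distrib)
    finally show ?thesis using ab by (simp add: field_simps)
  qed (use that q in auto)
  show ?thesis
    using x
  proof (induction S rule: infinite_finite_induct)
    case (insert m S)
    have "(\<Sum>m\<in>insert m S. x m) powr q \<le> x m powr q + (\<Sum>m\<in>S. x m) powr q"
      using insert by (simp add: add sum_nonneg)
    also have "\<dots> \<le> (\<Sum>m\<in>insert m S. x m powr q)" using insert by simp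
    finally show ?case .
  qed auto
qed

text \<open>Jensen's inequality with weights proportional to \<open>u\<close>. It serves for
  \<open>u m\<close> the modulus of a fixed profile at \<open>x / 2 ^ m\<close>, whose sum over
  \<open>m\<close> is bounded: the \<open>q\<close>-th power of the sum of the dilates is then
  controlled by the sum of \<open>q\<close>-th powers of the coefficients.\<close>

lemma powr_weighted_sum_le:
  fixes a u :: "'m \<Rightarrow> real"
  assumes q: "1 \<le> q" and a: "\<And>m. m \<in> S \<Longrightarrow> 0 < a m" and u: "\<And>m. m \<in> S \<Longrightarrow> 0 \<le> u m" and fin: "finite S"
    and U: "(\<Sum>m\<in>S. u m) \<le> U"
  shows "(\<Sum>m\<in>S. a m * u m) powr q \<le> U powr (q - 1) * (\<Sum>m\<in>S. a m powr q * u m)"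
proof (cases "(\<Sum>m\<in>S. u m) = 0")
  case True
  then have "\<And>m. m \<in> S \<Longrightarrow> u m = 0" using fin u sum_nonneg_eq_0_iff by blast
  then show ?thesis using q by simp
next
  case False
  define T where "T = (\<Sum>m\<in>S. u m)"
  have T: "T > 0" using False u by (simp add: T_def less_le sum_nonneg)
  have "(\<Sum>m\<in>S. (u m / T) *\<^sub>R a m) powr q \<le> (\<Sum>m\<in>S. (u m / T) * a m powr q)"
    using False T fin a u
    by (intro convex_on_sum[OF _ _ powr_convex[OF q]]) (auto simp: T_def sum_divide_distrib[symmetric])
  then have "((\<Sum>m\<in>S. a m * u m) / T) powr q \<le> (\<Sum>m\<in>S. a m powr q * u m) / T"
    by (simp add: sum_divide_distrib mult.commute)
  moreover have "((\<Sum>m\<in>S. a m * u m) / T) powr q = (\<Sum>m\<in>S. a m * u m) powr q / T powr q"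
    using T a u by (intro powr_divide)
  ultimately have "(\<Sum>m\<in>S. a m * u m) powr q \<le> T powr q / T * (\<Sum>m\<in>S. a m powr q * u m)"
    using T by (simp add: field_simps)
  also have "T powr q / T = T powr (q - 1)" using T by (simp add: powr_diff)
  also have "\<dots> * (\<Sum>m\<in>S. a m powr q * u m) \<le> U powr (q - 1) * (\<Sum>m\<in>S. a m powr q * u m)"
    using q u U T by (intro mult_right_mono powr_mono2 sum_nonneg) (auto simp: T_def)
  finally show ?thesis .
qed

text \<open>The values \<open>r * (1/2) ^ m\<close> cross 1 at the index \<open>m0\<close>; on
  either side the minimum is dominated by a geometric series with sum at most 2.\<close>

lemma sum_dyadic_min_le:
  fixes r :: real
  assumes r: "r \<ge> 0" and fin: "finite S"
  shows "(\<Sum>m\<in>S. min (r * (1/2) ^ m) (inverse (r * (1/2) ^ m))) \<le> 4"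
proof (cases "r = 0")
  case False
  then have r0: "r > 0" using r by simp
  define m0 where "m0 = (LEAST m. r \<le> 2 ^ m)"
  obtain k where "r < 2 ^ k" using real_arch_pow[of 2 r] by auto
  then have m0: "r \<le> 2 ^ m0" unfolding m0_def by (intro LeastI[of "\<lambda>m. r \<le> 2 ^ m" k, OF less_imp_le])
  \<comment> \<open>Minimality of \<open>m0\<close>. In the case \<open>m0 = 0\<close> the series on
    the left is empty.\<close>
  have small: "2 ^ m0 \<le> 2 * r \<or> m0 = 0"
  proof (cases m0)
    case (Suc n)
    then have "\<not> r \<le> 2 ^ n" unfolding m0_def using not_less_Least[of n "\<lambda>m. r \<le> 2 ^ m"] by simp
    then show ?thesis using Suc by simp
  qed simp
  obtain L where L: "S \<subseteq> {..<L}" using fin finite_nat_iff_bounded by auto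
  have "(\<Sum>m\<in>S. min (r * (1/2) ^ m) (inverse (r * (1/2) ^ m)))
     \<le> (\<Sum>m\<in>{..<m0} \<union> {m0..<m0 + L}. min (r * (1/2) ^ m) (inverse (r * (1/2) ^ m)))"
    using L r0 by (intro sum_mono2) auto
  also have "\<dots> = (\<Sum>m<m0. min (r * (1/2) ^ m) (inverse (r * (1/2) ^ m))) + (\<Sum>m=m0..<m0+L. min (r * (1/2) ^ m) (inverse (r * (1/2) ^ m)))"
    by (rule sum.union_disjoint) auto
  also have "\<dots> \<le> (\<Sum>m<m0. inverse (r * (1/2) ^ m)) + (\<Sum>m=m0..<m0+L. r * (1/2) ^ m)"
    by (intro add_mono sum_mono) auto
  also have "(\<Sum>m<m0. inverse (r * (1/2) ^ m)) \<le> 2"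
  proof -
    have "(\<Sum>m<m0. inverse (r * (1/2) ^ m)) = (\<Sum>m<m0. 2 ^ m) / r"
      by (simp add: sum_divide_distrib power_one_over inverse_eq_divide)
    also have "(\<Sum>m<m0. 2 ^ m) = (2 ^ m0 - 1 :: real)" by (simp add: geometric_sum)
    also have "(2 ^ m0 - 1) / r \<le> 2" using small r0 by (auto simp: field_simps)
    finally show ?thesis .
  qed
  also have "(\<Sum>m=m0..<m0+L. r * (1/2) ^ m) \<le> 2"
  proof -
    have "(\<Sum>m=m0..<m0+L. r * (1/2) ^ m) = r * (1/2) ^ m0 * (\<Sum>m<L. (1/2) ^ m)"
      by (simp add: sum.atLeastLessThan_shift_0[of _ m0] sum_distrib_left power_add atLeast0LessThan ac_simps)
    also have "(\<Sum>m<L. (1/2) ^ m) \<le> (2::real)" by (simp add: geometric_sum)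
    also have "r * (1/2) ^ m0 * 2 \<le> 2" using m0 by (simp add: power_one_over field_simps)
    finally show ?thesis using r0 by simp
  qed
  finally show ?thesis by simp
qed simp


text \<open>With \<open>\<beta> = d / q\<close> each dilate has the same size in the space of
  exponent \<open>q\<close>; the factors \<open>\<eta> m\<close> are the signs.\<close>

definition dyadic_sum :: "('a::real_vector \<Rightarrow> real) \<Rightarrow> real \<Rightarrow> nat set \<Rightarrow> (nat \<Rightarrow> real) \<Rightarrow> 'a \<Rightarrow> real" where
  "dyadic_sum \<psi> \<beta> S \<eta> x = (\<Sum>m\<in>S. \<eta> m * 2 powr (- (real m * \<beta>)) * \<psi> ((1/2) ^ m *\<^sub>R x))"

lemma ereal_cases_pos:
  assumes "0 < (q::ereal)"
  obtains (infinite) "q = \<infinity>" | (finite) r where "q = ereal r" "0 < r"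
  using assms by (cases q) auto

lemma hardy_norm_finite_le:
  "q \<le> 1 \<Longrightarrow> hardy_norm (ereal q) f = lq_norm q (max_fun f)"
  "q > 1 \<Longrightarrow> hardy_norm (ereal q) f = lq_norm q (\<lambda>x. ennreal (norm (f x)))"
  "hardy_norm \<infinity> f = esssup lborel (\<lambda>x. ennreal (norm (f x)))"
  by (auto simp: hardy_norm_def Lp_norm_def one_ereal_def)

lemma integral_dyadic_dilate:
  fixes w :: "'a::euclidean_space \<Rightarrow> real"
  assumes "integrable lborel w"
  shows "integrable lborel (\<lambda>x. w ((1/2) ^ m *\<^sub>R x))"
    and "(\<integral>x. w ((1/2) ^ m *\<^sub>R x) \<partial>lborel) = 2 powr (real m * real DIM('a)) * (\<integral>x. w x \<partial>lborel)"
proof -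
  show "integrable lborel (\<lambda>x. w ((1/2) ^ m *\<^sub>R x))"
    using integrable_lborel_affine[OF assms, of "(1/2) ^ m" 0] by simp
  have "(1 / \<bar>(1/2) ^ m\<bar>) ^ DIM('a) = 2 powr (real m * real DIM('a))"
    by (simp add: power_one_over powr_realpow[symmetric] powr_powr[symmetric])
  then show "(\<integral>x. w ((1/2) ^ m *\<^sub>R x) \<partial>lborel) = 2 powr (real m * real DIM('a)) * (\<integral>x. w x \<partial>lborel)"
    using integral_lborel_affine[of "(1/2) ^ m" w 0] by simp
qed

text \<open>Near the origin the vanishing value and the Lipschitz bound give size
  \<open>norm z\<close>, far away the decay gives size \<open>1 / norm z\<close>. The dyadic sum of
  the smaller of the two is bounded.\<close>

lemma diff_gauss_sum_dyadic_bounded: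
  fixes v :: "'a::euclidean_space"
  assumes M: "odd M"
  shows "\<exists>U>0. \<forall>S x. finite S \<longrightarrow> (\<Sum>m\<in>S. \<bar>diff_gauss v M ((1/2) ^ m *\<^sub>R x)\<bar>) \<le> U"
proof -
  obtain C where C: "C > 0" "\<And>x::'a. \<bar>diff_gauss v M x\<bar> \<le> C * (1 + norm x) powr (- (real (DIM('a) + M)))"
    using diff_gauss_decay[of v M] by blast
  define L where "L = 2 ^ M * (2 * pi)"
  have L: "L > 0" by (simp add: L_def)
  have pt: "\<bar>diff_gauss v M z\<bar> \<le> (L + C) * min (norm z) (inverse (norm z))" for z
  proof (cases "z = 0")
    case True then show ?thesis using diff_gauss_at_zero[OF M] by simp
  next
    case False
    have "\<bar>diff_gauss v M z\<bar> \<le> L * norm z"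
      using diff_gauss_Lipschitz[of v M z 0] diff_gauss_at_zero[OF M, of v] by (simp add: L_def)
    also have "\<dots> \<le> (L + C) * norm z" using C by (intro mult_right_mono) auto
    finally have 1: "\<bar>diff_gauss v M z\<bar> \<le> (L + C) * norm z" .
    have "(1 + norm z) powr (- (real (DIM('a) + M))) \<le> (1 + norm z) powr (- 1)"
    proof (intro powr_mono)
      have "1 \<le> real DIM('a)" using DIM_positive[where 'a='a] by linarith
      then show "- real (DIM('a) + M) \<le> - 1" unfolding of_nat_add by linarith
    qed simp
    also have "\<dots> \<le> inverse (norm z)"
      using False by (simp add: powr_minus le_imp_inverse_le)
    finally have "\<bar>diff_gauss v M z\<bar> \<le> C * inverse (norm z)"
      using C by (intro order_trans[OF C(2)] mult_left_mono) auto
    also have "\<dots> \<le> (L + C) * inverse (norm z)" using L by (intro mult_right_mono) auto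
    finally show ?thesis using 1 by (simp add: min_def)
  qed
  have "(\<Sum>m\<in>S. \<bar>diff_gauss v M ((1/2) ^ m *\<^sub>R x)\<bar>) \<le> (L + C) * 4" if "finite S" for S x
  proof -
    have "(\<Sum>m\<in>S. \<bar>diff_gauss v M ((1/2) ^ m *\<^sub>R x)\<bar>) \<le> (\<Sum>m\<in>S. (L + C) * min (norm x * (1/2) ^ m) (inverse (norm x * (1/2) ^ m)))"
      by (rule sum_mono) (use pt[of "(1/2) ^ _ *\<^sub>R x"] in \<open>simp add: mult.commute\<close>)
    also have "\<dots> = (L + C) * (\<Sum>m\<in>S. min (norm x * (1/2) ^ m) (inverse (norm x * (1/2) ^ m)))"
      by (simp add: sum_distrib_left)
    also have "\<dots> \<le> (L + C) * 4"
      using C L that by (intro mult_left_mono sum_dyadic_min_le) auto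
    finally show ?thesis .
  qed
  then show ?thesis using C L by (intro exI[of _ "(L + C) * 4"]) auto
qed

lemma dyadic_coeff_powr:
  assumes "r \<noteq> 0"
  shows "(2 powr (- (real m * (d * (1 / r))))) powr r * 2 powr (real m * d) = 1"
  using assms by (simp add: powr_powr powr_add[symmetric])

text \<open>The growth is that of dilates with disjoint supports. For \<open>q \<le> 1\<close> it
  follows from subadditivity of the \<open>q\<close>-th power applied to the maximal functions, for
  finite \<open>q > 1\<close> from Jensen's inequality with the bounded dyadic sum, and for
  \<open>q = \<infinity>\<close> from that sum itself. The moment condition makes the
  \<open>q\<close>-th power of the maximal function integrable.\<close>

lemma hardy_norm_dyadic_sum:
  fixes v :: "'a::euclidean_space"
  assumes q: "0 < q" and M: "odd M"
    and moment: "q \<noteq> \<infinity> \<Longrightarrow> 2 * real DIM('a) \<le> real (DIM('a) + M) * real_of_ereal q"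
  shows "\<exists>B>0. \<forall>S \<eta>. finite S \<longrightarrow> S \<noteq> {} \<longrightarrow> (\<forall>m. \<bar>\<eta> m\<bar> \<le> 1) \<longrightarrow>
     hardy_norm q (\<lambda>x. complex_of_real (dyadic_sum (diff_gauss v M) (real DIM('a) * recip q) S \<eta> x))
       \<le> ennreal (B * real (card S) powr recip q)"
proof -
  define \<psi> where "\<psi> = diff_gauss v M"
  define d where "d = real DIM('a)"
  obtain U where U: "U > 0" "\<And>S x. finite S \<Longrightarrow> (\<Sum>m\<in>S. \<bar>\<psi> ((1/2) ^ m *\<^sub>R x)\<bar>) \<le> U"
    using diff_gauss_sum_dyadic_bounded[OF M, of v] unfolding \<psi>_def by blast
  have norm_le: "norm (complex_of_real (dyadic_sum \<psi> \<beta> S \<eta> x)) \<le> (\<Sum>m\<in>S. 2 powr (- (real m * \<beta>)) * \<bar>\<psi> ((1/2) ^ m *\<^sub>R x)\<bar>)"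
    if "\<forall>m. \<bar>\<eta> m\<bar> \<le> 1" for \<beta> S \<eta> x
    unfolding norm_of_real dyadic_sum_def
    by (intro order_trans[OF sum_abs] sum_mono) (use that in \<open>auto simp: abs_mult mult.assoc intro!: mult_left_le_one_le\<close>)
  have meas: "dyadic_sum \<psi> \<beta> S \<eta> \<in> borel_measurable borel" for \<beta> S \<eta>
    unfolding dyadic_sum_def[abs_def] \<psi>_def by measurable
  show ?thesis
    using q
  proof (cases rule: ereal_cases_pos)
    case infinite
    have "hardy_norm q (\<lambda>x. complex_of_real (dyadic_sum \<psi> (d * recip q) S \<eta> x)) \<le> ennreal U"
      if "finite S" "\<forall>m. \<bar>\<eta> m\<bar> \<le> 1" for S \<eta>
      unfolding infinite hardy_norm_finite_le
    proof (rule esssup_I)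
      have "norm (complex_of_real (dyadic_sum \<psi> (d * recip \<infinity>) S \<eta> x)) \<le> U" for x
        using norm_le[OF that(2), of "d * recip \<infinity>" S x] U(2)[OF that(1), of x] by (simp add: recip_def)
      then show "AE x in lborel. ennreal (norm (complex_of_real (dyadic_sum \<psi> (d * recip \<infinity>) S \<eta> x))) \<le> ennreal U"
        by (intro AE_I2 ennreal_leI)
    qed (use meas in simp)
    then show ?thesis
      using U(1) infinite unfolding \<psi>_def d_def by (intro exI[of _ U]) (auto simp: recip_def)
  next
    case (finite r)
    have rq: "recip q = 1 / r" using finite by (simp add: recip_def)
    show ?thesis
    proof (cases "r \<le> 1")
      case True
      define N where "N = real (DIM('a) + M)"
      obtain C where C': "C > 0" "\<And>h x::'a. max_fun (\<lambda>y. complex_of_real (\<psi> (y + h))) x \<le> ennreal (C * (1 + norm (x + h)) powr (- N))"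
        using max_fun_diff_gauss[of v M] unfolding \<psi>_def N_def by blast
      then have C: "C > 0" "max_fun (\<lambda>y. complex_of_real (\<psi> y)) x \<le> ennreal (C * (1 + norm x) powr (- N))" for x :: 'a
        using C'(2)[of 0 x] by simp_all
      define w where "w x = (1 + norm x) powr (- (N * r))" for x :: 'a
      have w: "integrable lborel w"
        unfolding w_def by (rule integrable_one_plus_norm_powr) (use moment finite in \<open>simp add: N_def\<close>)
      define I where "I = (\<integral>x. w x \<partial>lborel)"
      have I0: "I \<ge> 0" unfolding I_def w_def by (intro Bochner_Integration.integral_nonneg) simp
      define B where "B = (C powr r * (I + 1)) powr (1 / r)"
      have "hardy_norm q (\<lambda>x. complex_of_real (dyadic_sum \<psi> (d * recip q) S \<eta> x)) \<le> ennreal (B * real (card S) powr recip q)"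
        if S: "finite S" and \<eta>: "\<forall>m. \<bar>\<eta> m\<bar> \<le> 1" for S \<eta>
      proof -
        define a where "a m = 2 powr (- (real m * (d * (1 / r))))" for m
        define b where "b x = (\<Sum>m\<in>S. a m * (C * (1 + norm ((1/2) ^ m *\<^sub>R x)) powr (- N)))" for x :: 'a
        define h where "h x = (\<Sum>m\<in>S. a m powr r * C powr r * w ((1/2) ^ m *\<^sub>R x))" for x
        have "lq_norm r (max_fun (\<lambda>x. complex_of_real (dyadic_sum \<psi> (d * (1 / r)) S \<eta> x))) \<le> ennreal ((real (card S) * (C powr r * (I + 1))) powr (1 / r))"
        proof (rule lq_norm_le[where b=b and h=h])
          fix x
          have "max_fun (\<lambda>y. complex_of_real (\<psi> ((1/2) ^ m *\<^sub>R y))) x \<le> ennreal (C * (1 + norm ((1/2) ^ m *\<^sub>R x)) powr (- N))" for m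
            by (rule order_trans[OF max_fun_dilate[of "(1/2) ^ m" "\<lambda>y. complex_of_real (\<psi> y)"] C(2)]) simp
          moreover have "complex_of_real (dyadic_sum \<psi> (d * (1 / r)) S \<eta> y) = (\<Sum>m\<in>S. of_real (\<eta> m * a m) * of_real (\<psi> ((1/2) ^ m *\<^sub>R y)))" for y
            by (simp add: dyadic_sum_def a_def)
          ultimately have "max_fun (\<lambda>y. complex_of_real (dyadic_sum \<psi> (d * (1 / r)) S \<eta> y)) x
             \<le> ennreal (\<Sum>m\<in>S. \<bar>\<eta> m * a m\<bar> * (C * (1 + norm ((1/2) ^ m *\<^sub>R x)) powr (- N)))"
            using S C(1) integral_dyadic_dilate(1)[OF integrable_diff_gauss[of v M]]
            by (simp only:) (intro max_fun_sum_le, auto intro!: integrable_of_real simp: \<psi>_def)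
          also have "\<dots> \<le> ennreal (b x)"
            unfolding b_def using \<eta> C(1)
            by (intro ennreal_leI sum_mono mult_right_mono) (auto simp: a_def abs_mult intro!: mult_left_le_one_le)
          finally show "max_fun (\<lambda>y. complex_of_real (dyadic_sum \<psi> (d * (1 / r)) S \<eta> y)) x \<le> ennreal (b x)" .
          show "0 \<le> b x" unfolding b_def using C(1) by (intro sum_nonneg) (auto simp: a_def)
          have "b x powr r \<le> (\<Sum>m\<in>S. (a m * (C * (1 + norm ((1/2) ^ m *\<^sub>R x)) powr (- N))) powr r)"
            unfolding b_def using C(1) True finite by (intro powr_sum_subadditive) (auto simp: a_def)
          also have "\<dots> = h x" unfolding h_def
            by (simp add: powr_mult powr_powr w_def mult.assoc)
          finally show "b x powr r \<le> h x" .
        next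
          show "integrable lborel h" unfolding h_def
            by (intro Bochner_Integration.integrable_sum integrable_mult_right integral_dyadic_dilate w)
          have "(\<integral>x. h x \<partial>lborel) = (\<Sum>m\<in>S. (a m powr r * 2 powr (real m * d)) * (C powr r * I))"
            unfolding h_def
            by (subst Bochner_Integration.integral_sum)
              (auto intro!: integrable_mult_right integral_dyadic_dilate(1) w sum.cong simp: integral_dyadic_dilate(2)[OF w] I_def d_def)
          \<comment> \<open>The \<open>r\<close>-th power of the coefficient cancels the Jacobian of
            the dilation, so every dilate contributes the same amount.\<close>
          also have "\<dots> = real (card S) * (C powr r * I)"
            using finite by (simp only: a_def dyadic_coeff_powr[OF less_imp_neq[THEN not_sym]]) simp
          also have "\<dots> \<le> real (card S) * (C powr r * (I + 1))" by (intro mult_left_mono) auto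
          finally show "(\<integral>x. h x \<partial>lborel) \<le> real (card S) * (C powr r * (I + 1))" .
        qed (use finite in auto)
        then show ?thesis
          unfolding rq unfolding finite hardy_norm_finite_le(1)[OF True]
          by (simp add: B_def powr_mult mult.commute)
      qed
      moreover have "B > 0" using C(1) I0 by (simp add: B_def)
      ultimately show ?thesis unfolding \<psi>_def d_def by (intro exI[of _ B]) auto
    next
      case False
      define I where "I = (\<integral>x. \<bar>\<psi> x\<bar> \<partial>lborel)"
      have \<psi>: "integrable lborel (\<lambda>x. \<bar>\<psi> x\<bar>)" unfolding \<psi>_def by (intro integrable_abs integrable_diff_gauss)
      have I0: "I \<ge> 0" unfolding I_def by (intro Bochner_Integration.integral_nonneg) simp
      define B where "B = (U powr (r - 1) * (I + 1)) powr (1 / r)"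
      have "hardy_norm q (\<lambda>x. complex_of_real (dyadic_sum \<psi> (d * recip q) S \<eta> x)) \<le> ennreal (B * real (card S) powr recip q)"
        if S: "finite S" and \<eta>: "\<forall>m. \<bar>\<eta> m\<bar> \<le> 1" for S \<eta>
      proof -
        define a where "a m = 2 powr (- (real m * (d * (1 / r))))" for m
        define b where "b x = (\<Sum>m\<in>S. a m * \<bar>\<psi> ((1/2) ^ m *\<^sub>R x)\<bar>)" for x
        define h where "h x = U powr (r - 1) * (\<Sum>m\<in>S. a m powr r * \<bar>\<psi> ((1/2) ^ m *\<^sub>R x)\<bar>)" for x
        have "lq_norm r (\<lambda>x. ennreal (norm (complex_of_real (dyadic_sum \<psi> (d * (1 / r)) S \<eta> x)))) \<le> ennreal ((real (card S) * (U powr (r - 1) * (I + 1))) powr (1 / r))"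
        proof (rule lq_norm_le[where b=b and h=h])
          fix x
          show "ennreal (norm (complex_of_real (dyadic_sum \<psi> (d * (1 / r)) S \<eta> x))) \<le> ennreal (b x)"
            unfolding b_def a_def using norm_le[OF \<eta>] by (intro ennreal_leI)
          show "0 \<le> b x" unfolding b_def by (intro sum_nonneg) (auto simp: a_def)
          show "b x powr r \<le> h x"
            unfolding b_def h_def using False S U by (intro powr_weighted_sum_le) (auto simp: a_def)
        next
          show "integrable lborel h" unfolding h_def
            by (intro Bochner_Integration.integrable_sum integrable_mult_right integral_dyadic_dilate[OF \<psi>])
          have "(\<integral>x. h x \<partial>lborel) = U powr (r - 1) * (\<Sum>m\<in>S. (a m powr r * 2 powr (real m * d)) * I)"
            unfolding h_def integral_mult_right_zero
            by (subst Bochner_Integration.integral_sum)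
              (auto intro!: integrable_mult_right integral_dyadic_dilate(1)[OF \<psi>] sum.cong simp: integral_dyadic_dilate(2)[OF \<psi>] I_def d_def)
          also have "\<dots> = real (card S) * (U powr (r - 1) * I)"
            using finite by (simp only: a_def dyadic_coeff_powr[OF less_imp_neq[THEN not_sym]]) simp
          also have "\<dots> \<le> real (card S) * (U powr (r - 1) * (I + 1))" by (intro mult_left_mono) auto
          finally show "(\<integral>x. h x \<partial>lborel) \<le> real (card S) * (U powr (r - 1) * (I + 1))" .
        qed (use finite in auto)
        then show ?thesis
          unfolding rq unfolding finite using False
          by (simp add: hardy_norm_finite_le B_def powr_mult mult.commute)
      qed
      moreover have "B > 0" using U(1) I0 by (simp add: B_def)
      ultimately show ?thesis unfolding \<psi>_def d_def by (intro exI[of _ B]) auto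
    qed
  qed
qed

text \<open>One decaying majorant bounds both the function and its maximal function, hence serves
  either branch of the Hardy norm.\<close>

lemma hardy_norm_diff_gauss_shift:
  fixes v :: "'a::euclidean_space"
  assumes q: "0 < q"
    and moment: "q \<noteq> \<infinity> \<Longrightarrow> 2 * real DIM('a) \<le> real (DIM('a) + M) * real_of_ereal q"
  shows "\<exists>B>0. hardy_norm q (\<lambda>x. complex_of_real (diff_gauss v M (x + h))) \<le> ennreal B"
proof -
  define N where "N = real (DIM('a) + M)"
  obtain C1 where C1: "C1 > 0" "\<And>x::'a. max_fun (\<lambda>y. complex_of_real (diff_gauss v M (y + h))) x \<le> ennreal (C1 * (1 + norm (x + h)) powr (- N))"
    using max_fun_diff_gauss[of v M] unfolding N_def by blast
  obtain C2 where C2: "C2 > 0" "\<And>x::'a. \<bar>diff_gauss v M x\<bar> \<le> C2 * (1 + norm x) powr (- N)"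
    using diff_gauss_decay[of v M] unfolding N_def by blast
  define C where "C = C1 + C2"
  have C: "C > 0" using C1 C2 by (simp add: C_def)
  have *: "max_fun (\<lambda>y. complex_of_real (diff_gauss v M (y + h))) x \<le> ennreal (C * (1 + norm (x + h)) powr (- N))"
    "ennreal (norm (complex_of_real (diff_gauss v M (x + h)))) \<le> ennreal (C * (1 + norm (x + h)) powr (- N))" for x
  proof -
    show "max_fun (\<lambda>y. complex_of_real (diff_gauss v M (y + h))) x \<le> ennreal (C * (1 + norm (x + h)) powr (- N))"
      using C2(1) by (intro order_trans[OF C1(2)] ennreal_leI mult_right_mono) (auto simp: C_def)
    have "norm (complex_of_real (diff_gauss v M (x + h))) \<le> C2 * (1 + norm (x + h)) powr (- N)" using C2(2)[of "x + h"] by simp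
    also have "\<dots> \<le> C * (1 + norm (x + h)) powr (- N)" using C1(1) by (intro mult_right_mono) (auto simp: C_def)
    finally show "ennreal (norm (complex_of_real (diff_gauss v M (x + h)))) \<le> ennreal (C * (1 + norm (x + h)) powr (- N))"
      by (rule ennreal_leI)
  qed
  show ?thesis
    using q
  proof (cases rule: ereal_cases_pos)
    case infinite
    have "(1 + norm (x + h)) powr (- N) \<le> 1" for x
      using powr_mono[of "- N" 0 "1 + norm (x + h)"] by (simp add: N_def add_nonneg_eq_0_iff)
    then have "ennreal (norm (complex_of_real (diff_gauss v M (x + h)))) \<le> ennreal C" for x
      using C by (intro order_trans[OF *(2)] ennreal_leI) (simp add: mult_left_le)
    then have "hardy_norm q (\<lambda>x. complex_of_real (diff_gauss v M (x + h))) \<le> ennreal C"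
      unfolding infinite hardy_norm_finite_le by (intro esssup_I AE_I2) auto
    with C show ?thesis by blast
  next
    case (finite r)
    define w where "w x = C powr r * (1 + norm (x + h)) powr (- (N * r))" for x
    have w: "integrable lborel w"
      unfolding w_def using moment finite
      by (intro integrable_mult_right integrable_lborel_shift[of "\<lambda>x. (1 + norm x) powr (- (N * r))"] integrable_one_plus_norm_powr)
         (simp add: N_def)
    define V where "V = (\<integral>x. w x \<partial>lborel)"
    have lq: "lq_norm r g \<le> ennreal (V powr (1 / r))" if "\<And>x. g x \<le> ennreal (C * (1 + norm (x + h)) powr (- N))" for g
      by (rule lq_norm_le[where b="\<lambda>x. C * (1 + norm (x + h)) powr (- N)" and h=w])
         (use that finite C w in \<open>auto simp: w_def powr_mult powr_powr V_def\<close>)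
    have "hardy_norm q (\<lambda>x. complex_of_real (diff_gauss v M (x + h))) \<le> ennreal (V powr (1 / r))"
      using lq[OF *(1)] lq[OF *(2)] unfolding finite by (cases "r \<le> 1") (simp_all add: hardy_norm_finite_le)
    also have "\<dots> \<le> ennreal (V powr (1 / r) + 1)" by (intro ennreal_leI) simp
    finally show ?thesis by (intro exI[of _ "V powr (1 / r) + 1"]) (simp add: add_nonneg_pos)
  qed
qed

text \<open>For \<open>q > 1\<close> the Hardy norm is the Lebesgue norm, which does not see the
  unimodular factor. For finite \<open>q\<close> the power is at most the Gaussian itself, whose
  integral compensates the normalising factor.\<close>

lemma hardy_norm_modulated_gauss:
  fixes a :: "'a::euclidean_space"
  assumes q: "1 < q"
  shows "hardy_norm q (\<lambda>x. complex_of_real (2 powr (- (real m * (real DIM('a) * recip q))) * gauss ((1/2) ^ m *\<^sub>R x)) * cis (2 * pi * (a \<bullet> x))) \<le> ennreal 1"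
proof -
  have "0 < q" using q by (auto intro: less_trans[of _ 1])
  then show ?thesis
  proof (cases rule: ereal_cases_pos)
    case infinite
    then show ?thesis
      by (auto simp: hardy_norm_finite_le recip_def norm_mult intro!: esssup_I)
  next
    case (finite r)
    have r: "r > 1" using q finite by simp
    define c where "c = 2 powr (- (real m * (real DIM('a) * (1 / r))))"
    define h where "h x = c powr r * gauss ((1/2) ^ m *\<^sub>R x)" for x :: 'a
    have "lq_norm r (\<lambda>x::'a. ennreal (norm (complex_of_real (c * gauss ((1/2) ^ m *\<^sub>R x)) * cis (2 * pi * (a \<bullet> x))))) \<le> ennreal (1 powr (1 / r))"
    proof (rule lq_norm_le[where b="\<lambda>x. c * gauss ((1/2) ^ m *\<^sub>R x)" and h=h])
      fix x :: 'a
      have "gauss ((1/2) ^ m *\<^sub>R x) powr r \<le> gauss ((1/2) ^ m *\<^sub>R x)"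
        using powr_mono'[of 1 r "gauss ((1/2) ^ m *\<^sub>R x)"] r by simp
      then show "(c * gauss ((1/2) ^ m *\<^sub>R x)) powr r \<le> h x"
        by (simp add: h_def powr_mult mult_left_mono)
      show "integrable lborel h" unfolding h_def
        by (intro integrable_mult_right integral_dyadic_dilate integrable_gauss)
      show "(\<integral>x. h x \<partial>lborel) \<le> 1"
        using r dyadic_coeff_powr[of r m "real DIM('a)"]
        by (simp add: h_def integral_dyadic_dilate(2)[OF integrable_gauss] integral_gauss c_def)
    qed (use r in \<open>auto simp: c_def norm_mult abs_mult\<close>)
    then show ?thesis using r unfolding finite by (simp add: hardy_norm_finite_le recip_def c_def)
  qed
qed


section \<open>Gaussian Schwartz functions\<close>

text \<open>A class closed under differentiation, so that the iterated derivatives in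
  \<open>schwartz\<close> can be handled by induction. The real linear term \<open>w\<close>
  accommodates translations, the imaginary one \<open>a\<close> modulations, and the coordinate
  factors arise from differentiating.\<close>

inductive_set gauss_class :: "('a::euclidean_space \<Rightarrow> complex) set" where
  base: "l > 0 \<Longrightarrow> (\<lambda>x. exp (complex_of_real (- l * (x \<bullet> x) + w \<bullet> x) + \<i> * complex_of_real (a \<bullet> x))) \<in> gauss_class"
| cmult: "f \<in> gauss_class \<Longrightarrow> (\<lambda>x. c * f x) \<in> gauss_class"
| coord: "f \<in> gauss_class \<Longrightarrow> (\<lambda>x. complex_of_real (x \<bullet> b) * f x) \<in> gauss_class"
| add: "f \<in> gauss_class \<Longrightarrow> g \<in> gauss_class \<Longrightarrow> (\<lambda>x. f x + g x) \<in> gauss_class"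

lemma gauss_class_zero: "(\<lambda>_. 0) \<in> gauss_class"
  using gauss_class.cmult[OF gauss_class.base[of 1 0 0], of 0] by simp

lemma gauss_class_sum:
  "(\<And>i. i \<in> I \<Longrightarrow> f i \<in> gauss_class) \<Longrightarrow> (\<lambda>x. \<Sum>i\<in>I. f i x) \<in> gauss_class"
  by (induction I rule: infinite_finite_induct) (auto intro: gauss_class_zero gauss_class.add)

lemma gauss_class_deriv:
  assumes "f \<in> gauss_class"
  shows "\<exists>D. (\<forall>x. (f has_derivative D x) (at x)) \<and> (\<forall>v. (\<lambda>x. D x v) \<in> gauss_class)"
  using assms
proof induction
  case (base l w a)
  let ?f = "\<lambda>x. exp (complex_of_real (- l * (x \<bullet> x) + w \<bullet> x) + \<i> * complex_of_real (a \<bullet> x))"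
  define D where "D x v = (complex_of_real (- l * (2 * (x \<bullet> v)) + w \<bullet> v) + \<i> * complex_of_real (a \<bullet> v)) * ?f x" for x v
  have "(?f has_derivative D x) (at x)" for x
  proof -
    have "((\<lambda>x. - l * (x \<bullet> x) + w \<bullet> x) has_derivative (\<lambda>v. - l * (2 * (x \<bullet> v)) + w \<bullet> v)) (at x)"
      by (rule has_derivative_eq_rhs, (rule derivative_intros)+) (auto simp: fun_eq_iff inner_commute algebra_simps)
    note 1 = has_derivative_of_real[OF this, where 'a=complex]
    have "((\<lambda>x. a \<bullet> x) has_derivative (\<lambda>v. a \<bullet> v)) (at x)"
      by (intro has_derivative_inner_right has_derivative_ident)
    note 2 = has_derivative_mult_right[OF has_derivative_of_real[OF this], of \<i>]
    from has_derivative_compose[OF has_derivative_add[OF 1 2] has_field_derivative_imp_has_derivative[OF DERIV_exp]]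
    show ?thesis unfolding D_def by (simp only: mult.commute)
  qed
  moreover have "(\<lambda>x. D x v) \<in> gauss_class" for v
  proof -
    have "(\<lambda>x. complex_of_real (- 2 * l) * (complex_of_real (x \<bullet> v) * ?f x) + (complex_of_real (w \<bullet> v) + \<i> * complex_of_real (a \<bullet> v)) * ?f x) \<in> gauss_class"
      using base by (intro gauss_class.intros)
    also have "(\<lambda>x. complex_of_real (- 2 * l) * (complex_of_real (x \<bullet> v) * ?f x) + (complex_of_real (w \<bullet> v) + \<i> * complex_of_real (a \<bullet> v)) * ?f x) = (\<lambda>x. D x v)"
      unfolding D_def by (intro ext) (simp add: algebra_simps)
    finally show ?thesis .
  qed
  ultimately show ?case by blast
next
  case (cmult f c)
  then obtain D where "\<And>x. (f has_derivative D x) (at x)" "\<And>v. (\<lambda>x. D x v) \<in> gauss_class" by blast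
  then show ?case
    by (intro exI[of _ "\<lambda>x v. c * D x v"]) (auto intro!: derivative_eq_intros gauss_class.cmult)
next
  case (coord f b)
  then obtain D where D: "\<And>x. (f has_derivative D x) (at x)" "\<And>v. (\<lambda>x. D x v) \<in> gauss_class" by blast
  have "((\<lambda>x. complex_of_real (x \<bullet> b) * f x) has_derivative (\<lambda>v. complex_of_real (x \<bullet> b) * D x v + complex_of_real (v \<bullet> b) * f x)) (at x)" for x
    by (intro has_derivative_mult D(1) has_derivative_of_real has_derivative_inner_left has_derivative_ident)
  moreover have "(\<lambda>x. complex_of_real (x \<bullet> b) * D x v + complex_of_real (v \<bullet> b) * f x) \<in> gauss_class" for v
    by (intro gauss_class.intros D(2) coord)
  ultimately show ?case by (intro exI[of _ "\<lambda>x v. complex_of_real (x \<bullet> b) * D x v + complex_of_real (v \<bullet> b) * f x"]) auto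
next
  case (add f g)
  then obtain D E where "\<And>x. (f has_derivative D x) (at x)" "\<And>v. (\<lambda>x. D x v) \<in> gauss_class"
    "\<And>x. (g has_derivative E x) (at x)" "\<And>v. (\<lambda>x. E x v) \<in> gauss_class" by metis
  then show ?case
    by (intro exI[of _ "\<lambda>x v. D x v + E x v"]) (auto intro!: has_derivative_add gauss_class.add)
qed

lemma gauss_class_decay:
  assumes "f \<in> gauss_class"
  shows "bounded (range (\<lambda>x. (1 + norm x) ^ N * norm (f x)))"
proof -
  have "\<exists>C. \<forall>x. (1 + norm x) ^ N * norm (f x) \<le> C"
    using assms
  \<comment> \<open>\<open>N\<close> is generalised because a coordinate factor is paid for with one
    more power.\<close>
  proof (induction arbitrary: N)
    case (base l w a)
    \<comment> \<open>The summand 1 absorbs the factor \<open>exp r\<close> that bounds the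
      polynomial weight; \<open>b ^ 2 / (4 * l)\<close> is the maximum of
      \<open>b * r - l * r ^ 2\<close>.\<close>
    define b where "b = 1 + norm w"
    have "(1 + norm x) ^ N * norm (exp (complex_of_real (- l * (x \<bullet> x) + w \<bullet> x) + \<i> * complex_of_real (a \<bullet> x)))
        \<le> (1 + real N ^ N) * exp (b\<^sup>2 / (4 * l))" for x
    proof -
      define r where "r = norm x"
      have pow: "(1 + r) ^ N \<le> (1 + real N ^ N) * exp r"
      proof (cases "N = 0")
        case False
        have "(1 + r) ^ N \<le> (real N * (1 + r / real N)) ^ N"
          using False by (intro power_mono) (auto simp: distrib_left r_def)
        also have "\<dots> = real N ^ N * (1 + r / real N) ^ N" by (simp add: power_mult_distrib)
        also have "\<dots> \<le> (1 + real N ^ N) * exp r"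
        proof (intro mult_mono exp_ge_one_plus_x_over_n_power_n)
          show "- real N \<le> r" using norm_ge_zero[of x] unfolding r_def by linarith
        qed (use False in \<open>auto simp: r_def\<close>)
        finally show ?thesis .
      next
        case True
        have "1 \<le> exp r" by (simp add: r_def)
        then have "1 \<le> 2 * exp r" by linarith
        then show ?thesis using True by simp
      qed
      have "norm (exp (complex_of_real (- l * (x \<bullet> x) + w \<bullet> x) + \<i> * complex_of_real (a \<bullet> x))) = exp (- l * (x \<bullet> x) + w \<bullet> x)"
        by (simp add: norm_exp_eq_Re)
      also have "\<dots> \<le> exp (- l * r\<^sup>2 + norm w * r)"
        using norm_cauchy_schwarz[of w x] by (simp add: r_def power2_norm_eq_inner)
      finally have "(1 + r) ^ N * norm (exp (complex_of_real (- l * (x \<bullet> x) + w \<bullet> x) + \<i> * complex_of_real (a \<bullet> x)))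
         \<le> ((1 + real N ^ N) * exp r) * exp (- l * r\<^sup>2 + norm w * r)"
        by (intro mult_mono pow) auto
      also have "\<dots> = (1 + real N ^ N) * exp (b * r - l * r\<^sup>2)"
        by (simp add: mult.assoc exp_add[symmetric] b_def algebra_simps)
      also have "\<dots> \<le> (1 + real N ^ N) * exp (b\<^sup>2 / (4 * l))"
      proof -
        have "0 \<le> (b - 2 * l * r)\<^sup>2" by simp
        then have "4 * l * (b * r - l * r\<^sup>2) \<le> b\<^sup>2" by (simp add: power2_eq_square algebra_simps)
        then have "b * r - l * r\<^sup>2 \<le> b\<^sup>2 / (4 * l)" using base by (simp add: pos_le_divide_eq mult.commute)
        then show ?thesis by (intro mult_left_mono) auto
      qed
      finally show ?thesis by (simp add: r_def)
    qed
    then show ?case by blast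
  next
    case (cmult f c)
    then obtain C where C: "\<And>x. (1 + norm x) ^ N * norm (f x) \<le> C" by blast
    have "(1 + norm x) ^ N * norm (c * f x) \<le> norm c * C" for x
      using mult_left_mono[OF C[of x], of "norm c"] by (simp add: norm_mult ac_simps)
    then show ?case by blast
  next
    case (coord f b)
    then obtain C where C: "\<And>x. (1 + norm x) ^ Suc N * norm (f x) \<le> C" by blast
    have "(1 + norm x) ^ N * norm (complex_of_real (x \<bullet> b) * f x) \<le> norm b * C" for x
    proof -
      have "\<bar>x \<bullet> b\<bar> \<le> (1 + norm x) * norm b"
        using Cauchy_Schwarz_ineq2[of x b] by (simp add: distrib_right add_increasing)
      then have "\<bar>x \<bullet> b\<bar> * ((1 + norm x) ^ N * norm (f x)) \<le> ((1 + norm x) * norm b) * ((1 + norm x) ^ N * norm (f x))"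
        by (rule mult_right_mono) simp
      also have "\<dots> = norm b * ((1 + norm x) ^ Suc N * norm (f x))" by simp
      also have "\<dots> \<le> norm b * C" by (intro mult_left_mono C) simp
      finally show ?thesis by (simp add: norm_mult ac_simps)
    qed
    then show ?case by blast
  next
    case (add f g)
    then obtain C C' where C: "\<And>x. (1 + norm x) ^ N * norm (f x) \<le> C" "\<And>x. (1 + norm x) ^ N * norm (g x) \<le> C'" by metis
    have "(1 + norm x) ^ N * norm (f x + g x) \<le> C + C'" for x
    proof -
      have "(1 + norm x) ^ N * norm (f x + g x) \<le> (1 + norm x) ^ N * (norm (f x) + norm (g x))"
        by (intro mult_left_mono norm_triangle_ineq) simp
      also have "\<dots> \<le> C + C'" using C[of x] by (simp add: distrib_left)
      finally show ?thesis .
    qed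
    then show ?case by blast
  qed
  then obtain C where "\<And>x. (1 + norm x) ^ N * norm (f x) \<le> C" by blast
  then show ?thesis by (intro boundedI[of _ C]) auto
qed

lemma iter_deriv_gauss_class: "f \<in> gauss_class \<Longrightarrow> iter_deriv vs f \<in> gauss_class"
proof (induction vs)
  case (Cons v vs)
  then obtain D where D: "\<And>x. (iter_deriv vs f has_derivative D x) (at x)" "\<And>v. (\<lambda>x. D x v) \<in> gauss_class"
    using gauss_class_deriv by blast
  have "frechet_derivative (iter_deriv vs f) (at x) = D x" for x
    using frechet_derivative_at[OF D(1)] by simp
  then show ?case using D(2) by simp
qed simp

lemma gauss_class_schwartz:
  assumes "f \<in> gauss_class" shows "schwartz f"
  unfolding schwartz_def
proof (intro conjI allI impI)
  fix vs x
  show "iter_deriv vs f differentiable at x"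
    using gauss_class_deriv[OF iter_deriv_gauss_class[OF assms]] unfolding differentiable_def by blast
qed (use gauss_class_decay[OF iter_deriv_gauss_class[OF assms]] in blast)

text \<open>Expanding the square puts the translation into the linear term \<open>w\<close> and the
  constant factor \<open>gauss h\<close>.\<close>

lemma gauss_affine_in_class:
  assumes r: "r \<noteq> 0"
  shows "(\<lambda>x. complex_of_real (gauss (r *\<^sub>R x + h)) * cis (a \<bullet> x)) \<in> gauss_class"
proof -
  have "(\<lambda>x. complex_of_real (gauss h) * exp (complex_of_real (- (pi * r\<^sup>2) * (x \<bullet> x) + ((- 2 * pi * r) *\<^sub>R h) \<bullet> x) + \<i> * complex_of_real (a \<bullet> x))) \<in> gauss_class"
    by (intro gauss_class.intros) (use r in simp)
  also have "(\<lambda>x. complex_of_real (gauss h) * exp (complex_of_real (- (pi * r\<^sup>2) * (x \<bullet> x) + ((- 2 * pi * r) *\<^sub>R h) \<bullet> x) + \<i> * complex_of_real (a \<bullet> x)))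
     = (\<lambda>x. complex_of_real (gauss (r *\<^sub>R x + h)) * cis (a \<bullet> x))"
  proof
    fix x
    have "(norm (r *\<^sub>R x + h))\<^sup>2 = r\<^sup>2 * (x \<bullet> x) + 2 * r * (h \<bullet> x) + (norm h)\<^sup>2"
      unfolding power2_norm_eq_inner
      by (simp add: inner_add_left inner_add_right inner_commute power2_eq_square algebra_simps)
    then have "gauss (r *\<^sub>R x + h) = gauss h * exp (- (pi * r\<^sup>2) * (x \<bullet> x) + ((- 2 * pi * r) *\<^sub>R h) \<bullet> x)"
      by (simp add: gauss_def exp_add[symmetric] algebra_simps)
    then show "complex_of_real (gauss h) * exp (complex_of_real (- (pi * r\<^sup>2) * (x \<bullet> x) + ((- 2 * pi * r) *\<^sub>R h) \<bullet> x) + \<i> * complex_of_real (a \<bullet> x))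
       = complex_of_real (gauss (r *\<^sub>R x + h)) * cis (a \<bullet> x)"
      by (simp only: exp_add[of "complex_of_real _"] cis_conv_exp exp_of_real of_real_mult mult.assoc)
  qed
  finally show ?thesis .
qed

lemma diff_gauss_affine_in_class:
  assumes r: "r \<noteq> 0"
  shows "(\<lambda>x. complex_of_real (diff_gauss v M (r *\<^sub>R x + h))) \<in> gauss_class"
proof (induction M arbitrary: h)
  case 0
  show ?case using gauss_affine_in_class[OF r, of h 0] by (simp add: cis_zero)
next
  case (Suc M)
  have "(\<lambda>x. complex_of_real (diff_gauss v M (r *\<^sub>R x + (h + v))) + (- 1) * complex_of_real (diff_gauss v M (r *\<^sub>R x + (h - v)))) \<in> gauss_class"
    by (intro gauss_class.add gauss_class.cmult Suc)
  also have "(\<lambda>x. complex_of_real (diff_gauss v M (r *\<^sub>R x + (h + v))) + (- 1) * complex_of_real (diff_gauss v M (r *\<^sub>R x + (h - v))))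
     = (\<lambda>x. complex_of_real (diff_gauss v (Suc M) (r *\<^sub>R x + h)))"
    by (intro ext) (simp add: diff_gauss_Suc add.assoc add_diff_eq)
  finally show ?case .
qed

lemma schwartz_diff_gauss_shift: "schwartz (\<lambda>x. complex_of_real (diff_gauss v M (x + h)))"
  using diff_gauss_affine_in_class[of 1 v M h] by (intro gauss_class_schwartz) simp

lemma diff_gauss_bounded: "\<exists>B. \<forall>x. \<bar>diff_gauss v M x\<bar> \<le> B"
proof -
  obtain B where "\<And>x. norm (complex_of_real (diff_gauss v M (x + 0))) \<le> B"
    using schwartz_bounded[OF schwartz_diff_gauss_shift[of v M 0]] by blast
  then have "\<bar>diff_gauss v M x\<bar> \<le> B" for x by simp
  then show ?thesis by blast
qed

lemma schwartz_dyadic_sum: "schwartz (\<lambda>x. complex_of_real (dyadic_sum (diff_gauss v M) \<beta> S \<eta> x))"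
proof (rule gauss_class_schwartz)
  have "(\<lambda>x. \<Sum>m\<in>S. complex_of_real (\<eta> m * 2 powr (- (real m * \<beta>))) * complex_of_real (diff_gauss v M ((1/2) ^ m *\<^sub>R x + 0))) \<in> gauss_class"
    by (intro gauss_class_sum gauss_class.cmult diff_gauss_affine_in_class) simp
  then show "(\<lambda>x. complex_of_real (dyadic_sum (diff_gauss v M) \<beta> S \<eta> x)) \<in> gauss_class"
    by (simp add: dyadic_sum_def)
qed

lemma schwartz_modulated_gauss:
  "schwartz (\<lambda>x. complex_of_real (c * gauss ((1/2) ^ m *\<^sub>R x)) * cis (2 * pi * (a \<bullet> x)))"
proof (rule gauss_class_schwartz)
  have "(\<lambda>x. complex_of_real c * (complex_of_real (gauss ((1/2) ^ m *\<^sub>R x + 0)) * cis (((2 * pi) *\<^sub>R a) \<bullet> x))) \<in> gauss_class"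
    by (intro gauss_class.cmult gauss_affine_in_class) simp
  then show "(\<lambda>x. complex_of_real (c * gauss ((1/2) ^ m *\<^sub>R x)) * cis (2 * pi * (a \<bullet> x))) \<in> gauss_class"
    by (simp add: mult.assoc)
qed


section \<open>Dyadic shells of lattice points and random signs\<close>

text \<open>A ball about \<open>2 ^ m *\<^sub>R w\<close> rather than a full annulus:
  \<open>y / 2 ^ m\<close> then stays close to \<open>w\<close>, which in the block argument keeps
  the wide inputs near a point where their profile does not vanish.\<close>

definition lattice_shell :: "real^'d::finite \<Rightarrow> real \<Rightarrow> nat \<Rightarrow> (real^'d) set" where
  "lattice_shell w \<rho> m = {y \<in> int_lattice. norm (y - 2 ^ m *\<^sub>R w) \<le> 2 ^ m * \<rho>}"

lemma finite_lattice_shell: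
  fixes w :: "real^'d::finite"
  shows "finite (lattice_shell w \<rho> m)"
proof -
  define R where "R = norm (2 ^ m *\<^sub>R w) + 2 ^ m * \<rho>"
  have "lattice_shell w \<rho> m \<subseteq> vec_lambda ` (\<Pi>\<^sub>E i\<in>UNIV. real_of_int ` {- \<lceil>R\<rceil>..\<lceil>R\<rceil>})"
  proof
    fix y :: "real^'d" assume y: "y \<in> lattice_shell w \<rho> m"
    have "norm y \<le> R" using y norm_triangle_ineq2[of y "2 ^ m *\<^sub>R w"] by (simp add: lattice_shell_def R_def)
    have "y $ i \<in> real_of_int ` {- \<lceil>R\<rceil>..\<lceil>R\<rceil>}" for i
    proof -
      have "y $ i \<in> \<int>" using y by (simp add: lattice_shell_def int_lattice_def)
      then obtain k where k: "y $ i = real_of_int k" by (rule Ints_cases)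
      have "\<bar>y $ i\<bar> \<le> R" using component_le_norm_cart[of y i] \<open>norm y \<le> R\<close> by linarith
      then show ?thesis using k by (auto simp: ceiling_le_iff intro!: image_eqI[of _ _ k]) linarith+
    qed
    then have "(\<lambda>i. y $ i) \<in> (\<Pi>\<^sub>E i\<in>UNIV. real_of_int ` {- \<lceil>R\<rceil>..\<lceil>R\<rceil>})" by (auto simp: PiE_UNIV_domain)
    moreover have "y = vec_lambda (\<lambda>i. y $ i)" by simp
    ultimately show "y \<in> vec_lambda ` (\<Pi>\<^sub>E i\<in>UNIV. real_of_int ` {- \<lceil>R\<rceil>..\<lceil>R\<rceil>})" by (metis image_eqI)
  qed
  then show ?thesis by (rule finite_subset) (intro finite_imageI finite_PiE, auto)
qed

text \<open>A volume count: rounding down the coordinates shows that unit cubes attached to the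
  points of the shell cover a cube inside the ball.\<close>

lemma card_lattice_shell:
  fixes w :: "real^'d::finite"
  assumes \<rho>: "\<rho> > 0" and m: "2 * real CARD('d) \<le> 2 ^ m * \<rho>"
  shows "(2 ^ m * \<rho> / real CARD('d)) ^ CARD('d) \<le> real (card (lattice_shell w \<rho> m))"
proof -
  define d where "d = real CARD('d)"
  have d: "d > 0" by (simp add: d_def)
  \<comment> \<open>The cube of half-side \<open>t\<close> lies in the ball of half the radius; the
    other half of the radius absorbs the rounding error, at most \<open>d\<close>.\<close>
  define t where "t = 2 ^ m * \<rho> / (2 * d)"
  have t: "t > 0" using \<rho> d by (simp add: t_def)
  define c where "c = 2 ^ m *\<^sub>R w"
  define Q where "Q = cbox (c - t *\<^sub>R One) (c + t *\<^sub>R One)"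
  have cover: "Q \<subseteq> (\<Union>y\<in>lattice_shell w \<rho> m. cbox y (y + One))"
  proof
    fix z assume z: "z \<in> Q"
    define y where "y = (\<chi> i. real_of_int \<lfloor>z $ i\<rfloor>)"
    have "norm (z - c) \<le> (\<Sum>i\<in>UNIV. \<bar>(z - c) $ i\<bar>)" by (rule norm_le_l1_cart)
    also have "\<dots> \<le> (\<Sum>i\<in>(UNIV::'d set). t)"
    proof (rule sum_mono)
      fix i
      have "c $ i - t * One $ i \<le> z $ i \<and> z $ i \<le> c $ i + t * One $ i"
        using z unfolding Q_def mem_box_cart by (simp only: vector_add_component vector_minus_component vector_scaleR_component real_scaleR_def)
      then show "\<bar>(z - c) $ i\<bar> \<le> t" by (simp only: One_nth) (simp add: abs_le_iff)
    qed
    also have "\<dots> = 2 ^ m * \<rho> / 2" using d by (simp add: t_def d_def)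
    finally have 1: "norm (z - c) \<le> 2 ^ m * \<rho> / 2" .
    have "norm (y - z) \<le> (\<Sum>i\<in>UNIV. \<bar>(y - z) $ i\<bar>)" by (rule norm_le_l1_cart)
    also have "\<dots> \<le> (\<Sum>i\<in>(UNIV::'d set). 1)"
      by (intro sum_mono) (simp add: y_def, linarith)
    finally have 2: "norm (y - z) \<le> d" by (simp add: d_def)
    have "norm (y - c) \<le> norm (y - z) + norm (z - c)" using norm_triangle_ineq[of "y - z" "z - c"] by simp
    also have "\<dots> \<le> 2 ^ m * \<rho>" using 1 2 m by (simp add: d_def)
    finally have "y \<in> lattice_shell w \<rho> m" by (auto simp: lattice_shell_def c_def int_lattice_def y_def)
    moreover have "z \<in> cbox y (y + One)"
    proof -
      have "y $ i \<le> z $ i \<and> z $ i \<le> y $ i + One $ i" for i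
      proof -
        have "real_of_int \<lfloor>z $ i\<rfloor> \<le> z $ i" "z $ i \<le> real_of_int \<lfloor>z $ i\<rfloor> + 1" by linarith+
        then show ?thesis by (simp only: One_nth y_def vec_lambda_beta)
      qed
      then show ?thesis unfolding mem_box_cart by (simp only: vector_add_component simp_thms)
    qed
    ultimately show "z \<in> (\<Union>y\<in>lattice_shell w \<rho> m. cbox y (y + One))" by blast
  qed
  have cube: "emeasure lborel (cbox y (y + One)) = 1" for y :: "real^'d"
    by (subst emeasure_lborel_cbox) (auto simp: inner_add_left)
  have side: "((c + t *\<^sub>R One) - (c - t *\<^sub>R One)) \<bullet> b = 2 * t" if "b \<in> Basis" for b
    by (simp only: inner_diff_left inner_add_left inner_scaleR_left inner_sum_left_Basis[of b "\<lambda>_. 1", OF that, simplified])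
  have "emeasure lborel Q = (\<Prod>b\<in>Basis. ((c + t *\<^sub>R One) - (c - t *\<^sub>R One)) \<bullet> b)"
    unfolding Q_def by (rule emeasure_lborel_cbox) (use t in \<open>simp add: inner_diff_left inner_add_left\<close>)
  also have "\<dots> = ennreal (\<Prod>b\<in>(Basis :: (real^'d) set). 2 * t)"
    by (intro arg_cong[where f=ennreal] prod.cong refl side)
  finally have "ennreal ((2 * t) ^ CARD('d)) = emeasure lborel Q" by simp
  also have "\<dots> \<le> emeasure lborel (\<Union>y\<in>lattice_shell w \<rho> m. cbox y (y + One))"
    using cover finite_lattice_shell by (intro emeasure_mono) (auto intro!: sets.finite_UN)
  also have "\<dots> \<le> (\<Sum>y\<in>lattice_shell w \<rho> m. emeasure lborel (cbox y (y + One)))"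
    using finite_lattice_shell by (intro emeasure_subadditive_finite) auto
  also have "\<dots> = ennreal (real (card (lattice_shell w \<rho> m)))" by (simp add: cube ennreal_of_nat_eq_real_of_nat)
  finally have "(2 * t) ^ CARD('d) \<le> real (card (lattice_shell w \<rho> m))" by simp
  then show ?thesis using d by (simp add: t_def d_def)
qed

text \<open>A shell has at least of order \<open>2 ^ (m * d)\<close> points at distance at most of
  order \<open>2 ^ m\<close>, so its contribution is bounded below independently of
  \<open>m\<close>. The lower limit \<open>m1\<close> makes the radius exceed the lattice spacing
  sufficiently for the count.\<close>

lemma sum_lattice_shells:
  fixes w :: "real^'d::finite"
  assumes w: "w \<noteq> 0" and \<rho>: "0 < \<rho>" "\<rho> \<le> norm w / 4"
  shows "\<exists>c>0. \<exists>m1. \<forall>m0\<ge>m1. \<forall>K.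
     c * real K \<le> (\<Sum>y\<in>(\<Union>m\<in>{m0..<m0+K}. lattice_shell w \<rho> m). (1 + norm y) powr (- real CARD('d)))"
proof -
  define d where "d = real CARD('d)"
  have d: "d > 0" by (simp add: d_def)
  define H where "H = 1 + norm w + \<rho>"
  have H: "H > 0" using \<rho> by (simp add: H_def add_pos_nonneg add_pos_pos)
  define c where "c = (\<rho> / (d * H)) ^ CARD('d)"
  have c: "c > 0" using \<rho> d H by (simp add: c_def)
  obtain m1 where m1: "2 * d / \<rho> < 2 ^ m1" using real_arch_pow[of 2 "2 * d / \<rho>"] by auto
  have shell: "c \<le> (\<Sum>y\<in>lattice_shell w \<rho> m. (1 + norm y) powr (- d))" if m: "m \<ge> m1" for m
  proof -
    have "2 * d / \<rho> \<le> 2 ^ m" by (rule less_imp_le[OF less_le_trans[OF m1 power_increasing]]) (use m in auto)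
    then have "2 * d \<le> 2 ^ m * \<rho>" using \<rho> by (simp add: pos_divide_le_eq)
    then have card: "(2 ^ m * \<rho> / d) ^ CARD('d) \<le> real (card (lattice_shell w \<rho> m))"
      unfolding d_def by (intro card_lattice_shell \<rho>)
    have low: "(2 ^ m * H) powr (- d) \<le> (1 + norm y) powr (- d)" if y: "y \<in> lattice_shell w \<rho> m" for y
    proof (rule powr_mono2')
      have "norm y \<le> 2 ^ m * norm w + 2 ^ m * \<rho>"
        using y norm_triangle_ineq2[of y "2 ^ m *\<^sub>R w"] by (simp add: lattice_shell_def)
      moreover have "(1::real) \<le> 2 ^ m" by simp
      ultimately show "1 + norm y \<le> 2 ^ m * H" unfolding H_def distrib_left by linarith
    qed (use d in \<open>auto intro: add_pos_nonneg\<close>)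
    have "c = (2 ^ m * \<rho> / d) ^ CARD('d) * (2 ^ m * H) powr (- d)"
      using H d \<rho> by (simp add: d_def powr_minus powr_realpow c_def power_mult_distrib power_divide field_simps)
    also have "\<dots> \<le> real (card (lattice_shell w \<rho> m)) * (2 ^ m * H) powr (- d)"
      using card by (intro mult_right_mono) auto
    also have "\<dots> = (\<Sum>y\<in>lattice_shell w \<rho> m. (2 ^ m * H) powr (- d))" by simp
    also have "\<dots> \<le> (\<Sum>y\<in>lattice_shell w \<rho> m. (1 + norm y) powr (- d))" by (intro sum_mono low)
    finally show ?thesis .
  qed
  \<comment> \<open>Norms on shell \<open>m\<close> lie within
    \<open>2 ^ m * (norm w - \<rho>)\<close> and \<open>2 ^ m * (norm w + \<rho>)\<close>. These
    ranges do not meet since \<open>\<rho> \<le> norm w / 4\<close> gives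
    \<open>2 * (norm w - \<rho>) > norm w + \<rho>\<close>.\<close>
  have disj: "lattice_shell w \<rho> m \<inter> lattice_shell w \<rho> m' = {}" if "m < m'" for m m'
  proof (rule ccontr)
    assume "lattice_shell w \<rho> m \<inter> lattice_shell w \<rho> m' \<noteq> {}"
    then obtain y where y: "y \<in> lattice_shell w \<rho> m" "y \<in> lattice_shell w \<rho> m'" by blast
    have "norm y \<le> norm (2 ^ m *\<^sub>R w) + 2 ^ m * \<rho>" "norm (2 ^ m' *\<^sub>R w) - 2 ^ m' * \<rho> \<le> norm y"
      using y norm_triangle_ineq2[of y "2 ^ m *\<^sub>R w"] norm_triangle_ineq2[of "2 ^ m' *\<^sub>R w" y]
      by (auto simp: lattice_shell_def norm_minus_commute)
    then have "2 ^ m' * (norm w - \<rho>) \<le> 2 ^ m * (norm w + \<rho>)" by (simp add: algebra_simps)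
    moreover have "2 ^ Suc m * (norm w - \<rho>) \<le> 2 ^ m' * (norm w - \<rho>)"
      using that \<rho> by (intro mult_right_mono power_increasing) auto
    ultimately have "2 ^ Suc m * (norm w - \<rho>) \<le> 2 ^ m * (norm w + \<rho>)" by linarith
    then have "2 ^ m * (2 * (norm w - \<rho>)) \<le> 2 ^ m * (norm w + \<rho>)" by (simp only: power_Suc ac_simps)
    then have "2 * (norm w - \<rho>) \<le> norm w + \<rho>" by simp
    with \<rho> w show False by simp
  qed
  have "c * real K \<le> (\<Sum>y\<in>(\<Union>m\<in>{m0..<m0+K}. lattice_shell w \<rho> m). (1 + norm y) powr (- d))" if "m0 \<ge> m1" for m0 K
  proof -
    have "(\<Sum>y\<in>(\<Union>m\<in>{m0..<m0+K}. lattice_shell w \<rho> m). (1 + norm y) powr (- d))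
      = (\<Sum>m\<in>{m0..<m0+K}. \<Sum>y\<in>lattice_shell w \<rho> m. (1 + norm y) powr (- d))"
      using finite_lattice_shell disj by (intro sum.UNION_disjoint) (auto, metis disjoint_iff linorder_neqE_nat)
    also have "\<dots> \<ge> (\<Sum>m\<in>{m0..<m0+K}. c)"
      using shell that by (intro sum_mono) auto
    finally show ?thesis by (simp add: mult.commute)
  qed
  with c show ?thesis unfolding d_def by blast
qed

section \<open>Sign patterns and flips\<close>

text \<open>The value 1 prescribed outside \<open>I\<close> makes the set finite, so that averages
  are finite sums.\<close>

definition sign_functions :: "'i set \<Rightarrow> ('i \<Rightarrow> real) set" where
  "sign_functions I = {\<epsilon>. \<forall>i. (i \<in> I \<longrightarrow> \<epsilon> i \<in> {1, -1}) \<and> (i \<notin> I \<longrightarrow> \<epsilon> i = 1)}"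

lemma finite_sign_functions: "finite I \<Longrightarrow> finite (sign_functions I)"
  unfolding sign_functions_def by (rule finite_set_of_finite_funs) auto

lemma sign_functions_abs: "\<epsilon> \<in> sign_functions I \<Longrightarrow> \<bar>\<epsilon> i\<bar> = 1"
  unfolding sign_functions_def by (cases "i \<in> I") (auto dest: spec[of _ i])

lemma sign_functions_one: "(\<lambda>_. 1) \<in> sign_functions I"
  by (simp add: sign_functions_def)

text \<open>The sign at \<open>i0\<close> is kept and the others are multiplied by \<open>s\<close>.
  Summing over both values of \<open>s\<close> therefore leaves only the term at \<open>i0\<close>,
  while each flip is an involution of the sign patterns.\<close>

definition flip :: "'i set \<Rightarrow> 'i \<Rightarrow> real \<Rightarrow> ('i \<Rightarrow> real) \<Rightarrow> 'i \<Rightarrow> real" where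
  "flip I i0 s \<epsilon> i = (if i \<in> I \<and> i \<noteq> i0 then s * \<epsilon> i else \<epsilon> i)"

lemma flip_sign_functions: "s \<in> {1, -1} \<Longrightarrow> \<epsilon> \<in> sign_functions I \<Longrightarrow> flip I i0 s \<epsilon> \<in> sign_functions I"
  unfolding sign_functions_def flip_def by auto

lemma flip_flip: "s \<in> {1, -1} \<Longrightarrow> flip I i0 s (flip I i0 s \<epsilon>) = \<epsilon>"
  unfolding flip_def by auto

lemma sum_flip:
  assumes "finite I" "i0 \<in> I"
  shows "(\<Sum>i\<in>I. of_real (flip I i0 s \<epsilon> i) * A i) = of_real (\<epsilon> i0) * A i0 + of_real s * (\<Sum>i\<in>I - {i0}. of_real (\<epsilon> i) * A i :: complex)"
  using assms by (subst sum.remove[of I i0]) (auto simp: flip_def sum_distrib_left mult.assoc intro!: sum.cong)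

text \<open>The average is dominated by the maximum, so this holds for every \<open>p > 0\<close>, convexity playing no role.\<close>

lemma norm_average_powr_le:
  fixes V :: "'i \<Rightarrow> complex"
  assumes "finite F" "F \<noteq> {}" "p > 0" "(\<Sum>s\<in>F. V s) = of_nat (card F) * t"
  shows "norm t powr p \<le> (\<Sum>s\<in>F. norm (V s) powr p)"
proof -
  have "\<exists>s\<in>F. norm t \<le> norm (V s)"
  proof (rule ccontr)
    assume "\<not> ?thesis"
    then have "\<And>s. s \<in> F \<Longrightarrow> norm (V s) < norm t" by auto
    then have "(\<Sum>s\<in>F. norm (V s)) < (\<Sum>s\<in>F. norm t)" using assms by (intro sum_strict_mono) auto
    moreover have "real (card F) * norm t \<le> (\<Sum>s\<in>F. norm (V s))"
      using norm_sum[of V F] assms(4) by (simp add: norm_mult)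
    ultimately show False by simp
  qed
  then obtain s where s: "s \<in> F" "norm t \<le> norm (V s)" by blast
  have "norm t powr p \<le> norm (V s) powr p" using s assms by (intro powr_mono2) auto
  also have "\<dots> \<le> (\<Sum>s\<in>F. norm (V s) powr p)" using s assms by (intro member_le_sum) auto
  finally show ?thesis .
qed


section \<open>Limits of dilated convolutions\<close>

text \<open>The parameter \<open>\<tau> $ j\<close> is the ratio of the unit scale of
  \<open>\<phi>\<close> to the scale of the \<open>j\<close>-th input: 1 for an input at unit scale,
  \<open>(1/2) ^ m\<close> for a wide one. At \<open>\<tau> $ j = 0\<close> the input is frozen at
  the value \<open>g j (X $ j)\<close>, which is the limit of infinite width.\<close>

definition dilated_conv :: "(real^'d^'n \<Rightarrow> complex) \<Rightarrow> ('n \<Rightarrow> real^'d \<Rightarrow> real) \<Rightarrow> real^'d^'n \<Rightarrow> real^'n \<Rightarrow> complex" where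
  "dilated_conv \<phi> g X \<tau> = (\<integral>z. \<phi> z * complex_of_real (\<Prod>j\<in>UNIV. g j (X $ j - \<tau> $ j *\<^sub>R z $ j)) \<partial>lborel)"

lemma continuous_dilated_conv:
  fixes \<phi> :: "real^'d::finite^'n::finite \<Rightarrow> complex"
  assumes \<phi>: "integrable lborel \<phi>"
    and g: "\<And>j. continuous_on UNIV (g j)" "\<And>j x. \<bar>g j x\<bar> \<le> B j"
  shows "isCont (\<lambda>(X, \<tau>). dilated_conv \<phi> g X \<tau>) (X0, \<tau>0)"
  unfolding continuous_at_sequentially comp_def
proof (intro allI impI)
  note [measurable] = borel_measurable_integrable[OF \<phi>]
  fix s :: "nat \<Rightarrow> (real^'d^'n) \<times> (real^'n)" assume s: "s \<longlonglongrightarrow> (X0, \<tau>0)"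
  have gm[measurable]: "g j \<in> borel_measurable borel" for j by (intro borel_measurable_continuous_onI g)
  have X: "(\<lambda>n. fst (s n)) \<longlonglongrightarrow> X0" and T: "(\<lambda>n. snd (s n)) \<longlonglongrightarrow> \<tau>0"
    using tendsto_fst[OF s] tendsto_snd[OF s] by simp_all
  have "(\<lambda>n. dilated_conv \<phi> g (fst (s n)) (snd (s n))) \<longlonglongrightarrow> dilated_conv \<phi> g X0 \<tau>0"
    unfolding dilated_conv_def
  proof (rule integral_dominated_convergence[where w="\<lambda>z. norm (\<phi> z) * (\<Prod>j\<in>UNIV. B j)"])
    show "integrable lborel (\<lambda>z. norm (\<phi> z) * (\<Prod>j\<in>UNIV. B j))" using \<phi> by simp
    have "(\<lambda>n. g j (fst (s n) $ j - snd (s n) $ j *\<^sub>R z $ j)) \<longlonglongrightarrow> g j (X0 $ j - \<tau>0 $ j *\<^sub>R z $ j)" for z :: "real^'d^'n" and j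
      using g(1)[of j] by (intro isCont_tendsto_compose[of _ "g j"] tendsto_intros X T)
        (simp add: continuous_on_eq_continuous_at)
    then show "AE z in lborel. (\<lambda>n. \<phi> z * complex_of_real (\<Prod>j\<in>UNIV. g j (fst (s n) $ j - snd (s n) $ j *\<^sub>R z $ j)))
       \<longlonglongrightarrow> \<phi> z * complex_of_real (\<Prod>j\<in>UNIV. g j (X0 $ j - \<tau>0 $ j *\<^sub>R z $ j))"
      by (intro AE_I2 tendsto_intros)
    show "AE z in lborel. norm (\<phi> z * complex_of_real (\<Prod>j\<in>UNIV. g j (fst (s n) $ j - snd (s n) $ j *\<^sub>R z $ j))) \<le> norm (\<phi> z) * (\<Prod>j\<in>UNIV. B j)" for n
      using g(2) by (intro AE_I2) (auto simp: norm_mult abs_prod simp del: of_real_prod intro!: mult_left_mono prod_mono)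
  qed measurable
  then show "(\<lambda>n. case s n of (X, \<tau>) \<Rightarrow> dilated_conv \<phi> g X \<tau>) \<longlonglongrightarrow> (case (X0, \<tau>0) of (X, \<tau>) \<Rightarrow> dilated_conv \<phi> g X \<tau>)"
    by (simp only: split_beta fst_conv snd_conv)
qed

lemma dilated_conv_near:
  fixes \<phi> :: "real^'d::finite^'n::finite \<Rightarrow> complex"
  assumes \<phi>: "integrable lborel \<phi>"
    and g: "\<And>j. continuous_on UNIV (g j)" "\<And>j x. \<bar>g j x\<bar> \<le> B j"
    and e: "e > 0"
  shows "\<exists>r>0. \<forall>X \<tau>. (\<forall>j. norm (X $ j - X0 $ j) \<le> r) \<longrightarrow> (\<forall>j. \<bar>\<tau> $ j - \<tau>0 $ j\<bar> \<le> r) \<longrightarrow>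
     norm (dilated_conv \<phi> g X \<tau> - dilated_conv \<phi> g X0 \<tau>0) \<le> e"
proof -
  define f where "f = (\<lambda>(X, \<tau>). dilated_conv \<phi> g X \<tau>)"
  have "isCont f (X0, \<tau>0)" unfolding f_def by (rule continuous_dilated_conv[OF \<phi> g])
  then obtain \<delta> where \<delta>: "\<delta> > 0" "\<And>P. dist P (X0, \<tau>0) < \<delta> \<Longrightarrow> dist (f P) (f (X0, \<tau>0)) < e"
    unfolding continuous_at_eps_delta using e by blast
  define n where "n = real CARD('n)"
  have n: "n > 0" by (simp add: n_def)
  \<comment> \<open>Componentwise distances \<open>r\<close> add up to at most
    \<open>\<delta> / 4\<close> for each of \<open>X\<close> and \<open>\<tau>\<close>.\<close>
  define r where "r = \<delta> / (4 * n)"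
  have r: "r > 0" using \<delta> n by (simp add: r_def)
  have "norm (dilated_conv \<phi> g X \<tau> - dilated_conv \<phi> g X0 \<tau>0) \<le> e"
    if X: "\<And>j. norm (X $ j - X0 $ j) \<le> r" and T: "\<And>j. \<bar>\<tau> $ j - \<tau>0 $ j\<bar> \<le> r" for X \<tau>
  proof -
    have "dist X X0 \<le> (\<Sum>j\<in>UNIV. norm ((X - X0) $ j))"
      unfolding dist_norm norm_vec_def by (rule L2_set_le_sum) simp
    also have "\<dots> \<le> (\<Sum>j\<in>(UNIV::'n set). r)" using X by (intro sum_mono) simp
    finally have 1: "dist X X0 \<le> \<delta> / 4" using n by (simp add: r_def n_def)
    have "dist \<tau> \<tau>0 \<le> (\<Sum>j\<in>UNIV. norm ((\<tau> - \<tau>0) $ j))"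
      unfolding dist_norm norm_vec_def by (rule L2_set_le_sum) simp
    also have "\<dots> \<le> (\<Sum>j\<in>(UNIV::'n set). r)" using T by (intro sum_mono) simp
    finally have 2: "dist \<tau> \<tau>0 \<le> \<delta> / 4" using n by (simp add: r_def n_def)
    have "dist (X, \<tau>) (X0, \<tau>0) \<le> dist X X0 + dist \<tau> \<tau>0"
      unfolding dist_Pair_Pair by (rule sqrt_sum_squares_le_sum) auto
    then have "dist (X, \<tau>) (X0, \<tau>0) < \<delta>" using 1 2 \<delta>(1) by simp
    from \<delta>(2)[OF this] show ?thesis by (simp add: dist_norm f_def)
  qed
  with r show ?thesis by blast
qed

section \<open>Nonvanishing of the limits\<close>

text \<open>The dyadic partition of unity sums to 1 along every nonzero ray, so the transform of
  \<open>\<phi>\<close> cannot vanish on all dyadic dilates of a vector supported on the block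
  \<open>J\<close>.\<close>

lemma fourier_phi_nonzero_on_diagonal:
  fixes \<phi> :: "real^'d::finite^'n::finite \<Rightarrow> complex"
  assumes phi: "admissible_phi \<phi>" and J: "J \<noteq> {}"
  shows "\<exists>v a. v \<bullet> a = 1/4 \<and> fourier \<phi> (block_vec J a) \<noteq> 0"
proof -
  define o1 where "o1 = ((\<chi> i. 1) :: real^'d)"
  obtain i where i: "i \<in> J" using J by blast
  have "block_vec J o1 $ i $ k = 1" for k using i by (simp add: o1_def)
  then have "block_vec J o1 \<noteq> (0 :: real^'d^'n)" by (metis zero_index zero_neq_one)
  then have "((\<lambda>k::int. fourier \<phi> ((2 powr (- real_of_int k)) *\<^sub>R block_vec J o1)) has_sum 1) UNIV"
    using phi by (auto simp: admissible_phi_def)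
  then have "\<exists>k::int. fourier \<phi> ((2 powr (- real_of_int k)) *\<^sub>R block_vec J o1) \<noteq> 0"
    by (metis (mono_tags, lifting) has_sum_0 has_sum_unique zero_neq_one)
  then obtain k :: int where k: "fourier \<phi> ((2 powr (- real_of_int k)) *\<^sub>R block_vec J o1) \<noteq> 0" by blast
  define t where "t = 2 powr (- real_of_int k)"
  have t: "t > 0" by (simp add: t_def)
  \<comment> \<open>Any coordinate direction serves for \<open>v\<close>, since all entries of
    \<open>o1\<close> are 1.\<close>
  have "((1 / (4 * t)) *\<^sub>R axis undefined 1) \<bullet> (t *\<^sub>R o1) = 1 / 4"
    using t by (simp add: inner_axis' o1_def)
  moreover have "block_vec J (t *\<^sub>R o1) = t *\<^sub>R block_vec J o1"
    by (simp add: vec_eq_iff)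
  ultimately show ?thesis using k unfolding t_def by metis
qed

lemma fourier_diff_gauss_nonzero:
  assumes "v \<bullet> a = 1/4"
  shows "fourier (\<lambda>x. complex_of_real (diff_gauss v M x)) a \<noteq> 0"
proof -
  have "2 * pi * (v \<bullet> a) = pi / 2" using assms by simp
  then have "sin (2 * pi * (v \<bullet> a)) = 1" by (simp only: sin_pi_half)
  then show ?thesis
    unfolding fourier_diff_gauss using gauss_pos[of a] by (simp add: less_imp_neq[THEN not_sym])
qed

text \<open>Vanishing everywhere would contradict the nonzero transform at \<open>a\<close>. The
  origin is excluded by oddness, which ensures the nonzero centre needed for the lattice
  shells.\<close>

lemma diff_gauss_nonzero:
  assumes "v \<bullet> a = 1/4" and M: "odd M"
  shows "\<exists>u. u \<noteq> 0 \<and> diff_gauss v M u \<noteq> 0"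
proof (rule ccontr)
  assume "\<not> ?thesis"
  then have "diff_gauss v M x = 0" for x using diff_gauss_at_zero[OF M] by (cases "x = 0") auto
  then have "fourier (\<lambda>x. complex_of_real (diff_gauss v M x)) a = 0" by (simp add: fourier_def)
  with fourier_diff_gauss_nonzero[OF assms(1)] show False by blast
qed

text \<open>Were the convolution identically zero, so would be its Fourier transform, which at
  \<open>block_vec J a\<close> is the product of the transforms of \<open>\<phi>\<close> and of the factors.\<close>

lemma dilated_conv_nonzero:
  fixes \<phi> :: "real^'d::finite^'n::finite \<Rightarrow> complex"
  assumes phi: "admissible_phi \<phi>" and a: "v \<bullet> a = 1/4" "fourier \<phi> (block_vec J a) \<noteq> 0"
  shows "\<exists>h. (\<integral>z. \<phi> z * complex_of_real (\<Prod>j\<in>J. diff_gauss v M (h $ j - z $ j)) \<partial>lborel) \<noteq> 0"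
proof (rule ccontr)
  assume "\<not> ?thesis"
  then have zero: "(\<integral>z. \<phi> z * complex_of_real (\<Prod>j\<in>J. diff_gauss v M (h $ j - z $ j)) \<partial>lborel) = 0" for h by blast
  note \<phi> = phi_integrable[OF phi]
  note [measurable] = borel_measurable_integrable[OF \<phi>]
  \<comment> \<open>The variables outside \<open>J\<close> receive a Gaussian only to make
    \<open>G\<close> integrable over the whole space, so that it has a transform.\<close>
  define g where "g j x = complex_of_real (if j \<in> J then diff_gauss v M x else gauss x)" for j and x :: "real^'d"
  have g: "integrable lborel (g j)" for j
    unfolding g_def using integrable_diff_gauss[of v M] integrable_gauss by (cases "j \<in> J") (auto intro!: integrable_of_real)
  define G where "G X = (\<Prod>j\<in>UNIV. g j (X $ j))" for X :: "real^'d^'n"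
  have G: "integrable lborel G" unfolding G_def by (rule integrable_lborel_prod_vec[OF g])
  note [measurable] = borel_measurable_integrable[OF G]
  \<comment> \<open>Only the variables in \<open>J\<close> are translated, matching a limit in which
    the other inputs are frozen.\<close>
  define \<pi>J where "\<pi>J z = (\<chi> j. if j \<in> J then z $ j else 0)" for z :: "real^'d^'n"
  have [measurable]: "\<pi>J \<in> borel_measurable borel"
    unfolding \<pi>J_def
  proof (intro borel_measurable_continuous_onI continuous_on_vec_lambda)
    show "continuous_on UNIV (\<lambda>z::real^'d^'n. if j \<in> J then z $ j else 0)" for j
      by (cases "j \<in> J") (auto intro!: continuous_intros)
  qed
  define \<xi> where "\<xi> = (block_vec J a :: real^'d^'n)"
  have inner: "(\<integral>X. G (X - \<pi>J z) * cis (- 2 * pi * (X \<bullet> \<xi>)) \<partial>lborel) = cis (- 2 * pi * (z \<bullet> \<xi>)) * fourier G \<xi>" for z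
  proof -
    have "\<pi>J z \<bullet> \<xi> = z \<bullet> \<xi>" unfolding inner_vec_def[of _ \<xi>]
      by (rule sum.cong) (auto simp: \<pi>J_def \<xi>_def)
    then show ?thesis
      using fourier_shift[of G "- \<pi>J z" \<xi>] by (simp add: fourier_def)
  qed
  have pair: "integrable (lborel \<Otimes>\<^sub>M lborel) (\<lambda>(X, z). \<phi> z * G (X - \<pi>J z) * cis (- 2 * pi * (X \<bullet> \<xi>)))"
  proof (subst lborel_pair.integrable_product_swap_iff[symmetric], rule lborel_pair.Fubini_integrable)
    have "norm (\<phi> z * G (X - \<pi>J z) * cis (- 2 * pi * (X \<bullet> \<xi>))) = norm (\<phi> z) * norm (G (X - \<pi>J z))" for z X
      by (simp add: norm_mult)
    moreover have "(\<integral>X. norm (G (X - \<pi>J z)) \<partial>lborel) = (\<integral>X. norm (G X) \<partial>lborel)" for z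
      using integral_lborel_shift[of "\<lambda>X. norm (G X)" "- \<pi>J z"] by simp
    ultimately show "integrable lborel (\<lambda>z. \<integral>X. norm (case (z, X) of (z, X) \<Rightarrow> case (X, z) of (X, z) \<Rightarrow> \<phi> z * G (X - \<pi>J z) * cis (- 2 * pi * (X \<bullet> \<xi>))) \<partial>lborel)"
      using \<phi> by simp
    show "AE z in lborel. integrable lborel (\<lambda>X. case (z, X) of (z, X) \<Rightarrow> case (X, z) of (X, z) \<Rightarrow> \<phi> z * G (X - \<pi>J z) * cis (- 2 * pi * (X \<bullet> \<xi>)))"
    proof (rule AE_I2)
      fix z
      have "integrable lborel (\<lambda>X. G (X - \<pi>J z) * cis (- 2 * pi * (X \<bullet> \<xi>)))"
        using integrable_lborel_shift[OF G, of "- \<pi>J z"] by (intro integrable_times_cis continuous_intros) simp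
      from integrable_mult_right[OF this, of "\<phi> z"]
      show "integrable lborel (\<lambda>X. case (z, X) of (z, X) \<Rightarrow> case (X, z) of (X, z) \<Rightarrow> \<phi> z * G (X - \<pi>J z) * cis (- 2 * pi * (X \<bullet> \<xi>)))"
        by (simp add: mult.assoc)
    qed
  qed measurable
  \<comment> \<open>Integration in \<open>z\<close> first gives 0 by assumption; integration in
    \<open>X\<close> first gives the product of the transforms of \<open>\<phi>\<close> and
    \<open>G\<close> at \<open>\<xi>\<close>.\<close>
  have "(\<integral>z. (\<integral>X. \<phi> z * G (X - \<pi>J z) * cis (- 2 * pi * (X \<bullet> \<xi>)) \<partial>lborel) \<partial>lborel)
      = (\<integral>X. (\<integral>z. \<phi> z * G (X - \<pi>J z) * cis (- 2 * pi * (X \<bullet> \<xi>)) \<partial>lborel) \<partial>lborel)"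
    by (rule lborel_pair.Fubini_integral[OF pair])
  also have "\<dots> = 0"
  proof -
    have "(\<integral>z. \<phi> z * G (X - \<pi>J z) * cis (- 2 * pi * (X \<bullet> \<xi>)) \<partial>lborel) = 0" for X
    proof -
      have "G (X - \<pi>J z) = complex_of_real (\<Prod>j\<in>J. diff_gauss v M (X $ j - z $ j)) * complex_of_real (\<Prod>j\<in>-J. gauss (X $ j))" for z
      proof -
        have "G (X - \<pi>J z) = (\<Prod>j\<in>J. g j ((X - \<pi>J z) $ j)) * (\<Prod>j\<in>-J. g j ((X - \<pi>J z) $ j))"
          unfolding G_def by (subst prod.union_disjoint[symmetric]) (auto intro!: prod.cong)
        then show ?thesis by (simp add: g_def \<pi>J_def)
      qed
      then have "\<phi> z * G (X - \<pi>J z) * cis (- 2 * pi * (X \<bullet> \<xi>))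
         = (complex_of_real (\<Prod>j\<in>-J. gauss (X $ j)) * cis (- 2 * pi * (X \<bullet> \<xi>))) * (\<phi> z * complex_of_real (\<Prod>j\<in>J. diff_gauss v M (X $ j - z $ j)))" for z
        by (simp only: ac_simps)
      then show ?thesis by (simp only: integral_mult_right_zero zero mult_zero_right)
    qed
    then show ?thesis by simp
  qed
  finally have "(\<integral>z. (\<integral>X. \<phi> z * G (X - \<pi>J z) * cis (- 2 * pi * (X \<bullet> \<xi>)) \<partial>lborel) \<partial>lborel) = 0" .
  moreover have "(\<integral>X. \<phi> z * G (X - \<pi>J z) * cis (- 2 * pi * (X \<bullet> \<xi>)) \<partial>lborel) = \<phi> z * (cis (- 2 * pi * (z \<bullet> \<xi>)) * fourier G \<xi>)" for z
    unfolding inner[symmetric] by (subst integral_mult_right_zero[symmetric]) (simp only: mult.assoc)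
  ultimately have "(\<integral>z. \<phi> z * (cis (- 2 * pi * (z \<bullet> \<xi>)) * fourier G \<xi>) \<partial>lborel) = 0"
    by simp
  then have "fourier \<phi> \<xi> * fourier G \<xi> = 0"
    by (simp add: fourier_def[of \<phi>] mult.assoc[symmetric])
  moreover have "fourier G \<xi> \<noteq> 0"
  proof -
    have "g j = (if j \<in> J then (\<lambda>x. complex_of_real (diff_gauss v M x)) else (\<lambda>x. complex_of_real (gauss x)))" for j
      by (auto simp: g_def)
    then have "fourier (g j) (\<xi> $ j) \<noteq> 0" for j
      using fourier_diff_gauss_nonzero[OF a(1), of M] by (cases "j \<in> J") (simp_all add: \<xi>_def fourier_gauss)
    then show ?thesis unfolding G_def[abs_def] fourier_tensor[OF g] by simp
  qed
  ultimately show False using a(2) by (simp add: \<xi>_def)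
qed

text \<open>By multilinearity the sum over sign choices factors over \<open>j\<close>, and in each
  factor the part \<open>b j\<close> cancels. The sets \<open>A j\<close> may differ:
  \<open>{1}\<close> is allowed where \<open>b j\<close> is zero.\<close>

lemma tensor_conv_sum_signs:
  fixes \<phi> :: "real^'d::finite^'n::finite \<Rightarrow> complex" and a b :: "'n \<Rightarrow> real^'d \<Rightarrow> complex"
  assumes \<phi>: "integrable lborel \<phi>"
    and m: "\<And>j. a j \<in> borel_measurable borel" "\<And>j. b j \<in> borel_measurable borel"
    and bd: "\<And>j x. norm (a j x) \<le> Ba j" "\<And>j x. norm (b j x) \<le> Bb j"
    and A: "\<And>j. finite (A j)" "\<And>j x. (\<Sum>s\<in>A j. of_real s * b j x) = 0"
  shows "(\<Sum>s\<in>Pi\<^sub>E UNIV A. tensor_conv \<phi> (\<lambda>j x. a j x + of_real (s j) * b j x) X)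
     = of_nat (\<Prod>j\<in>UNIV. card (A j)) * tensor_conv \<phi> a X"
proof -
  note [measurable] = m borel_measurable_integrable[OF \<phi>]
  have int: "integrable lborel (\<lambda>z. \<phi> z * (\<Prod>j\<in>UNIV. a j (X $ j - z $ j) + of_real (s j) * b j (X $ j - z $ j)))" for s
  proof (rule integrable_mult_bounded[OF \<phi>])
    show "norm (\<Prod>j\<in>UNIV. a j (X $ j - z $ j) + of_real (s j) * b j (X $ j - z $ j)) \<le> (\<Prod>j\<in>UNIV. Ba j + \<bar>s j\<bar> * Bb j)" for z :: "real^'d^'n"
      unfolding prod_norm[symmetric]
      by (intro prod_mono conjI norm_ge_zero order_trans[OF norm_triangle_ineq] add_mono bd)
         (auto simp: norm_mult intro!: mult_left_mono bd)
  qed measurable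
  have "(\<Sum>s\<in>Pi\<^sub>E UNIV A. tensor_conv \<phi> (\<lambda>j x. a j x + of_real (s j) * b j x) X)
     = (\<integral>z. \<phi> z * (\<Sum>s\<in>Pi\<^sub>E UNIV A. \<Prod>j\<in>UNIV. a j (X $ j - z $ j) + of_real (s j) * b j (X $ j - z $ j)) \<partial>lborel)"
    unfolding tensor_conv_def sum_distrib_left by (rule Bochner_Integration.integral_sum[symmetric]) (rule int)
  also have "\<dots> = (\<integral>z. \<phi> z * (\<Prod>j\<in>UNIV. \<Sum>s\<in>A j. a j (X $ j - z $ j) + of_real s * b j (X $ j - z $ j)) \<partial>lborel)"
    by (subst prod_sum_PiE) (auto simp: A)
  also have "\<dots> = (\<integral>z. of_nat (\<Prod>j\<in>UNIV. card (A j)) * (\<phi> z * (\<Prod>j\<in>UNIV. a j (X $ j - z $ j))) \<partial>lborel)"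
    by (simp add: sum.distrib A prod.distrib ac_simps)
  also have "\<dots> = of_nat (\<Prod>j\<in>UNIV. card (A j)) * tensor_conv \<phi> a X"
    unfolding tensor_conv_def by (rule integral_mult_right_zero)
  finally show ?thesis .
qed


section \<open>Low regularity in one variable\<close>

definition multiplier_estimate ::
  "(real^'d::finite^'n::finite \<Rightarrow> complex) \<Rightarrow> ('n \<Rightarrow> real) \<Rightarrow> ('n \<Rightarrow> ereal) \<Rightarrow> real \<Rightarrow> real \<Rightarrow> bool" where
  "multiplier_estimate \<phi> s pj p C \<longleftrightarrow> (\<forall>\<sigma> :: real^'d^'n \<Rightarrow> complex. \<forall>f :: 'n \<Rightarrow> real^'d \<Rightarrow> complex.
            \<sigma> \<in> borel_measurable lborel \<longrightarrow> bounded (range \<sigma>) \<longrightarrow>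
            sobolev_L2 \<phi> s \<sigma> < \<infinity> \<longrightarrow> (\<forall>j. schwartz (f j)) \<longrightarrow>
            Lp_norm (ereal p) (multiplier_op \<sigma> f)
              \<le> ennreal C * sobolev_L2 \<phi> s \<sigma> * (\<Prod>j\<in>UNIV. hardy_norm (pj j) (f j)))"

text \<open>The form with \<open>p\<close>-th powers can be added over sign patterns for every
  \<open>p > 0\<close>, also when \<open>Lp_norm\<close> does not obey the triangle
  inequality.\<close>

lemma nn_integral_powr_le_Lp_norm:
  fixes T :: "'a::euclidean_space \<Rightarrow> complex"
  assumes p: "p > 0" and U: "U \<ge> 0" and le: "Lp_norm (ereal p) T \<le> ennreal U"
  shows "(\<integral>\<^sup>+x. ennreal (norm (T x) powr p) \<partial>lborel) \<le> ennreal (U powr p)"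
proof -
  define I where "I = (\<integral>\<^sup>+x. ennreal (norm (T x) powr p) \<partial>lborel)"
  have "Lp_norm (ereal p) T = enn_powr (1 / p) I"
    by (simp add: Lp_norm_def lq_norm_def enn_powr_def I_def)
  then have le': "enn_powr (1 / p) I \<le> ennreal U" using le by simp
  have "I \<noteq> top"
  proof
    assume "I = top"
    then have "top \<le> ennreal U" using le' by (simp add: enn_powr_def)
    then show False by (simp add: top_unique)
  qed
  define i where "i = enn2real I"
  have i: "I = ennreal i" "i \<ge> 0" using \<open>I \<noteq> top\<close> by (simp_all add: i_def less_top)
  have "enn_powr (1 / p) (ennreal i) = ennreal (i powr (1 / p))" using i(2) by (simp add: enn_powr_def)
  then have "i powr (1 / p) \<le> U" using le' U unfolding i(1) by simp
  then have "(i powr (1 / p)) powr p \<le> U powr p" using p by (intro powr_mono2) auto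
  then have "i \<le> U powr p" using p i by (simp add: powr_powr)
  then show ?thesis unfolding I_def[symmetric] i(1) by (rule ennreal_leI)
qed

lemma ennreal_prod_mono:
  fixes f g :: "'a \<Rightarrow> ennreal"
  shows "(\<And>i. i \<in> A \<Longrightarrow> f i \<le> g i) \<Longrightarrow> prod f A \<le> prod g A"
  by (induction A rule: infinite_finite_induct) (auto intro!: mult_mono)

text \<open>The only access to the assumed estimate: \<open>C0\<close> is fixed before
  \<open>Y\<close>, the coefficients and the inputs, so letting \<open>Y\<close> grow can contradict
  it. \<open>Q\<close> and \<open>B\<close> stand for whatever upper bounds are at hand.\<close>

lemma multiplier_estimate_trig_symbol:
  fixes \<phi> :: "real^'d::finite^'n::finite \<Rightarrow> complex"
  assumes phi: "admissible_phi \<phi>" and s: "\<And>j. 0 < s j" and J: "J \<noteq> {}" and p: "p > 0"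
    and est: "multiplier_estimate \<phi> s pj p C"
  shows "\<exists>C0>0. \<forall>Y c f B Q. finite Y \<longrightarrow> Y \<subseteq> int_lattice \<longrightarrow> (\<forall>j. schwartz (f j)) \<longrightarrow>
     (\<forall>j. 0 \<le> B j \<and> hardy_norm (pj j) (f j) \<le> ennreal (B j)) \<longrightarrow>
     (\<Sum>y\<in>Y. (norm (c y))\<^sup>2 * (1 + norm y) powr (2 * (\<Sum>j\<in>J. s j))) \<le> Q \<longrightarrow>
     (\<integral>\<^sup>+x. ennreal (norm (\<Sum>y\<in>Y. c y * tensor_conv \<phi> f (\<chi> j. if j \<in> J then x + y else x)) powr p) \<partial>lborel)
       \<le> ennreal ((C0 * sqrt Q * (\<Prod>j\<in>UNIV. B j)) powr p)"
proof -
  obtain C1 where C1: "C1 > 0" "\<And>Y c. finite Y \<Longrightarrow> Y \<subseteq> int_lattice \<Longrightarrow>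
     sobolev_L2 \<phi> s (trig_symbol \<phi> J Y c)
       \<le> ennreal (C1 * sqrt (\<Sum>y\<in>Y. (norm (c y))\<^sup>2 * (1 + norm y) powr (2 * (\<Sum>j\<in>J. s j))))"
    using sobolev_L2_trig_symbol_bound[OF phi, of s J, OF s J] by blast
  \<comment> \<open>A positive majorant, as \<open>C\<close> may be negative.\<close>
  define C2 where "C2 = \<bar>C\<bar> + 1"
  have C2: "C2 > 0" "C \<le> C2" by (simp_all add: C2_def)
  define C0 where "C0 = C2 * C1"
  have C0: "C0 > 0" using C1 C2 by (simp add: C0_def)
  have main: "(\<integral>\<^sup>+x. ennreal (norm (\<Sum>y\<in>Y. c y * tensor_conv \<phi> f (\<chi> j. if j \<in> J then x + y else x)) powr p) \<partial>lborel)
       \<le> ennreal ((C0 * sqrt Q * (\<Prod>j\<in>UNIV. B j)) powr p)"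
    if Y: "finite Y" "Y \<subseteq> int_lattice" and f: "\<And>j. schwartz (f j)"
      and B: "\<And>j. 0 \<le> B j" "\<And>j. hardy_norm (pj j) (f j) \<le> ennreal (B j)"
      and Q: "(\<Sum>y\<in>Y. (norm (c y))\<^sup>2 * (1 + norm y) powr (2 * (\<Sum>j\<in>J. s j))) \<le> Q"
    for Y c f B Q
  proof -
    define \<sigma> where "\<sigma> = trig_symbol \<phi> J Y c"
    have Q0: "Q \<ge> 0" by (rule order_trans[OF _ Q]) (auto intro: sum_nonneg)
    have sob: "sobolev_L2 \<phi> s \<sigma> \<le> ennreal (C1 * sqrt Q)"
      unfolding \<sigma>_def using C1(1) Q by (intro order_trans[OF C1(2)[OF Y]] ennreal_leI) simp
    then have "sobolev_L2 \<phi> s \<sigma> < \<infinity>" by (rule le_less_trans) simp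
    then have "Lp_norm (ereal p) (multiplier_op \<sigma> f)
        \<le> ennreal C * sobolev_L2 \<phi> s \<sigma> * (\<Prod>j\<in>UNIV. hardy_norm (pj j) (f j))"
      using est f trig_symbol_measurable[OF phi, of J Y c] trig_symbol_bounded[OF phi, of J Y c]
      unfolding multiplier_estimate_def by (simp add: \<sigma>_def)
    also have "\<dots> \<le> ennreal C2 * ennreal (C1 * sqrt Q) * (\<Prod>j\<in>UNIV. ennreal (B j))"
      using sob B(2) C2 by (intro mult_mono ennreal_prod_mono ennreal_leI) auto
    also have "\<dots> = ennreal (C0 * sqrt Q * (\<Prod>j\<in>UNIV. B j))"
      using C1(1) C2(1) Q0 B(1) by (simp add: C0_def prod_ennreal ennreal_mult[symmetric] prod_nonneg mult.assoc)
    finally have "Lp_norm (ereal p) (multiplier_op \<sigma> f) \<le> ennreal (C0 * sqrt Q * (\<Prod>j\<in>UNIV. B j))" .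
    moreover have "multiplier_op \<sigma> f = (\<lambda>x. \<Sum>y\<in>Y. c y * tensor_conv \<phi> f (\<chi> j. if j \<in> J then x + y else x))"
      unfolding \<sigma>_def by (intro ext multiplier_op_trig_symbol[OF phi] schwartz_integrable f Y(1))
    ultimately show ?thesis
      using C0 Q0 B(1) by (intro nn_integral_powr_le_Lp_norm p) (auto intro!: mult_nonneg_nonneg prod_nonneg)
  qed
  show ?thesis
    by (rule exI[of _ C0], intro conjI allI impI C0, rule main) (simp_all)
qed

text \<open>The sum of the thresholds \<open>2 * d / p(j)\<close> dominates each of them, so one
  order serves all inputs; doubling and adding 1 makes it odd.\<close>

lemma exists_odd_moment_order:
  fixes pj :: "'n::finite \<Rightarrow> ereal"
  assumes pos: "\<And>j. 0 < pj j"
  shows "\<exists>M. odd M \<and> (\<forall>j. pj j \<noteq> \<infinity> \<longrightarrow> 2 * real d \<le> real (d + M) * real_of_ereal (pj j))"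
proof -
  define t where "t j = (if pj j = \<infinity> then 0 else 2 * real d / real_of_ereal (pj j))" for j
  have r: "real_of_ereal (pj j) > 0" if "pj j \<noteq> \<infinity>" for j
    using pos[of j] that by (cases "pj j") auto
  have t0: "t j \<ge> 0" for j using r[of j] by (auto simp: t_def)
  define M where "M = 2 * nat \<lceil>\<Sum>j\<in>UNIV. t j\<rceil> + 1"
  have "2 * real d \<le> real (d + M) * real_of_ereal (pj j)" if "pj j \<noteq> \<infinity>" for j
  proof -
    have "t j \<le> (\<Sum>j\<in>UNIV. t j)" using t0 by (intro member_le_sum) auto
    also have "\<dots> \<le> real (d + M)" unfolding M_def by linarith
    finally show ?thesis using r[OF that] that by (simp add: t_def pos_divide_le_eq)
  qed
  moreover have "odd M" by (simp add: M_def)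
  ultimately show ?thesis by blast
qed

text \<open>Values within half the modulus of a common \<open>D0\<close> cannot cancel under
  nonnegative weights.\<close>

lemma norm_sum_near_ge:
  fixes D :: "'y \<Rightarrow> complex"
  assumes l: "\<And>y. y \<in> Y \<Longrightarrow> 0 \<le> l y" and D: "\<And>y. y \<in> Y \<Longrightarrow> norm (D y - D0) \<le> norm D0 / 2"
  shows "(\<Sum>y\<in>Y. l y) * (norm D0 / 2) \<le> norm (\<Sum>y\<in>Y. of_real (l y) * D y)"
proof -
  have "norm (\<Sum>y\<in>Y. of_real (l y) * D0) - norm (\<Sum>y\<in>Y. of_real (l y) * D y) \<le> norm (\<Sum>y\<in>Y. of_real (l y) * (D y - D0))"
  proof -
    have "(\<Sum>y\<in>Y. of_real (l y) * (D y - D0)) = (\<Sum>y\<in>Y. of_real (l y) * D y) - (\<Sum>y\<in>Y. of_real (l y) * D0)"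
      by (simp add: sum_subtractf right_diff_distrib)
    then show ?thesis by (metis norm_minus_commute norm_triangle_ineq2)
  qed
  also have "\<dots> \<le> (\<Sum>y\<in>Y. l y * (norm D0 / 2))"
  proof (intro order_trans[OF norm_sum] sum_mono)
    fix y assume y: "y \<in> Y"
    show "norm (of_real (l y) * (D y - D0)) \<le> l y * (norm D0 / 2)"
      using mult_left_mono[OF D[OF y] l[OF y]] l[OF y] by (simp add: norm_mult)
  qed
  also have "norm (\<Sum>y\<in>Y. of_real (l y) * D0) = (\<Sum>y\<in>Y. l y) * norm D0"
    using l by (simp add: sum_distrib_right[symmetric] norm_mult of_real_sum[symmetric] sum_nonneg del: of_real_sum)
  finally show ?thesis unfolding sum_distrib_right[symmetric] by (simp add: field_simps)
qed

lemma hardy_norm_dyadic_sum_cart: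
  fixes v :: "real^'d::finite"
  assumes "0 < q" "odd M" "q \<noteq> \<infinity> \<longrightarrow> 2 * real CARD('d) \<le> real (CARD('d) + M) * real_of_ereal q"
  shows "\<exists>B>0. \<forall>S \<eta>. finite S \<longrightarrow> S \<noteq> {} \<longrightarrow> (\<forall>m. \<bar>\<eta> m\<bar> \<le> 1) \<longrightarrow>
     hardy_norm q (\<lambda>x. complex_of_real (dyadic_sum (diff_gauss v M) (real CARD('d) * recip q) S \<eta> x))
       \<le> ennreal (B * real (card S) powr recip q)"
proof -
  have D: "DIM(real^'d) = CARD('d)" by simp
  show ?thesis
    by (rule hardy_norm_dyadic_sum[where v=v and q=q and M=M, unfolded D, OF assms(1,2)]) (use assms(3) in simp)
qed

text \<open>The symbol has size about \<open>\<Lambda>\<close> at the frequency \<open>(0, \<dots>, a, \<dots>, 0)\<close> but Sobolev norm about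
  \<open>sqrt \<Lambda>\<close>; widening the inputs to scale \<open>2 ^ m\<close> isolates that value.\<close>

lemma estimate_fails_low_regularity:
  fixes \<phi> :: "real^'d::finite^'n::finite \<Rightarrow> complex"
  assumes phi: "admissible_phi \<phi>" and s: "\<And>j. 0 < s j" and p: "p > 0"
    and pos: "\<And>j. 0 < pj j" and holder: "(\<Sum>j\<in>UNIV. recip (pj j)) = 1 / p"
    and est: "multiplier_estimate \<phi> s pj p C"
    and i: "s i \<le> real CARD('d) / 2" "1 < pj i"
  shows False
proof -
  define d where "d = real CARD('d)"
  have d: "d > 0" by (simp add: d_def)
  obtain M where M: "odd M" "\<And>j. pj j \<noteq> \<infinity> \<Longrightarrow> 2 * d \<le> real (CARD('d) + M) * real_of_ereal (pj j)"
    using exists_odd_moment_order[of pj "CARD('d)", OF pos] unfolding d_def by blast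
  obtain v a :: "real^'d" where va: "v \<bullet> a = 1/4" "fourier \<phi> (block_vec {i} a) \<noteq> 0"
    using fourier_phi_nonzero_on_diagonal[OF phi, of "{i}"] by blast
  define \<psi> where "\<psi> = diff_gauss v M"
  obtain u where u: "u \<noteq> 0" "\<psi> u \<noteq> 0"
    unfolding \<psi>_def using diff_gauss_nonzero[OF va(1) M(1)] by blast
  define \<beta> where "\<beta> j = d * recip (pj j)" for j
  have sum_\<beta>: "(\<Sum>j\<in>UNIV. \<beta> j) = d / p" by (simp add: \<beta>_def sum_distrib_left[symmetric] holder)
  have "\<exists>B>0. \<forall>m. hardy_norm (pj j) (\<lambda>x. complex_of_real (dyadic_sum \<psi> (\<beta> j) {m} (\<lambda>_. 1) x)) \<le> ennreal B" for j
  proof -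
    obtain B where B: "B > 0" "\<forall>S \<eta>. finite S \<longrightarrow> S \<noteq> {} \<longrightarrow> (\<forall>m. \<bar>\<eta> m\<bar> \<le> 1) \<longrightarrow>
     hardy_norm (pj j) (\<lambda>x. complex_of_real (dyadic_sum \<psi> (\<beta> j) S \<eta> x)) \<le> ennreal (B * real (card S) powr recip (pj j))"
      using hardy_norm_dyadic_sum_cart[of "pj j" M v] pos[of j] M unfolding d_def \<beta>_def \<psi>_def by metis
    have "hardy_norm (pj j) (\<lambda>x. complex_of_real (dyadic_sum \<psi> (\<beta> j) {m} (\<lambda>_. 1) x)) \<le> ennreal B" for m
      using B(2)[rule_format, of "{m}" "\<lambda>_. 1"] by simp
    with B(1) show ?thesis by (intro exI[of _ B]) simp
  qed
  then obtain B where B: "\<And>j. B j > 0"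
    "\<And>j m. hardy_norm (pj j) (\<lambda>x. complex_of_real (dyadic_sum \<psi> (\<beta> j) {m} (\<lambda>_. 1) x)) \<le> ennreal (B j)"
    by metis
  \<comment> \<open>The inputs other than the \<open>i\<close>-th use the cancelling profile
    \<open>\<psi>\<close>, because their exponents may be at most 1.\<close>
  define f where "f m j = (if j = i then (\<lambda>x. complex_of_real (2 powr (- (real m * \<beta> i)) * gauss ((1/2) ^ m *\<^sub>R x)) * cis (2 * pi * (a \<bullet> x)))
     else (\<lambda>x. complex_of_real (dyadic_sum \<psi> (\<beta> j) {m} (\<lambda>_. 1) x)))" for m j
  define g where "g j = (if j = i then gauss else \<psi>)" for j
  \<comment> \<open>The frequency of the \<open>i\<close>-th input is moved onto
    \<open>\<phi>\<close>; the integral of \<open>\<Phi>\<close> is then the transform of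
    \<open>\<phi>\<close> at \<open>block_vec {i} a\<close>.\<close>
  define \<Phi> where "\<Phi> z = \<phi> z * cis (- 2 * pi * (a \<bullet> z $ i))" for z
  have f_schwartz: "schwartz (f m j)" for m j
    unfolding f_def \<psi>_def
    by (cases "j = i") (simp_all only: if_True if_False simp_thms schwartz_modulated_gauss schwartz_dyadic_sum)
  define B' where "B' j = (if j = i then 1 else B j)" for j
  have f_hardy: "0 \<le> B' j \<and> hardy_norm (pj j) (f m j) \<le> ennreal (B' j)" for m j
    using B hardy_norm_modulated_gauss[OF i(2), of m a] by (auto simp: f_def B'_def \<beta>_def d_def less_imp_le)
  have f_eq: "f m j w = complex_of_real (2 powr (- (real m * \<beta> j)) * g j ((1/2) ^ m *\<^sub>R w)) * (if j = i then cis (2 * pi * (a \<bullet> w)) else 1)" for m j w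
    by (simp add: f_def g_def dyadic_sum_def)
  have tensor_eq: "tensor_conv \<phi> (f m) X = complex_of_real (2 powr (- (real m * (d / p)))) * cis (2 * pi * (a \<bullet> X $ i))
      * dilated_conv \<Phi> g ((1/2) ^ m *\<^sub>R X) (\<chi> j. (1/2) ^ m)" for m X
  proof -
    have "\<phi> z * (\<Prod>j\<in>UNIV. f m j (X $ j - z $ j))
      = (complex_of_real (2 powr (- (real m * (d / p)))) * cis (2 * pi * (a \<bullet> X $ i))) *
        (\<Phi> z * complex_of_real (\<Prod>j\<in>UNIV. g j (((1/2) ^ m *\<^sub>R X) $ j - (\<chi> j. (1/2) ^ m) $ j *\<^sub>R z $ j)))" for z
    proof -
      have "(\<Prod>j\<in>UNIV. f m j (X $ j - z $ j))
         = complex_of_real (\<Prod>j\<in>UNIV. 2 powr (- (real m * \<beta> j))) * complex_of_real (\<Prod>j\<in>UNIV. g j ((1/2) ^ m *\<^sub>R (X $ j - z $ j)))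
           * (\<Prod>j\<in>UNIV. if j = i then cis (2 * pi * (a \<bullet> (X $ j - z $ j))) else 1)"
        by (simp add: f_eq prod.distrib)
      also have "(\<Prod>j\<in>UNIV. if j = i then cis (2 * pi * (a \<bullet> (X $ j - z $ j))) else 1) = cis (2 * pi * (a \<bullet> (X $ i - z $ i)))"
        by simp
      also have "\<dots> = cis (2 * pi * (a \<bullet> X $ i)) * cis (- 2 * pi * (a \<bullet> z $ i))"
        by (simp add: cis_mult inner_diff_right right_diff_distrib)
      also have "(\<Prod>j\<in>UNIV. 2 powr (- (real m * \<beta> j))) = 2 powr (- (real m * (d / p)))"
        by (simp add: powr_sum[symmetric] sum_negf sum_distrib_left[symmetric] sum_\<beta>)
      finally show ?thesis by (simp add: \<Phi>_def scaleR_diff_right ac_simps)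
    qed
    then show ?thesis unfolding tensor_conv_def dilated_conv_def by (simp only: integral_mult_right_zero)
  qed
  have \<Phi>_int: "integrable lborel \<Phi>"
    unfolding \<Phi>_def by (intro integrable_times_cis phi_integrable[OF phi] continuous_intros)
  \<comment> \<open>The limit of infinite width: all profiles are frozen at \<open>u\<close>, and
    \<open>K0\<close> is the integral of \<open>\<Phi>\<close> times their values there.\<close>
  define K0 where "K0 = dilated_conv \<Phi> g (\<chi> j. u) 0"
  have K0: "K0 \<noteq> 0"
  proof -
    have "z \<bullet> (block_vec {i} a :: real^'d^'n) = a \<bullet> z $ i" for z
    proof -
      have "z \<bullet> (block_vec {i} a :: real^'d^'n) = (\<Sum>j\<in>UNIV. if j = i then z $ j \<bullet> a else 0)"
        unfolding inner_vec_def[of _ "block_vec {i} a"] by (rule sum.cong) auto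
      then show ?thesis by (simp add: inner_commute)
    qed
    then have "K0 = fourier \<phi> (block_vec {i} a) * complex_of_real (\<Prod>j\<in>UNIV. g j u)"
      by (simp add: K0_def dilated_conv_def \<Phi>_def fourier_def)
    then show ?thesis using va(2) u gauss_pos[of u] by (simp add: g_def less_imp_neq[THEN not_sym])
  qed
  obtain Bg where Bg: "\<And>x. \<bar>\<psi> x\<bar> \<le> Bg" unfolding \<psi>_def using diff_gauss_bounded by blast
  have "\<exists>r>0. \<forall>X \<tau>. (\<forall>j. norm (X $ j - (\<chi> j. u) $ j) \<le> r) \<longrightarrow> (\<forall>j. \<bar>\<tau> $ j - 0 $ j\<bar> \<le> r) \<longrightarrow>
     norm (dilated_conv \<Phi> g X \<tau> - dilated_conv \<Phi> g (\<chi> j. u) 0) \<le> norm K0 / 2"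
  proof (rule dilated_conv_near[OF \<Phi>_int])
    show "continuous_on UNIV (g j)" for j
      by (auto simp: g_def \<psi>_def continuous_diff_gauss intro: continuous_on_gauss)
    show "\<bar>g j x\<bar> \<le> (if j = i then 1 else Bg)" for j x using Bg by (simp add: g_def)
  qed (use K0 in simp)
  then obtain r where r: "r > 0" "\<And>X \<tau>. (\<And>j. norm (X $ j - u) \<le> r) \<Longrightarrow> (\<And>j. \<bar>\<tau> $ j\<bar> \<le> r) \<Longrightarrow>
     norm (dilated_conv \<Phi> g X \<tau> - K0) \<le> norm K0 / 2"
    unfolding K0_def by auto
  obtain c1 m1 where c1: "c1 > 0" "\<And>K. c1 * real K \<le> (\<Sum>y\<in>(\<Union>m\<in>{m1..<m1+K}. lattice_shell u (norm u / 4) m). (1 + norm y) powr (- d))"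
    using sum_lattice_shells[OF u(1), of "norm u / 4"] u(1) unfolding d_def by auto
  obtain C0 where C0: "C0 > 0" and trig: "\<And>Y c f B Q. finite Y \<Longrightarrow> Y \<subseteq> int_lattice \<Longrightarrow> (\<And>j. schwartz (f j)) \<Longrightarrow>
     (\<And>j. 0 \<le> B j \<and> hardy_norm (pj j) (f j) \<le> ennreal (B j)) \<Longrightarrow>
     (\<Sum>y\<in>Y. (norm (c y))\<^sup>2 * (1 + norm y) powr (2 * (\<Sum>j\<in>{i}. s j))) \<le> Q \<Longrightarrow>
     (\<integral>\<^sup>+x. ennreal (norm (\<Sum>y\<in>Y. c y * tensor_conv \<phi> f (\<chi> j. if j \<in> {i} then x + y else x)) powr p) \<partial>lborel)
       \<le> ennreal ((C0 * sqrt Q * (\<Prod>j\<in>UNIV. B j)) powr p)"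
    using multiplier_estimate_trig_symbol[OF phi, of s "{i}" p pj C, OF s _ p est] by blast
  define P where "P = (\<Prod>j\<in>UNIV. B' j)"
  have P: "P > 0" unfolding P_def B'_def using B by (intro prod_pos) auto
  define \<omega> where "\<omega> = (unit_ball_vol d * (r / 2) ^ CARD('d)) powr (1 / p) * (norm K0 / 2)"
  have "unit_ball_vol d * (r / 2) ^ CARD('d) > 0" using r(1) unit_ball_vol_pos[of d] d by simp
  then have \<omega>: "\<omega> > 0" unfolding \<omega>_def using K0 by (intro mult_pos_pos) (simp_all only: powr_gt_zero, simp_all)
  define C' where "C' = C0 * P / \<omega>"
  have C': "C' > 0" using C0 P \<omega> by (simp add: C'_def)
  have main: "c1 * real K \<le> C'\<^sup>2" for K
  proof -
    define Y where "Y = (\<Union>m\<in>{m1..<m1+K}. lattice_shell u (norm u / 4) m)"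
    have Y: "finite Y" "Y \<subseteq> int_lattice"
      unfolding Y_def using finite_lattice_shell by (auto, auto simp: lattice_shell_def)
    define \<Lambda> where "\<Lambda> = (\<Sum>y\<in>Y. (1 + norm y) powr (- d))"
    have \<Lambda>0: "\<Lambda> \<ge> 0" unfolding \<Lambda>_def by (intro sum_nonneg) auto
    \<comment> \<open>The phase undoes the one that the modulated input acquires under translation
      by \<open>y\<close>, so all terms add coherently.\<close>
    define c where "c y = complex_of_real ((1 + norm y) powr (- d)) * cis (- 2 * pi * (a \<bullet> y))" for y
    \<comment> \<open>The hypothesis \<open>s i \<le> d / 2\<close> enters as
      \<open>- 2 * d + 2 * s i \<le> - d\<close>.\<close>
    have Q: "(\<Sum>y\<in>Y. (norm (c y))\<^sup>2 * (1 + norm y) powr (2 * (\<Sum>j\<in>{i}. s j))) \<le> \<Lambda>"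
      unfolding \<Lambda>_def
    proof (rule sum_mono)
      fix y assume "y \<in> Y"
      have "(norm (c y))\<^sup>2 * (1 + norm y) powr (2 * (\<Sum>j\<in>{i}. s j)) = (1 + norm y) powr (- d + - d + 2 * s i)"
        by (simp only: powr_add) (simp add: c_def norm_mult power2_eq_square)
      also have "\<dots> \<le> (1 + norm y) powr (- d)" using i(1) by (intro powr_mono) (auto simp: d_def)
      finally show "(norm (c y))\<^sup>2 * (1 + norm y) powr (2 * (\<Sum>j\<in>{i}. s j)) \<le> (1 + norm y) powr (- d)" .
    qed
    obtain R where R: "R > 0" "\<And>y. y \<in> Y \<Longrightarrow> norm y \<le> R"
      using finite_imp_bounded[OF Y(1)] unfolding bounded_pos by blast
    \<comment> \<open>The width is chosen after \<open>Y\<close>: translations by points of norm at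
      most \<open>R\<close> become negligible at scale \<open>2 ^ m\<close>.\<close>
    obtain m where m: "(1/2) ^ m < min r (r / (2 * R))"
      using real_arch_pow_inv[of "min r (r / (2 * R))" "1/2"] r(1) R(1) by auto
    have mr: "(1/2) ^ m \<le> r" "(1/2) ^ m * R \<le> r / 2" using m R(1) by (auto simp: field_simps)
    define T where "T x = (\<Sum>y\<in>Y. c y * tensor_conv \<phi> (f m) (\<chi> j. if j \<in> {i} then x + y else x))" for x
    have upper: "(\<integral>\<^sup>+x. ennreal (norm (T x) powr p) \<partial>lborel) \<le> ennreal ((C0 * sqrt \<Lambda> * P) powr p)"
      unfolding T_def P_def by (rule trig[OF Y f_schwartz f_hardy Q])
    define L where "L = 2 powr (- (real m * (d / p))) * (\<Lambda> * (norm K0 / 2))"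
    have L0: "L \<ge> 0" using \<Lambda>0 by (simp add: L_def)
    have lower: "L \<le> norm (T x)" if x: "x \<in> ball (2 ^ m *\<^sub>R u) (2 ^ m * (r / 2))" for x
    proof -
      define D where "D y = dilated_conv \<Phi> g ((1/2) ^ m *\<^sub>R (\<chi> j. if j \<in> {i} then x + y else x)) (\<chi> j. (1/2) ^ m)" for y
      have xu: "norm ((1/2) ^ m *\<^sub>R x - u) \<le> r / 2"
      proof -
        have "(1/2) ^ m *\<^sub>R x - u = (1/2) ^ m *\<^sub>R (x - 2 ^ m *\<^sub>R u)"
          by (simp add: scaleR_diff_right power_mult_distrib[symmetric])
        then have "norm ((1/2) ^ m *\<^sub>R x - u) = (1/2) ^ m * norm (x - 2 ^ m *\<^sub>R u)"
          by (simp only: norm_scaleR) simp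
        also have "\<dots> \<le> (1/2) ^ m * (2 ^ m * (r / 2))"
          using x by (intro mult_left_mono) (auto simp: dist_norm norm_minus_commute)
        finally show ?thesis by (simp add: power_one_over)
      qed
      have Dy: "norm (D y - K0) \<le> norm K0 / 2" if "y \<in> Y" for y
        unfolding D_def
      proof (rule r(2))
        fix j
        have "norm ((1/2) ^ m *\<^sub>R y) = (1/2) ^ m * norm y" by simp
        also have "\<dots> \<le> (1/2) ^ m * R" by (intro mult_left_mono R(2)[OF that]) simp
        also note mr(2)
        finally have "norm ((1/2) ^ m *\<^sub>R y) \<le> r / 2" .
        moreover have "norm ((1/2) ^ m *\<^sub>R (x + y) - u) \<le> norm ((1/2) ^ m *\<^sub>R x - u) + norm ((1/2) ^ m *\<^sub>R y)"
          using norm_triangle_ineq[of "(1/2) ^ m *\<^sub>R x - u" "(1/2) ^ m *\<^sub>R y"] by (simp add: algebra_simps)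
        ultimately show "norm (((1/2) ^ m *\<^sub>R (\<chi> j. if j \<in> {i} then x + y else x)) $ j - u) \<le> r"
          using xu r(1) by (cases "j = i") auto
      qed (use mr in simp)
      have "T x = complex_of_real (2 powr (- (real m * (d / p)))) * cis (2 * pi * (a \<bullet> x)) * (\<Sum>y\<in>Y. complex_of_real ((1 + norm y) powr (- d)) * D y)"
      proof -
        have "c y * tensor_conv \<phi> (f m) (\<chi> j. if j \<in> {i} then x + y else x)
           = (complex_of_real (2 powr (- (real m * (d / p)))) * cis (2 * pi * (a \<bullet> x))) * (complex_of_real ((1 + norm y) powr (- d)) * D y)" for y
        proof -
          have "cis (2 * pi * (a \<bullet> (x + y))) = cis (2 * pi * (a \<bullet> x)) * cis (2 * pi * (a \<bullet> y))"
            by (simp add: cis_mult inner_add_right distrib_left)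
          moreover have "cis (- 2 * pi * (a \<bullet> y)) * cis (2 * pi * (a \<bullet> y)) = 1" by (simp add: cis_mult)
          ultimately show ?thesis unfolding tensor_eq c_def D_def by simp
        qed
        then show ?thesis unfolding T_def by (simp only: sum_distrib_left)
      qed
      then have "norm (T x) = 2 powr (- (real m * (d / p))) * norm (\<Sum>y\<in>Y. complex_of_real ((1 + norm y) powr (- d)) * D y)"
        by (simp add: norm_mult)
      also have "\<dots> \<ge> L"
        unfolding L_def \<Lambda>_def by (intro mult_left_mono norm_sum_near_ge Dy) auto
      finally show ?thesis .
    qed
    have "ennreal (L powr p) * emeasure lborel (ball (2 ^ m *\<^sub>R u) (2 ^ m * (r / 2)))
       = (\<integral>\<^sup>+x. ennreal (L powr p) * indicator (ball (2 ^ m *\<^sub>R u) (2 ^ m * (r / 2))) x \<partial>lborel)"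
      by (subst nn_integral_cmult_indicator) auto
    also have "\<dots> \<le> (\<integral>\<^sup>+x. ennreal (norm (T x) powr p) \<partial>lborel)"
      using lower L0 p by (intro nn_integral_mono) (auto simp: indicator_def intro!: ennreal_leI powr_mono2)
    also note upper
    also have "emeasure lborel (ball (2 ^ m *\<^sub>R u) (2 ^ m * (r / 2))) = ennreal (unit_ball_vol d * (2 ^ m * (r / 2)) ^ CARD('d))"
      using r(1) by (subst emeasure_ball) (auto simp: d_def)
    finally have "L powr p * (unit_ball_vol d * (2 ^ m * (r / 2)) ^ CARD('d)) \<le> (C0 * sqrt \<Lambda> * P) powr p"
      using r(1) unit_ball_vol_nonneg[of d] d by (simp add: ennreal_mult[symmetric])
    \<comment> \<open>The volume of the ball, of order \<open>2 ^ (m * d)\<close>, cancels the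
      \<open>p\<close>-th power of the normalising factors, so the choice of \<open>m\<close> leaves
      no trace in the inequality.\<close>
    moreover have "L powr p * (unit_ball_vol d * (2 ^ m * (r / 2)) ^ CARD('d)) = (\<omega> * \<Lambda>) powr p"
    proof -
      have 1: "L powr p = 2 powr (- (real m * d)) * (\<Lambda> * (norm K0 / 2)) powr p"
        by (simp only: L_def powr_mult powr_powr) (use p in simp)
      have 2: "(2 ^ m * (r / 2)) ^ CARD('d) = 2 powr (real m * d) * (r / 2) ^ CARD('d)"
        unfolding power_mult_distrib by (simp add: powr_realpow[symmetric] powr_powr[symmetric] d_def)
      have 3: "2 powr (- (real m * d)) * 2 powr (real m * d) = 1" by (simp add: powr_add[symmetric])
      have 4: "(\<omega> * \<Lambda>) powr p = (unit_ball_vol d * (r / 2) ^ CARD('d)) * (\<Lambda> * (norm K0 / 2)) powr p"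
      proof -
        have "(\<omega> * \<Lambda>) powr p = ((unit_ball_vol d * (r / 2) ^ CARD('d)) powr (1 / p)) powr p * (\<Lambda> * (norm K0 / 2)) powr p"
          by (simp only: \<omega>_def powr_mult ac_simps)
        then show ?thesis using p r(1) unit_ball_vol_nonneg[of d] d by (simp add: powr_powr)
      qed
      have "L powr p * (unit_ball_vol d * (2 ^ m * (r / 2)) ^ CARD('d))
         = (2 powr (- (real m * d)) * 2 powr (real m * d)) * ((unit_ball_vol d * (r / 2) ^ CARD('d)) * (\<Lambda> * (norm K0 / 2)) powr p)"
        by (simp only: 1 2 ac_simps)
      then show ?thesis by (simp only: 3 4 mult_1)
    qed
    ultimately have "(\<omega> * \<Lambda>) powr p \<le> (C0 * sqrt \<Lambda> * P) powr p" by simp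
    then have "((\<omega> * \<Lambda>) powr p) powr (1 / p) \<le> ((C0 * sqrt \<Lambda> * P) powr p) powr (1 / p)"
      by (rule powr_mono2[rotated 2]) (use p in auto)
    then have "\<omega> * \<Lambda> \<le> C0 * sqrt \<Lambda> * P"
      using p \<omega> \<Lambda>0 C0 P by (simp add: powr_powr)
    then have le: "\<Lambda> \<le> C' * sqrt \<Lambda>" using \<omega> by (simp add: C'_def field_simps)
    have "\<Lambda> \<le> C'\<^sup>2"
    proof (cases "\<Lambda> = 0")
      case False
      then have "sqrt \<Lambda> > 0" using \<Lambda>0 by simp
      moreover have "sqrt \<Lambda> * sqrt \<Lambda> \<le> C' * sqrt \<Lambda>" using le \<Lambda>0 by simp
      ultimately have "sqrt \<Lambda> \<le> C'" by (rule mult_right_le_imp_le[rotated])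
      then have "(sqrt \<Lambda>)\<^sup>2 \<le> C'\<^sup>2" using \<Lambda>0 by (intro power_mono) auto
      then show ?thesis using \<Lambda>0 by simp
    qed simp
    then show ?thesis using c1(2)[of K] unfolding \<Lambda>_def Y_def by linarith
  qed
  obtain K :: nat where "C'\<^sup>2 / c1 < real K" using reals_Archimedean2 by blast
  then show False using main[of K] c1(1) by (simp add: field_simps)
qed


section \<open>The condition on a block of variables\<close>

text \<open>After the \<open>p\<close>-th root, \<open>\<Lambda> powr (1 / p - 1/2)\<close> is
  bounded by a multiple of \<open>real K powr b\<close>. With \<open>\<Lambda>\<close> at least of
  order \<open>K\<close> and \<open>1 / p = a + b\<close> this bounds
  \<open>real K powr (a - 1/2)\<close>.\<close>

lemma growth_contradiction:
  fixes a b c p C :: real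
  assumes p: "p > 0" "1 / p = a + b" and a: "a > 1/2" and b: "b \<ge> 0" and c: "c > 0" and C: "C \<ge> 0"
    and H: "\<And>K::nat. K \<ge> 1 \<Longrightarrow> \<exists>\<Lambda>. c * real K \<le> \<Lambda> \<and> \<Lambda> \<le> C * (sqrt \<Lambda> * real K powr b) powr p"
  shows False
proof -
  \<comment> \<open>The exponent of \<open>\<Lambda>\<close> left after cancelling its square root.
    It is positive, so the lower bound on \<open>\<Lambda>\<close> may be inserted; no upper bound
    on \<open>\<Lambda>\<close> is at hand.\<close>
  define e where "e = a + b - 1/2"
  have e: "e > 0" using a b by (simp add: e_def)
  define D where "D = C powr (1 / p) / c powr e"
  have bound: "real K powr (a - 1/2) \<le> D" if K: "K \<ge> 1" for K :: nat
  proof -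
    obtain \<Lambda> where L: "c * real K \<le> \<Lambda>" "\<Lambda> \<le> C * (sqrt \<Lambda> * real K powr b) powr p" using H[OF K] by blast
    have cK: "c * real K > 0" using c K by simp
    then have L0: "\<Lambda> > 0" using L(1) by linarith
    have "\<Lambda> powr (1 / p) \<le> (C * (sqrt \<Lambda> * real K powr b) powr p) powr (1 / p)"
      using L(2) L0 p a b by (intro powr_mono2) auto
    also have "\<dots> = C powr (1 / p) * (sqrt \<Lambda> * real K powr b)"
      using p(1) L0 C by (simp add: powr_mult powr_powr)
    finally have "\<Lambda> powr (e + 1/2) \<le> C powr (1 / p) * (\<Lambda> powr (1/2) * real K powr b)"
      using L0 by (simp add: p(2) e_def powr_half_sqrt)
    then have "\<Lambda> powr (1/2) * \<Lambda> powr e \<le> \<Lambda> powr (1/2) * (C powr (1 / p) * real K powr b)"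
      by (simp add: powr_add ac_simps)
    then have "\<Lambda> powr e \<le> C powr (1 / p) * real K powr b" using L0 by simp
    moreover have "(c * real K) powr e \<le> \<Lambda> powr e" using L(1) cK e by (intro powr_mono2) auto
    ultimately have "c powr e * real K powr (b + (a - 1/2)) \<le> C powr (1 / p) * real K powr b"
      by (simp add: powr_mult e_def algebra_simps)
    then have "real K powr b * (c powr e * real K powr (a - 1/2)) \<le> real K powr b * C powr (1 / p)"
      by (simp only: powr_add ac_simps)
    then have "c powr e * real K powr (a - 1/2) \<le> C powr (1 / p)" using K by simp
    then show ?thesis using c by (simp add: D_def pos_le_divide_eq mult.commute)
  qed
  define q where "q = a - 1/2"
  have q: "q > 0" using a by (simp add: q_def)
  have "D \<ge> 0" by (simp add: D_def)
  obtain K :: nat where K: "(D + 1) powr (1 / q) + 1 < real K" using reals_Archimedean2 by blast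
  then have "(D + 1) powr (1 / q) \<le> real K" "K \<ge> 1" using powr_ge_zero[of "D + 1" "1 / q"] by linarith+
  then have "((D + 1) powr (1 / q)) powr q \<le> real K powr q" using q by (intro powr_mono2) auto
  then have "D + 1 \<le> real K powr q" using q \<open>D \<ge> 0\<close> by (simp add: powr_powr)
  with bound[OF \<open>K \<ge> 1\<close>] show False by (simp add: q_def)
qed

lemma int_lattice_separated:
  fixes y y' :: "real^'d::finite"
  assumes "y \<in> int_lattice" "y' \<in> int_lattice" "y \<noteq> y'"
  shows "1 \<le> norm (y - y')"
proof -
  obtain i where i: "y $ i \<noteq> y' $ i" using assms(3) by (auto simp: vec_eq_iff)
  have "y $ i - y' $ i \<in> \<int>" using assms(1,2) by (auto simp: int_lattice_def)
  then obtain k :: int where k: "y $ i - y' $ i = of_int k" by (rule Ints_cases)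
  then have "k \<noteq> 0" using i by auto
  then have "1 \<le> \<bar>y $ i - y' $ i\<bar>" unfolding k by linarith
  also have "\<dots> \<le> norm (y - y')" using component_le_norm_cart[of "y - y'" i] by simp
  finally show ?thesis .
qed

lemma tensor_conv_measurable:
  fixes \<phi> :: "real^'d::finite^'n::finite \<Rightarrow> complex"
  assumes [measurable]: "\<phi> \<in> borel_measurable borel" "\<And>j. f j \<in> borel_measurable borel"
  shows "(\<lambda>x. tensor_conv \<phi> f (\<chi> j. if j \<in> J then x + y else x)) \<in> borel_measurable borel"
proof -
  have *: "(\<lambda>(x, z). \<phi> z * (\<Prod>j\<in>UNIV. f j ((if j \<in> J then x + y else x) - z $ j))) \<in> borel_measurable (borel \<Otimes>\<^sub>M lborel)"
    by measurable
  show ?thesis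
    unfolding tensor_conv_def using lborel.borel_measurable_lebesgue_integral[OF *] by simp
qed

lemma dyadic_sum_flip:
  assumes "finite S" "m \<in> S"
  shows "complex_of_real (dyadic_sum \<psi> \<beta> S (flip S m s \<eta>) x)
    = complex_of_real (\<eta> m * 2 powr (- (real m * \<beta>)) * \<psi> ((1/2) ^ m *\<^sub>R x))
      + of_real s * complex_of_real (dyadic_sum \<psi> \<beta> (S - {m}) \<eta> x)"
  using sum_flip[OF assms, of s \<eta> "\<lambda>i. complex_of_real (2 powr (- (real i * \<beta>)) * \<psi> ((1/2) ^ i *\<^sub>R x))"]
  by (simp add: dyadic_sum_def mult.assoc)

lemma dyadic_sum_bounded:
  assumes "\<And>x. \<bar>\<psi> x\<bar> \<le> B"
  shows "\<exists>B'. \<forall>x. norm (complex_of_real (dyadic_sum \<psi> \<beta> S \<eta> x)) \<le> B'"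
proof -
  have "norm (complex_of_real (dyadic_sum \<psi> \<beta> S \<eta> x)) \<le> (\<Sum>m\<in>S. \<bar>\<eta> m\<bar> * 2 powr (- (real m * \<beta>)) * B)" for x
    unfolding norm_of_real dyadic_sum_def
    by (intro order_trans[OF sum_abs] sum_mono) (auto simp: abs_mult intro!: mult_left_mono assms)
  then show ?thesis by blast
qed

text \<open>Flipping isolates the lattice point \<open>y0\<close> in the sum over \<open>Y\<close>
  and the dilate \<open>m\<close> in every wide input at once. The number of flips is independent of
  \<open>Y\<close> and \<open>S\<close>, so the constant is uniform as both grow.\<close>

lemma flipped_average:
  fixes \<phi> :: "real^'d::finite^'n::finite \<Rightarrow> complex" and h :: "'n \<Rightarrow> real^'d"
    and J :: "'n set" and \<beta> :: "'n \<Rightarrow> real"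
  assumes \<phi>: "integrable lborel \<phi>" and \<psi>: "continuous_on UNIV \<psi>" "\<And>x. \<bar>\<psi> x\<bar> \<le> B"
    and Y: "finite Y" "y0 \<in> Y" and S: "finite S" "m \<in> S" and p: "p > 0"
  defines "F \<equiv> \<lambda>\<eta> j x. if j \<in> J then complex_of_real (\<psi> (x + h j)) else complex_of_real (dyadic_sum \<psi> (\<beta> j) S (\<eta> j) x)"
    and "G \<equiv> \<lambda>\<eta> j x. if j \<in> J then complex_of_real (\<psi> (x + h j))
        else complex_of_real (\<eta> j m * 2 powr (- (real m * \<beta> j)) * \<psi> ((1/2) ^ m *\<^sub>R x))"
    and "A \<equiv> \<lambda>j. if j \<in> J then {1} else {1, - 1 :: real}"
  shows "norm (of_real (\<epsilon> y0) * (c y0 * tensor_conv \<phi> (G \<eta>) (X y0))) powr p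
    \<le> (\<Sum>(s0, s)\<in>{1, - 1} \<times> Pi\<^sub>E UNIV A.
        norm (\<Sum>y\<in>Y. of_real (flip Y y0 s0 \<epsilon> y) * (c y * tensor_conv \<phi> (F (\<lambda>j. flip S m (s j) (\<eta> j))) (X y))) powr p)"
proof -
  note [measurable] = borel_measurable_integrable[OF \<phi>] borel_measurable_continuous_onI[OF \<psi>(1)]
  \<comment> \<open>The nonresonant dilates of the \<open>j\<close>-th input; zero for
    \<open>j\<close> in \<open>J\<close>, where the single sign 1 is allowed.\<close>
  define b where "b j x = (if j \<in> J then 0 else complex_of_real (dyadic_sum \<psi> (\<beta> j) (S - {m}) (\<eta> j) x))" for j x
  have F_eq: "F (\<lambda>j. flip S m (s j) (\<eta> j)) = (\<lambda>j x. G \<eta> j x + of_real (s j) * b j x)" for s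
    by (intro ext) (simp add: F_def G_def b_def dyadic_sum_flip[OF S])
  have fin: "finite (Pi\<^sub>E UNIV A)" by (intro finite_PiE) (auto simp: A_def)
  have ne: "Pi\<^sub>E UNIV A \<noteq> {}" by (auto simp: PiE_eq_empty_iff A_def)
  have card: "card (Pi\<^sub>E UNIV A) = (\<Prod>j\<in>UNIV. card (A j))" by (rule card_PiE) simp
  have dm: "dyadic_sum \<psi> \<beta>' S' \<eta>' \<in> borel_measurable borel" for \<beta>' S' \<eta>'
    unfolding dyadic_sum_def[abs_def] by measurable
  obtain Bb where Bb: "\<And>j x. norm (b j x) \<le> Bb j"
  proof -
    have "\<exists>B'. \<forall>x. norm (b j x) \<le> B'" for j
      using dyadic_sum_bounded[of \<psi> B "\<beta> j" "S - {m}" "\<eta> j", OF \<psi>(2)] by (cases "j \<in> J") (auto simp: b_def)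
    then show ?thesis using that by metis
  qed
  have sum_s: "(\<Sum>s\<in>Pi\<^sub>E UNIV A. tensor_conv \<phi> (F (\<lambda>j. flip S m (s j) (\<eta> j))) (X y))
     = of_nat (\<Prod>j\<in>UNIV. card (A j)) * tensor_conv \<phi> (G \<eta>) (X y)" for y
    unfolding F_eq
  proof (rule tensor_conv_sum_signs[OF \<phi>])
    show "G \<eta> j \<in> borel_measurable borel" for j
      unfolding G_def by (cases "j \<in> J") simp_all
    show "b j \<in> borel_measurable borel" for j
      unfolding b_def using dm by (cases "j \<in> J") simp_all
    show "norm (G \<eta> j x) \<le> (if j \<in> J then B else \<bar>\<eta> j m\<bar> * 2 powr (- (real m * \<beta> j)) * B)" for j x
      unfolding G_def using \<psi>(2) by (auto simp: norm_mult intro!: mult_left_mono)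
    show "norm (b j x) \<le> Bb j" for j x by (rule Bb)
    show "finite (A j)" for j by (simp add: A_def)
    show "(\<Sum>s\<in>A j. of_real s * b j x) = 0" for j x by (simp add: A_def b_def)
  qed
  have "(\<Sum>q\<in>{1, - 1} \<times> Pi\<^sub>E UNIV A. \<Sum>y\<in>Y. of_real (flip Y y0 (fst q) \<epsilon> y) * (c y * tensor_conv \<phi> (F (\<lambda>j. flip S m (snd q j) (\<eta> j))) (X y)))
     = (\<Sum>s0\<in>{1, - 1}. \<Sum>s\<in>Pi\<^sub>E UNIV A. \<Sum>y\<in>Y. of_real (flip Y y0 s0 \<epsilon> y) * (c y * tensor_conv \<phi> (F (\<lambda>j. flip S m (s j) (\<eta> j))) (X y)))"
    by (simp only: sum.cartesian_product' fst_conv snd_conv)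
  also have "\<dots> = (\<Sum>s0\<in>{1, - 1}. \<Sum>y\<in>Y. of_real (flip Y y0 s0 \<epsilon> y) * (c y * (\<Sum>s\<in>Pi\<^sub>E UNIV A. tensor_conv \<phi> (F (\<lambda>j. flip S m (s j) (\<eta> j))) (X y))))"
    by (subst sum.swap) (simp add: sum_distrib_left)
  also have "\<dots> = (\<Sum>s0\<in>{1, - 1}. of_nat (\<Prod>j\<in>UNIV. card (A j)) * (\<Sum>y\<in>Y. of_real (flip Y y0 s0 \<epsilon> y) * (c y * tensor_conv \<phi> (G \<eta>) (X y))))"
    by (simp only: sum_s sum_distrib_left ac_simps)
  also have "\<dots> = of_nat (2 * (\<Prod>j\<in>UNIV. card (A j))) * (of_real (\<epsilon> y0) * (c y0 * tensor_conv \<phi> (G \<eta>) (X y0)))"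
    unfolding sum_flip[OF Y] by (simp add: distrib_left)
  also have "2 * (\<Prod>j\<in>UNIV. card (A j)) = card ({1, - 1 :: real} \<times> Pi\<^sub>E UNIV A)"
    by (simp add: card_cartesian_product card)
  finally have "norm (of_real (\<epsilon> y0) * (c y0 * tensor_conv \<phi> (G \<eta>) (X y0))) powr p
    \<le> (\<Sum>q\<in>{1, - 1} \<times> Pi\<^sub>E UNIV A. norm (\<Sum>y\<in>Y. of_real (flip Y y0 (fst q) \<epsilon> y) * (c y * tensor_conv \<phi> (F (\<lambda>j. flip S m (snd q j) (\<eta> j))) (X y))) powr p)"
    using fin ne by (intro norm_average_powr_le p) auto
  then show ?thesis by (simp add: split_beta')
qed


lemma recip_nonneg: "0 < q \<Longrightarrow> 0 \<le> recip q"
  by (cases q) (auto simp: recip_def)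

text \<open>Flips are involutions of the set of sign patterns, so the total over all patterns does
  not notice them. This allows a flip that depends on \<open>y\<close> and \<open>m\<close> although
  the total does not.\<close>

lemma sum_sign_reindex:
  fixes Y :: "'y set" and S :: "'m set"
    and V :: "('y \<Rightarrow> real) \<Rightarrow> ('n \<Rightarrow> 'm \<Rightarrow> real) \<Rightarrow> 'b::comm_monoid_add"
  assumes q: "s0 \<in> {1, - 1}" "\<And>j. s j \<in> {1, - 1 :: real}"
  defines "\<Omega> \<equiv> sign_functions Y \<times> {\<eta>. \<forall>k. \<eta> k \<in> sign_functions S}"
  shows "(\<Sum>(\<epsilon>, \<eta>)\<in>\<Omega>. V (flip Y y0 s0 \<epsilon>) (\<lambda>j. flip S m (s j) (\<eta> j))) = (\<Sum>(\<epsilon>, \<eta>)\<in>\<Omega>. V \<epsilon> \<eta>)"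
proof -
  define T where "T = (\<lambda>(\<epsilon>, \<eta>). (flip Y y0 s0 \<epsilon>, \<lambda>j. flip S m (s j) (\<eta> j)))"
  have inv: "T (T w) = w" for w
    unfolding T_def by (simp add: split_beta flip_flip[OF q(1)] flip_flip[OF q(2)])
  have closed: "T w \<in> \<Omega>" if "w \<in> \<Omega>" for w
    using that unfolding T_def \<Omega>_def by (auto intro: flip_sign_functions[OF q(1)] flip_sign_functions[OF q(2)])
  show ?thesis
    by (rule sum.reindex_bij_witness[of _ T T]) (use inv closed in \<open>auto simp: T_def\<close>)
qed

text \<open>On the shell of radius \<open>2 ^ m\<close> the \<open>m\<close>-th summands of the wide inputs have size
  \<open>2 powr (- m d / p k)\<close>, so all \<open>K\<close> shells contribute equally to the \<open>L\<^sup>p\<close> norm. The constants \<open>h\<close> and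
  \<open>u\<close> are shifts at which the limiting convolution does not vanish.\<close>

lemma estimate_fails_block:
  fixes \<phi> :: "real^'d::finite^'n::finite \<Rightarrow> complex"
  assumes phi: "admissible_phi \<phi>" and s: "\<And>j. 0 < s j" and p: "p > 0"
    and pos: "\<And>j. 0 < pj j" and holder: "(\<Sum>j\<in>UNIV. recip (pj j)) = 1 / p"
    and est: "multiplier_estimate \<phi> s pj p C"
    and J: "J \<noteq> {}" and cond: "(\<Sum>j\<in>J. s j) \<le> real CARD('d) * (\<Sum>j\<in>J. recip (pj j)) - real CARD('d) / 2"
  shows False
proof -
  define d where "d = real CARD('d)"
  have d: "d > 0" by (simp add: d_def)
  obtain M where M: "odd M" "\<And>j. pj j \<noteq> \<infinity> \<Longrightarrow> 2 * d \<le> real (CARD('d) + M) * real_of_ereal (pj j)"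
    using exists_odd_moment_order[of pj "CARD('d)", OF pos] unfolding d_def by blast
  obtain v a :: "real^'d" where va: "v \<bullet> a = 1/4" "fourier \<phi> (block_vec J a) \<noteq> 0"
    using fourier_phi_nonzero_on_diagonal[OF phi J] by blast
  define \<psi> where "\<psi> = diff_gauss v M"
  obtain u where u: "u \<noteq> 0" "\<psi> u \<noteq> 0"
    unfolding \<psi>_def using diff_gauss_nonzero[OF va(1) M(1)] by blast
  obtain h where h: "(\<integral>z. \<phi> z * complex_of_real (\<Prod>j\<in>J. \<psi> (h $ j - z $ j)) \<partial>lborel) \<noteq> 0"
    unfolding \<psi>_def using dilated_conv_nonzero[OF phi va] by blast
  have \<psi>_cont: "continuous_on UNIV \<psi>" unfolding \<psi>_def by (rule continuous_diff_gauss)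
  have [measurable]: "\<psi> \<in> borel_measurable borel" unfolding \<psi>_def by measurable
  note \<phi> = phi_integrable[OF phi]
  have \<phi>_meas[measurable]: "\<phi> \<in> borel_measurable borel" using borel_measurable_integrable[OF \<phi>] by simp
  obtain Bg where Bg: "\<And>x. \<bar>\<psi> x\<bar> \<le> Bg" unfolding \<psi>_def using diff_gauss_bounded by blast
  define \<beta> where "\<beta> j = d * recip (pj j)" for j
  have \<beta>0: "\<beta> j \<ge> 0" for j using recip_nonneg[OF pos[of j]] d by (simp add: \<beta>_def)
  define a1 where "a1 = (\<Sum>j\<in>J. recip (pj j))"
  define b1 where "b1 = (\<Sum>j\<in>UNIV. if j \<in> J then 0 else recip (pj j))"
  have ab: "1 / p = a1 + b1"
  proof -
    have "(\<Sum>j\<in>J. recip (pj j)) = (\<Sum>j\<in>UNIV. if j \<in> J then recip (pj j) else 0)" by (simp add: sum.If_cases)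
    then show ?thesis unfolding a1_def b1_def holder[symmetric] by (simp add: sum.distrib[symmetric]) (rule sum.cong, auto)
  qed
  have b1: "b1 \<ge> 0" unfolding b1_def using recip_nonneg[OF pos] by (intro sum_nonneg) auto
  \<comment> \<open>Positivity of the \<open>s j\<close> turns the weak inequality of the hypothesis
    into the strict \<open>a1 > 1/2\<close>.\<close>
  have "(\<Sum>j\<in>J. s j) > 0" using s J by (intro sum_pos) auto
  then have "d * (1/2) < d * a1" using cond unfolding d_def a1_def by linarith
  then have a1: "a1 > 1/2" using d by simp
  define \<alpha> where "\<alpha> = d * a1"
  define b2 where "b2 = d * b1"
  have b2_eq: "b2 = (\<Sum>j\<in>UNIV. if j \<in> J then 0 else \<beta> j)"
    unfolding b2_def b1_def sum_distrib_left by (rule sum.cong) (auto simp: \<beta>_def)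
  have "d / p = d * (a1 + b1)" unfolding ab[symmetric] by simp
  then have ab': "- \<alpha> + - b2 = - (d / p)" by (simp add: \<alpha>_def b2_def distrib_left)
  have b20: "b2 \<ge> 0" using b1 d by (simp add: b2_def)
  \<comment> \<open>The limiting configuration: inputs in \<open>J\<close> stay at unit scale near
    \<open>h\<close>, the wide inputs are frozen at \<open>u\<close>.\<close>
  define X0 where "X0 = (\<chi> j. if j \<in> J then h $ j else u)"
  define \<tau>0 where "\<tau>0 = ((\<chi> j. if j \<in> J then 1 else 0) :: real^'n)"
  define g where "g = (\<lambda>j::'n. \<psi>)"
  define K0 where "K0 = dilated_conv \<phi> g X0 \<tau>0"
  have K0: "K0 \<noteq> 0"
  proof -
    have "(\<Prod>j\<in>UNIV. g j (X0 $ j - \<tau>0 $ j *\<^sub>R z $ j)) = \<psi> u ^ card (- J) * (\<Prod>j\<in>J. \<psi> (h $ j - z $ j))" for z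
    proof -
      have "(\<Prod>j\<in>UNIV. g j (X0 $ j - \<tau>0 $ j *\<^sub>R z $ j)) = (\<Prod>j\<in>J. g j (X0 $ j - \<tau>0 $ j *\<^sub>R z $ j)) * (\<Prod>j\<in>-J. g j (X0 $ j - \<tau>0 $ j *\<^sub>R z $ j))"
        by (subst prod.union_disjoint[symmetric]) (auto intro!: prod.cong)
      then show ?thesis by (simp add: g_def X0_def \<tau>0_def)
    qed
    then have "\<phi> z * complex_of_real (\<Prod>j\<in>UNIV. g j (X0 $ j - \<tau>0 $ j *\<^sub>R z $ j))
       = complex_of_real (\<psi> u ^ card (- J)) * (\<phi> z * complex_of_real (\<Prod>j\<in>J. \<psi> (h $ j - z $ j)))" for z
      by (simp only: of_real_mult ac_simps)
    then have "K0 = complex_of_real (\<psi> u ^ card (- J)) * (\<integral>z. \<phi> z * complex_of_real (\<Prod>j\<in>J. \<psi> (h $ j - z $ j)) \<partial>lborel)"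
      unfolding K0_def dilated_conv_def by (simp only: integral_mult_right_zero)
    then show ?thesis using h u(2) by simp
  qed
  obtain r where r: "r > 0" "\<And>X \<tau>. (\<And>j. norm (X $ j - X0 $ j) \<le> r) \<Longrightarrow> (\<And>j. \<bar>\<tau> $ j - \<tau>0 $ j\<bar> \<le> r) \<Longrightarrow>
     norm (dilated_conv \<phi> g X \<tau> - K0) \<le> norm K0 / 2"
  proof -
    have "\<exists>r>0. \<forall>X \<tau>. (\<forall>j. norm (X $ j - X0 $ j) \<le> r) \<longrightarrow> (\<forall>j. \<bar>\<tau> $ j - \<tau>0 $ j\<bar> \<le> r) \<longrightarrow>
       norm (dilated_conv \<phi> g X \<tau> - dilated_conv \<phi> g X0 \<tau>0) \<le> norm K0 / 2"
      by (rule dilated_conv_near[OF \<phi>, of g "\<lambda>_. Bg"]) (use \<psi>_cont Bg K0 in \<open>auto simp: g_def\<close>)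
    then show ?thesis using that unfolding K0_def by metis
  qed
  \<comment> \<open>The shells are centred at multiples of \<open>-u\<close>, since \<open>x\<close>
    will be close to \<open>-y\<close> and \<open>x / 2 ^ m\<close> is to be close to
    \<open>u\<close>. The bound \<open>r / 2\<close> secures the latter, \<open>norm u / 4\<close>
    the disjointness of the shells.\<close>
  define \<rho> where "\<rho> = min (r / 2) (norm u / 4)"
  have \<rho>: "0 < \<rho>" "\<rho> \<le> norm (- u) / 4" "\<rho> \<le> r / 2" using r(1) u(1) by (auto simp: \<rho>_def)
  \<comment> \<open>The bound 1/4 makes the balls about different points \<open>-y\<close> disjoint,
    lattice points being at distance at least 1.\<close>
  define r0 where "r0 = min (r / 2) (1 / 4)"
  have r0: "0 < r0" "r0 \<le> r / 2" "r0 \<le> 1 / 4" using r(1) by (auto simp: r0_def)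
  obtain c1 m1 where c1: "c1 > 0" "\<And>m0 K. m0 \<ge> m1 \<Longrightarrow> c1 * real K \<le> (\<Sum>y\<in>(\<Union>m\<in>{m0..<m0+K}. lattice_shell (- u) \<rho> m). (1 + norm y) powr (- d))"
    using sum_lattice_shells[of "- u" \<rho>] u(1) \<rho> unfolding d_def by auto
  obtain m2 where m2: "(1/2) ^ m2 < r" using real_arch_pow_inv[of r "1/2"] r(1) by auto
  \<comment> \<open>From \<open>m0\<close> on, the ratio \<open>(1/2) ^ m\<close> of a wide input is
    within \<open>r\<close> of its limit 0.\<close>
  define m0 where "m0 = max m1 m2"
  have m0_small: "(1/2) ^ m \<le> r" if "m \<ge> m0" for m
    by (rule order_trans[OF power_decreasing less_imp_le[OF m2]]) (use that in \<open>auto simp: m0_def\<close>)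
  have "\<exists>B>0. hardy_norm (pj j) (\<lambda>x. complex_of_real (\<psi> (x + h $ j))) \<le> ennreal B" for j
    unfolding \<psi>_def by (rule hardy_norm_diff_gauss_shift[OF pos]) (use M(2)[of j] in \<open>simp add: d_def\<close>)
  then obtain B1 where B1: "\<And>j. B1 j > 0" "\<And>j. hardy_norm (pj j) (\<lambda>x. complex_of_real (\<psi> (x + h $ j))) \<le> ennreal (B1 j)"
    by metis
  have "\<exists>B>0. \<forall>S \<eta>. finite S \<longrightarrow> S \<noteq> {} \<longrightarrow> (\<forall>m. \<bar>\<eta> m\<bar> \<le> 1) \<longrightarrow>
     hardy_norm (pj j) (\<lambda>x. complex_of_real (dyadic_sum \<psi> (\<beta> j) S \<eta> x)) \<le> ennreal (B * real (card S) powr recip (pj j))" for j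
    using hardy_norm_dyadic_sum_cart[of "pj j" M v] pos[of j] M unfolding d_def \<beta>_def \<psi>_def by metis
  then obtain B2 where B2: "\<And>j. B2 j > 0" "\<And>j S \<eta>. finite S \<Longrightarrow> S \<noteq> {} \<Longrightarrow> (\<And>m. \<bar>\<eta> m\<bar> \<le> 1) \<Longrightarrow>
     hardy_norm (pj j) (\<lambda>x. complex_of_real (dyadic_sum \<psi> (\<beta> j) S \<eta> x)) \<le> ennreal (B2 j * real (card S) powr recip (pj j))"
    by metis
  obtain C0 where C0: "C0 > 0" and trig: "\<And>Y c f B Q. finite Y \<Longrightarrow> Y \<subseteq> int_lattice \<Longrightarrow> (\<And>j. schwartz (f j)) \<Longrightarrow>
     (\<And>j. 0 \<le> B j \<and> hardy_norm (pj j) (f j) \<le> ennreal (B j)) \<Longrightarrow>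
     (\<Sum>y\<in>Y. (norm (c y))\<^sup>2 * (1 + norm y) powr (2 * (\<Sum>j\<in>J. s j))) \<le> Q \<Longrightarrow>
     (\<integral>\<^sup>+x. ennreal (norm (\<Sum>y\<in>Y. c y * tensor_conv \<phi> f (\<chi> j. if j \<in> J then x + y else x)) powr p) \<partial>lborel)
       \<le> ennreal ((C0 * sqrt Q * (\<Prod>j\<in>UNIV. B j)) powr p)"
    using multiplier_estimate_trig_symbol[OF phi, of s J p pj C, OF s J p est] by blast
  define P where "P = (\<Prod>j\<in>UNIV. if j \<in> J then B1 j else B2 j)"
  have P: "P > 0" unfolding P_def using B1 B2 by (intro prod_pos) auto
  \<comment> \<open>On shell \<open>m\<close> the scale \<open>2 ^ m\<close> is at most
    \<open>H * (1 + norm y)\<close>; this converts the size of the wide inputs into a power of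
    \<open>1 + norm y\<close>.\<close>
  define H where "H = 1 + 2 / norm u"
  have H: "H > 0" by (simp add: H_def add_pos_nonneg)
  define \<kappa> where "\<kappa> = norm K0 / 2 * H powr (- b2)"
  have \<kappa>: "\<kappa> > 0" using K0 H by (simp add: \<kappa>_def)
  define A where "A = (\<lambda>j. if j \<in> J then {1} else {1, - 1 :: real})"
  \<comment> \<open>One flip for the lattice sum and one for each wide input; the cardinality does
    not involve \<open>K\<close>.\<close>
  define Fl where "Fl = {1, - 1 :: real} \<times> Pi\<^sub>E UNIV A"
  define vol where "vol = unit_ball_vol d * r0 ^ CARD('d)"
  have vol: "vol > 0" using unit_ball_vol_pos[of d] r0(1) d by (simp add: vol_def)
  define C1 where "C1 = real (card Fl) * (C0 * P) powr p / (\<kappa> powr p * vol)"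
  have C1: "C1 \<ge> 0" using vol by (simp add: C1_def)
  show False
  proof (rule growth_contradiction[OF p ab a1 b1 c1(1) C1])
    fix K :: nat assume K: "K \<ge> 1"
    define S where "S = {m0..<m0+K}"
    have S: "finite S" "S \<noteq> {}" "card S = K" using K by (auto simp: S_def)
    define Y where "Y = (\<Union>m\<in>S. lattice_shell (- u) \<rho> m)"
    have Y: "finite Y" "Y \<subseteq> int_lattice"
      unfolding Y_def using finite_lattice_shell S(1) by (auto, auto simp: lattice_shell_def)
    define \<Lambda> where "\<Lambda> = (\<Sum>y\<in>Y. (1 + norm y) powr (- d))"
    have \<Lambda>0: "\<Lambda> \<ge> 0" unfolding \<Lambda>_def by (intro sum_nonneg) auto
    define c where "c y = complex_of_real ((1 + norm y) powr (- \<alpha>))" for y :: "real^'d"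
    define X where "X x y = ((\<chi> j. if j \<in> J then x + y else x) :: real^'d^'n)" for x y
    define F where "F = (\<lambda>\<eta> j x. if j \<in> J then complex_of_real (\<psi> (x + h $ j)) else complex_of_real (dyadic_sum \<psi> (\<beta> j) S (\<eta> j) x))"
    define G where "G = (\<lambda>m \<eta> j x. if j \<in> J then complex_of_real (\<psi> (x + h $ j))
        else complex_of_real (\<eta> j m * 2 powr (- (real m * \<beta> j)) * \<psi> ((1/2) ^ m *\<^sub>R x)))"
    define T where "T \<epsilon> \<eta> x = (\<Sum>y\<in>Y. of_real (\<epsilon> y) * (c y * tensor_conv \<phi> (F \<eta>) (X x y)))" for \<epsilon> \<eta> x
    define \<Omega> where "\<Omega> = sign_functions Y \<times> {\<eta> :: 'n \<Rightarrow> nat \<Rightarrow> real. \<forall>k. \<eta> k \<in> sign_functions S}"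
    have fin\<Omega>: "finite \<Omega>"
    proof -
      have "finite {\<eta> :: 'n \<Rightarrow> nat \<Rightarrow> real. \<forall>k. (k \<in> UNIV \<longrightarrow> \<eta> k \<in> sign_functions S) \<and> (k \<notin> UNIV \<longrightarrow> \<eta> k = undefined)}"
        by (rule finite_set_of_finite_funs) (use finite_sign_functions[OF S(1)] in auto)
      then show ?thesis unfolding \<Omega>_def using finite_sign_functions[OF Y(1)] by (intro finite_cartesian_product) simp_all
    qed
    have ne\<Omega>: "card \<Omega> > 0"
    proof -
      have "((\<lambda>_. 1), (\<lambda>_ _. 1)) \<in> \<Omega>" unfolding \<Omega>_def by (simp add: sign_functions_one)
      then show ?thesis using fin\<Omega> card_gt_0_iff by blast
    qed
    define U where "U = C0 * P * (sqrt \<Lambda> * real K powr b1)"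
    have upper: "(\<integral>\<^sup>+x. ennreal (norm (T \<epsilon> \<eta> x) powr p) \<partial>lborel) \<le> ennreal (U powr p)"
      if \<omega>: "(\<epsilon>, \<eta>) \<in> \<Omega>" for \<epsilon> \<eta>
    proof -
      have abs: "\<bar>\<epsilon> y\<bar> = 1" "\<bar>\<eta> k m\<bar> = 1" for y k m
        using \<omega> by (auto simp: \<Omega>_def intro: sign_functions_abs)
      define B where "B j = (if j \<in> J then B1 j else B2 j * real K powr recip (pj j))" for j
      have prodB: "(\<Prod>j\<in>UNIV. B j) = P * real K powr b1"
      proof -
        have "B j = (if j \<in> J then B1 j else B2 j) * real K powr (if j \<in> J then 0 else recip (pj j))" for j
          using K by (simp add: B_def)
        then show ?thesis using K by (simp add: prod.distrib P_def powr_sum b1_def)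
      qed
      have "(\<integral>\<^sup>+x. ennreal (norm (\<Sum>y\<in>Y. (of_real (\<epsilon> y) * c y) * tensor_conv \<phi> (F \<eta>) (\<chi> j. if j \<in> J then x + y else x)) powr p) \<partial>lborel)
         \<le> ennreal ((C0 * sqrt \<Lambda> * (\<Prod>j\<in>UNIV. B j)) powr p)"
      proof (rule trig[OF Y])
        show "schwartz (F \<eta> j)" for j
          unfolding F_def \<psi>_def
          by (cases "j \<in> J") (simp_all only: if_True if_False schwartz_diff_gauss_shift schwartz_dyadic_sum)
        show "0 \<le> B j \<and> hardy_norm (pj j) (F \<eta> j) \<le> ennreal (B j)" for j
        proof (cases "j \<in> J")
          case True
          then show ?thesis using B1[of j] by (simp add: B_def F_def less_imp_le)
        next
          case False
          have "hardy_norm (pj j) (\<lambda>x. complex_of_real (dyadic_sum \<psi> (\<beta> j) S (\<eta> j) x)) \<le> ennreal (B2 j * real (card S) powr recip (pj j))"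
            by (rule B2(2)[OF S(1,2)]) (simp add: abs)
          then show ?thesis using False B2(1)[of j] by (simp add: B_def F_def S(3))
        qed
        show "(\<Sum>y\<in>Y. (norm (of_real (\<epsilon> y) * c y))\<^sup>2 * (1 + norm y) powr (2 * (\<Sum>j\<in>J. s j))) \<le> \<Lambda>"
          unfolding \<Lambda>_def
        proof (rule sum_mono)
          fix y assume "y \<in> Y"
          have "(norm (of_real (\<epsilon> y) * c y))\<^sup>2 * (1 + norm y) powr (2 * (\<Sum>j\<in>J. s j)) = (1 + norm y) powr (- \<alpha> + - \<alpha> + 2 * (\<Sum>j\<in>J. s j))"
            by (simp only: powr_add) (simp add: c_def norm_mult abs power2_eq_square)
          \<comment> \<open>The hypothesis on \<open>J\<close> enters here: it says
            \<open>2 * \<alpha>\<close> exceeds twice the sum of the \<open>s j\<close> by at least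
            \<open>d\<close>.\<close>
          also have "\<dots> \<le> (1 + norm y) powr (- d)"
            using cond by (intro powr_mono) (auto simp: \<alpha>_def a1_def d_def)
          finally show "(norm (of_real (\<epsilon> y) * c y))\<^sup>2 * (1 + norm y) powr (2 * (\<Sum>j\<in>J. s j)) \<le> (1 + norm y) powr (- d)" .
        qed
      qed
      then show ?thesis unfolding T_def X_def U_def prodB by (simp add: mult.assoc mult.left_commute)
    qed
    \<comment> \<open>For \<open>x\<close> near \<open>-y\<close> the inputs in \<open>J\<close> are
      evaluated near \<open>h\<close> and the wide ones near \<open>u\<close> after rescaling. The
      exponents \<open>\<alpha>\<close> of the coefficient and \<open>b2\<close> of the wide inputs
      add up to \<open>d / p\<close>.\<close>
    have target: "\<kappa> * (1 + norm y) powr (- (d / p)) \<le> norm (of_real (\<epsilon> y) * (c y * tensor_conv \<phi> (G m \<eta>) (X x y)))"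
      if \<omega>: "(\<epsilon>, \<eta>) \<in> \<Omega>" and m: "m \<in> S" and y: "y \<in> lattice_shell (- u) \<rho> m" and x: "norm (x + y) \<le> r0" for \<epsilon> \<eta> m y x
    proof -
      have abs: "\<bar>\<epsilon> y\<bar> = 1" "\<bar>\<eta> k m\<bar> = 1" for k
        using \<omega> by (auto simp: \<Omega>_def intro: sign_functions_abs)
      have yu: "norm (y + 2 ^ m *\<^sub>R u) \<le> 2 ^ m * \<rho>" using y by (simp add: lattice_shell_def)
      define X1 where "X1 = ((\<chi> j. if j \<in> J then x + y + h $ j else (1/2) ^ m *\<^sub>R x) :: real^'d^'n)"
      define \<tau>1 where "\<tau>1 = ((\<chi> j. if j \<in> J then 1 else (1/2) ^ m) :: real^'n)"
      define coef where "coef j = (if j \<in> J then 1 else \<eta> j m * 2 powr (- (real m * \<beta> j)))" for j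
      have G_eq: "G m \<eta> j (X x y $ j - z $ j) = complex_of_real (coef j * g j (X1 $ j - \<tau>1 $ j *\<^sub>R z $ j))" for j z
        by (auto simp: G_def X_def X1_def \<tau>1_def coef_def g_def algebra_simps)
      have "tensor_conv \<phi> (G m \<eta>) (X x y) = complex_of_real (\<Prod>j\<in>UNIV. coef j) * dilated_conv \<phi> g X1 \<tau>1"
      proof -
        have "\<phi> z * (\<Prod>j\<in>UNIV. G m \<eta> j (X x y $ j - z $ j))
           = complex_of_real (\<Prod>j\<in>UNIV. coef j) * (\<phi> z * complex_of_real (\<Prod>j\<in>UNIV. g j (X1 $ j - \<tau>1 $ j *\<^sub>R z $ j)))" for z
          by (simp add: G_eq prod.distrib ac_simps)
        then show ?thesis unfolding tensor_conv_def dilated_conv_def by (simp only: integral_mult_right_zero)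
      qed
      then have eq: "norm (of_real (\<epsilon> y) * (c y * tensor_conv \<phi> (G m \<eta>) (X x y)))
         = (1 + norm y) powr (- \<alpha>) * (\<bar>\<Prod>j\<in>UNIV. coef j\<bar> * norm (dilated_conv \<phi> g X1 \<tau>1))"
        by (simp add: norm_mult abs c_def del: of_real_prod)
      have "\<bar>\<Prod>j\<in>UNIV. coef j\<bar> = (\<Prod>j\<in>UNIV. 2 powr (- (real m * (if j \<in> J then 0 else \<beta> j))))"
        unfolding abs_prod by (rule prod.cong) (auto simp: coef_def abs_mult abs)
      also have "\<dots> = 2 powr (- (real m * b2))"
        unfolding b2_eq by (simp add: powr_sum[symmetric] sum_negf sum_distrib_left)
      also have "\<dots> = (2 ^ m) powr (- b2)" by (simp add: powr_realpow[symmetric] powr_powr)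
      also have "\<dots> \<ge> (H * (1 + norm y)) powr (- b2)"
      proof (rule powr_mono2')
        have "2 ^ m * norm u \<le> norm (y + 2 ^ m *\<^sub>R u) + norm y"
          using norm_triangle_ineq4[of "y + 2 ^ m *\<^sub>R u" y] by simp
        also have "\<dots> \<le> 2 ^ m * (norm u / 4) + norm y"
          using yu \<rho>(2) by (intro add_right_mono order_trans[OF yu] mult_left_mono) auto
        also have "2 ^ m * (norm u / 4) = (2 ^ m * norm u) / 4" by simp
        finally have "2 ^ m * norm u \<le> 2 * norm y" using norm_ge_zero[of y] by linarith
        then have "2 ^ m \<le> 2 * norm y / norm u" using u(1) by (simp add: pos_le_divide_eq)
        also have "\<dots> = (2 / norm u) * norm y" by simp
        also have "\<dots> \<le> H * (1 + norm y)"
          unfolding H_def by (intro mult_mono) auto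
        finally show "2 ^ m \<le> H * (1 + norm y)" .
      qed (use b20 in auto)
      finally have coef_ge: "H powr (- b2) * (1 + norm y) powr (- b2) \<le> \<bar>\<Prod>j\<in>UNIV. coef j\<bar>"
        by (simp only: powr_mult)
      have "norm (dilated_conv \<phi> g X1 \<tau>1 - K0) \<le> norm K0 / 2"
      proof (rule r(2))
        fix j
        show "norm (X1 $ j - X0 $ j) \<le> r"
        proof (cases "j \<in> J")
          case True
          then show ?thesis using x r0 r(1) by (simp add: X1_def X0_def)
        next
          case False
          have "(1/2) ^ m *\<^sub>R x - u = (1/2) ^ m *\<^sub>R (x + y) - (1/2) ^ m *\<^sub>R (y + 2 ^ m *\<^sub>R u)"
            by (simp add: algebra_simps power_mult_distrib[symmetric])
          then have "norm ((1/2) ^ m *\<^sub>R x - u) \<le> (1/2) ^ m * norm (x + y) + (1/2) ^ m * norm (y + 2 ^ m *\<^sub>R u)"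
            by (metis norm_triangle_ineq4 norm_scaleR abs_of_nonneg zero_le_power zero_le_divide_1_iff zero_le_numeral)
          also have "\<dots> \<le> 1 * r0 + (1/2) ^ m * (2 ^ m * \<rho>)"
            using x yu by (intro add_mono mult_mono) (auto simp: power_le_one)
          also have "\<dots> \<le> r" using r0(2) \<rho>(3) by (simp add: power_one_over)
          finally show ?thesis using False by (simp add: X1_def X0_def)
        qed
        show "\<bar>\<tau>1 $ j - \<tau>0 $ j\<bar> \<le> r"
          using m0_small[of m] m r(1) by (simp add: \<tau>1_def \<tau>0_def S_def)
      qed
      then have K_ge: "norm K0 / 2 \<le> norm (dilated_conv \<phi> g X1 \<tau>1)"
        using norm_triangle_ineq3[of "dilated_conv \<phi> g X1 \<tau>1" K0] by linarith
      have "\<kappa> * (1 + norm y) powr (- (d / p)) = (1 + norm y) powr (- \<alpha>) * ((H powr (- b2) * (1 + norm y) powr (- b2)) * (norm K0 / 2))"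
        unfolding ab'[symmetric] powr_add \<kappa>_def by (simp only: ac_simps)
      also have "\<dots> \<le> (1 + norm y) powr (- \<alpha>) * (\<bar>\<Prod>j\<in>UNIV. coef j\<bar> * norm (dilated_conv \<phi> g X1 \<tau>1))"
        using coef_ge K_ge by (intro mult_left_mono mult_mono) auto
      finally show ?thesis unfolding eq .
    qed
    define L where "L y = (\<kappa> * (1 + norm y) powr (- (d / p))) powr p" for y :: "real^'d"
    have L_eq: "L y = \<kappa> powr p * (1 + norm y) powr (- d)" for y
      using p by (simp add: L_def powr_mult powr_powr)
    \<comment> \<open>The bound for one pattern is summed over all patterns and the order exchanged;
      each flip then contributes the same total, whence the factor \<open>card Fl\<close>.\<close>
    have point: "real (card \<Omega>) * L y \<le> real (card Fl) * (\<Sum>(\<epsilon>, \<eta>)\<in>\<Omega>. norm (T \<epsilon> \<eta> x) powr p)"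
      if y: "y \<in> Y" and x: "norm (x + y) \<le> r0" for y x
    proof -
      obtain m where m: "m \<in> S" "y \<in> lattice_shell (- u) \<rho> m" using y by (auto simp: Y_def)
      have one: "L y \<le> (\<Sum>(s0, t)\<in>Fl. norm (T (flip Y y s0 \<epsilon>) (\<lambda>j. flip S m (t j) (\<eta> j)) x) powr p)"
        if \<omega>: "(\<epsilon>, \<eta>) \<in> \<Omega>" for \<epsilon> \<eta>
      proof -
        have "L y \<le> norm (of_real (\<epsilon> y) * (c y * tensor_conv \<phi> (G m \<eta>) (X x y))) powr p"
          unfolding L_def using target[OF \<omega> m x] p \<kappa> by (intro powr_mono2) auto
        also have "\<dots> \<le> (\<Sum>(s0, t)\<in>Fl. norm (T (flip Y y s0 \<epsilon>) (\<lambda>j. flip S m (t j) (\<eta> j)) x) powr p)"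
          unfolding T_def F_def G_def Fl_def A_def
          by (rule flipped_average[OF \<phi> \<psi>_cont Bg Y(1) y S(1) m(1) p])
        finally show ?thesis .
      qed
      have "real (card \<Omega>) * L y = (\<Sum>w\<in>\<Omega>. L y)" by simp
      also have "\<dots> \<le> (\<Sum>w\<in>\<Omega>. \<Sum>q\<in>Fl. norm (T (flip Y y (fst q) (fst w)) (\<lambda>j. flip S m (snd q j) (snd w j)) x) powr p)"
        using one by (intro sum_mono) (auto simp: split_beta)
      also have "\<dots> = (\<Sum>q\<in>Fl. \<Sum>w\<in>\<Omega>. norm (T (flip Y y (fst q) (fst w)) (\<lambda>j. flip S m (snd q j) (snd w j)) x) powr p)"
        by (rule sum.swap)
      also have "\<dots> = (\<Sum>q\<in>Fl. \<Sum>(\<epsilon>, \<eta>)\<in>\<Omega>. norm (T \<epsilon> \<eta> x) powr p)"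
      proof (rule sum.cong[OF refl])
        fix q assume q: "q \<in> Fl"
        have "fst q \<in> {1, - 1}" using q by (auto simp: Fl_def)
        moreover have "snd q j \<in> {1, - 1}" for j
        proof -
          have "snd q j \<in> A j" using q by (auto simp: Fl_def PiE_def Pi_def)
          then show ?thesis by (auto simp: A_def split: if_splits)
        qed
        ultimately have "(\<Sum>(\<epsilon>, \<eta>)\<in>\<Omega>. norm (T (flip Y y (fst q) \<epsilon>) (\<lambda>j. flip S m (snd q j) (\<eta> j)) x) powr p) = (\<Sum>(\<epsilon>, \<eta>)\<in>\<Omega>. norm (T \<epsilon> \<eta> x) powr p)"
          unfolding \<Omega>_def by (rule sum_sign_reindex[where V="\<lambda>\<epsilon> \<eta>. norm (T \<epsilon> \<eta> x) powr p"])
        then show "(\<Sum>w\<in>\<Omega>. norm (T (flip Y y (fst q) (fst w)) (\<lambda>j. flip S m (snd q j) (snd w j)) x) powr p) = (\<Sum>(\<epsilon>, \<eta>)\<in>\<Omega>. norm (T \<epsilon> \<eta> x) powr p)"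
          by (simp only: case_prod_unfold)
      qed
      also have "\<dots> = real (card Fl) * (\<Sum>(\<epsilon>, \<eta>)\<in>\<Omega>. norm (T \<epsilon> \<eta> x) powr p)" by simp
      finally show ?thesis .
    qed
    \<comment> \<open>At each \<open>x\<close> at most one summand is nonzero, so the bounds for
      single lattice points hold simultaneously and their integrals add up to a multiple of
      \<open>\<Lambda>\<close>.\<close>
    define f0 where "f0 x = real (card \<Omega>) * (\<Sum>y\<in>Y. indicator (ball (- y) r0) x * L y)" for x
    have f0_le: "f0 x \<le> real (card Fl) * (\<Sum>(\<epsilon>, \<eta>)\<in>\<Omega>. norm (T \<epsilon> \<eta> x) powr p)" for x
    proof (cases "\<exists>y\<in>Y. x \<in> ball (- y) r0")
      case True
      then obtain y where y: "y \<in> Y" "x \<in> ball (- y) r0" by blast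
      have xy: "norm (x + y) \<le> r0" using y(2) by (simp add: dist_norm norm_minus_commute[of "- y"])
      have "x \<notin> ball (- y') r0" if y': "y' \<in> Y" "y' \<noteq> y" for y'
      proof
        assume "x \<in> ball (- y') r0"
        then have "norm (x + y') \<le> r0" by (simp add: dist_norm norm_minus_commute[of "- y'"])
        then have "norm (y - y') \<le> r0 + r0"
          using norm_triangle_ineq4[of "x + y" "x + y'"] xy by simp
        moreover have "1 \<le> norm (y - y')" using y y' Y(2) by (intro int_lattice_separated) auto
        ultimately show False using r0(3) by linarith
      qed
      then have "(\<Sum>y'\<in>Y - {y}. indicator (ball (- y') r0) x * L y') = 0"
        by (intro sum.neutral) (auto simp del: mem_ball)
      moreover have "indicator (ball (- y) r0) x = (1 :: real)" using y(2) by (rule indicator_simps(1))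
      ultimately have "f0 x = real (card \<Omega>) * L y"
        unfolding f0_def by (subst sum.remove[OF Y(1) y(1)]) (simp only: mult_1 add_0_right)
      then show ?thesis using point[OF y(1) xy] by simp
    next
      case False
      then have "(\<Sum>y\<in>Y. indicator (ball (- y) r0) x * L y) = 0" by (intro sum.neutral) auto
      then show ?thesis by (simp add: f0_def split_beta sum_nonneg)
    qed
    have T_meas[measurable]: "T \<epsilon> \<eta> \<in> borel_measurable borel" for \<epsilon> \<eta>
    proof -
      have "F \<eta> j \<in> borel_measurable borel" for j
        unfolding F_def dyadic_sum_def by (cases "j \<in> J") simp_all
      then have "(\<lambda>x. tensor_conv \<phi> (F \<eta>) (X x y)) \<in> borel_measurable borel" for y
        unfolding X_def by (intro tensor_conv_measurable \<phi>_meas)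
      then show ?thesis unfolding T_def[abs_def] by measurable
    qed
    have f0_int: "integrable lborel f0" "(\<integral>x. f0 x \<partial>lborel) = real (card \<Omega>) * (\<Sum>y\<in>Y. vol * L y)"
    proof -
      have ind: "integrable lborel (indicator (ball (- y) r0) :: real^'d \<Rightarrow> real)" for y
        using emeasure_lborel_ball_finite[of "- y" r0] by (intro integrable_real_indicator) auto
      have meas: "measure lborel (ball (- y) r0 :: (real^'d) set) = vol" for y
        using r0(1) by (simp add: content_ball vol_def d_def)
      show "integrable lborel f0"
        unfolding f0_def[abs_def] by (intro integrable_mult_right Bochner_Integration.integrable_sum integrable_mult_left ind)
      show "(\<integral>x. f0 x \<partial>lborel) = real (card \<Omega>) * (\<Sum>y\<in>Y. vol * L y)"
        unfolding f0_def integral_mult_right_zero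
        by (subst Bochner_Integration.integral_sum) (auto intro!: integrable_mult_left ind simp: meas)
    qed
    have f0_nonneg: "f0 x \<ge> 0" for x by (auto simp: f0_def L_def intro!: mult_nonneg_nonneg sum_nonneg)
    have "ennreal (\<integral>x. f0 x \<partial>lborel) = (\<integral>\<^sup>+x. ennreal (f0 x) \<partial>lborel)"
      using f0_nonneg by (intro nn_integral_eq_integral[symmetric] f0_int) auto
    also have "\<dots> \<le> (\<integral>\<^sup>+x. (\<Sum>w\<in>\<Omega>. ennreal (real (card Fl)) * ennreal (norm (T (fst w) (snd w) x) powr p)) \<partial>lborel)"
    proof (rule nn_integral_mono)
      fix x
      have "ennreal (f0 x) \<le> ennreal (\<Sum>w\<in>\<Omega>. real (card Fl) * (norm (T (fst w) (snd w) x) powr p))"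
        using f0_le[of x] by (intro ennreal_leI) (simp add: split_beta sum_distrib_left)
      also have "\<dots> = (\<Sum>w\<in>\<Omega>. ennreal (real (card Fl)) * ennreal (norm (T (fst w) (snd w) x) powr p))"
        by (subst sum_ennreal[symmetric]) (auto simp: ennreal_mult)
      finally show "ennreal (f0 x) \<le> (\<Sum>w\<in>\<Omega>. ennreal (real (card Fl)) * ennreal (norm (T (fst w) (snd w) x) powr p))" .
    qed
    also have "\<dots> = (\<Sum>w\<in>\<Omega>. ennreal (real (card Fl)) * (\<integral>\<^sup>+x. ennreal (norm (T (fst w) (snd w) x) powr p) \<partial>lborel))"
      by (subst nn_integral_sum) (auto simp: nn_integral_cmult)
    also have "\<dots> \<le> (\<Sum>w\<in>\<Omega>. ennreal (real (card Fl)) * ennreal (U powr p))"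
      using upper by (intro sum_mono mult_left_mono) auto
    also have "\<dots> = ennreal (real (card \<Omega>) * (real (card Fl) * U powr p))"
      by (simp add: ennreal_mult[symmetric] ennreal_of_nat_eq_real_of_nat)
    finally have "real (card \<Omega>) * (\<Sum>y\<in>Y. vol * L y) \<le> real (card \<Omega>) * (real (card Fl) * U powr p)"
      unfolding f0_int(2) by (subst (asm) ennreal_le_iff) auto
    then have "(\<Sum>y\<in>Y. vol * L y) \<le> real (card Fl) * U powr p" using ne\<Omega> by simp
    moreover have "(\<Sum>y\<in>Y. vol * L y) = (\<kappa> powr p * vol) * \<Lambda>"
      by (simp add: L_eq \<Lambda>_def sum_distrib_left ac_simps)
    moreover have "U powr p = (C0 * P) powr p * (sqrt \<Lambda> * real K powr b1) powr p"
      unfolding U_def by (simp only: powr_mult)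
    ultimately have "(\<kappa> powr p * vol) * \<Lambda> \<le> real (card Fl) * ((C0 * P) powr p * (sqrt \<Lambda> * real K powr b1) powr p)"
      by simp
    moreover have "\<kappa> powr p * vol > 0" using \<kappa> vol by simp
    ultimately have "\<Lambda> \<le> C1 * (sqrt \<Lambda> * real K powr b1) powr p"
      unfolding C1_def by (simp add: pos_le_divide_eq mult.commute mult.left_commute)
    moreover have "c1 * real K \<le> \<Lambda>"
      unfolding \<Lambda>_def Y_def S_def by (rule c1(2)) (simp add: m0_def)
    ultimately show "\<exists>\<Lambda>. c1 * real K \<le> \<Lambda> \<and> \<Lambda> \<le> C1 * (sqrt \<Lambda> * real K powr b1) powr p" by blast
  qed
qed

theorem theorem1p1:
  fixes pj :: "'n::finite \<Rightarrow> ereal"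
    and p :: real
    and s :: "'n \<Rightarrow> real"
    and \<phi> :: "real^'d::finite^'n \<Rightarrow> complex"
  assumes phi: "admissible_phi \<phi>"
    and pj_pos: "\<And>j. 0 < pj j"
    and p_pos: "0 < p"
    and holder: "(\<Sum>j\<in>UNIV. recip (pj j)) = 1 / p"
    and s_pos: "\<And>j. 0 < s j"
    and cond: "(\<exists>j. s j \<le> real CARD('d) / 2) \<or>
               (\<exists>J. (\<Sum>k\<in>J. s k / real CARD('d) - recip (pj k)) \<le> - 1 / 2)"
  shows "\<not> (\<exists>C::real. \<forall>\<sigma> :: real^'d^'n \<Rightarrow> complex. \<forall>f :: 'n \<Rightarrow> real^'d \<Rightarrow> complex.
            \<sigma> \<in> borel_measurable lborel \<longrightarrow> bounded (range \<sigma>) \<longrightarrow>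
            sobolev_L2 \<phi> s \<sigma> < \<infinity> \<longrightarrow> (\<forall>j. schwartz (f j)) \<longrightarrow>
            Lp_norm (ereal p) (multiplier_op \<sigma> f)
              \<le> ennreal C * sobolev_L2 \<phi> s \<sigma> * (\<Prod>j\<in>UNIV. hardy_norm (pj j) (f j)))"
  unfolding multiplier_estimate_def[symmetric]
proof
  assume "\<exists>C. multiplier_estimate \<phi> s pj p C"
  then obtain C where est: "multiplier_estimate \<phi> s pj p C" by blast
  note block = estimate_fails_block[of \<phi> s p pj C, OF phi s_pos p_pos pj_pos holder est]
  define d where "d = real CARD('d)"
  have d: "d > 0" by (simp add: d_def)
  from cond show False
  proof
    assume "\<exists>j. s j \<le> real CARD('d) / 2"
    then obtain j where j: "s j \<le> d / 2" by (auto simp: d_def)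
    show False
    proof (cases "1 < pj j")
      case True
      show False
        by (rule estimate_fails_low_regularity[of \<phi> s p pj C, OF phi s_pos p_pos pj_pos holder est j[unfolded d_def] True])
    next
      case False
      \<comment> \<open>With \<open>1 / p(j) \<ge> 1\<close> the block condition for
        \<open>{j}\<close> reads \<open>s j \<le> d / p(j) - d / 2\<close>, whose right side is at
        least \<open>d / 2\<close>.\<close>
      then have "1 \<le> recip (pj j)" using pj_pos[of j] by (cases "pj j") (auto simp: recip_def)
      then have "d * 1 \<le> d * recip (pj j)" using d by (intro mult_left_mono) auto
      then have "s j \<le> d * recip (pj j) - d / 2" using j by linarith
      then show False using block[of "{j}"] by (simp add: d_def)
    qed
  next
    assume "\<exists>J. (\<Sum>k\<in>J. s k / real CARD('d) - recip (pj k)) \<le> - 1 / 2"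
    then obtain J where J: "(\<Sum>k\<in>J. s k / d - recip (pj k)) \<le> - 1 / 2" by (auto simp: d_def)
    \<comment> \<open>The empty sum is 0 and exceeds -1/2.\<close>
    then have "J \<noteq> {}" by auto
    moreover have "d * (\<Sum>k\<in>J. s k / d - recip (pj k)) \<le> d * (- 1 / 2)" using J d by (intro mult_left_mono) auto
    then have "(\<Sum>k\<in>J. s k) \<le> d * (\<Sum>k\<in>J. recip (pj k)) - d / 2"
      using d by (simp add: sum_subtractf right_diff_distrib sum_divide_distrib[symmetric])
    ultimately show False using block[of J] by (simp add: d_def)
  qed
qed

end
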